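(* Let $R$ be a finite commutative ring with non-zero unity such that the total graph $\mathrm{T}(\Gamma(R))$ is planar. Then the following hold: (a) If $R$ is a local ring, then $R$ is a field or $R$ is isomorphic to one of the following $9$ rings: $$\mathbb{Z}_{4},\quad \mathbb{Z}_{2}[X]/(X^{2}),\quad \mathbb{Z}_{2}[X]/(X^{3}),\quad \mathbb{Z}_{2}[X,Y]/(X,Y)^{2},\quad \mathbb{Z}_{4}[X]/(2X,X^{2}),$$ $$\mathbb{Z}_{4}[X]/(2X,X^{2}-2),\quad \mathbb{Z}_{8},\quad \mathbb{F}_4[X]/(X^{2}),\quad \mathbb{Z}_{4}[X]/(X^{2}+X+1).$$ (b) If $R$ is not a local ring, then $R$ is isomorphic to $\mathbb{Z}_2\times\mathbb{Z}_2$ or $\mathbb{Z}_6$.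
   Context: For a commutative ring $R$ with non-zero unity, $\mathrm{Z}(R)$ denotes the set of zero-divisors of $R$ (including $0$). The total graph of $R$, denoted $\mathrm{T}(\Gamma(R))$, is the simple undirected graph whose vertices are all elements of $R$, in which two distinct elements $x,y\in R$ are adjacent if and only if $x+y\in \mathrm{Z}(R)$. A graph is planar if it has genus $0$, i.e. it can be embedded in the sphere (equivalently, in the plane) without edge crossings. $\mathbb{Z}_n$ denotes the ring of integers modulo $n$, and $\mathbb{F}_q$ denotes the field with $q$ elements. *)

theory Defs
  imports "HOL-Analysis.Analysis" "HOL-Number_Theory.Residues" "HOL-Algebra.Algebra"
begin

section \<open>Plane drawings of simple graphs\<close>

text \<open>
  A simple undirected graph is given by its vertex set \<open>V\<close> and its edge set \<open>E\<close>, a set of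
  two-element subsets of \<open>V\<close>. It is planar if it has a crossing-free drawing in the plane: vertices
  are distinct points, edges are simple arcs that meet the vertex points exactly in their two
  endpoints, and the arcs of two different edges share at most common endpoints of these edges.
\<close>

definition plane_drawing ::
  "'v set \<Rightarrow> 'v set set \<Rightarrow> ('v \<Rightarrow> complex) \<Rightarrow> ('v set \<Rightarrow> real \<Rightarrow> complex) \<Rightarrow> bool" where
  "plane_drawing V E p \<gamma> \<longleftrightarrow>
     inj_on p V \<and>
     (\<forall>e\<in>E. arc (\<gamma> e) \<and> {pathstart (\<gamma> e), pathfinish (\<gamma> e)} = p ` e \<and>
            path_image (\<gamma> e) \<inter> p ` V = p ` e) \<and>
     (\<forall>e\<in>E. \<forall>f\<in>E. e \<noteq> f \<longrightarrow> path_image (\<gamma> e) \<inter> path_image (\<gamma> f) \<subseteq> p ` (e \<inter> f))"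

definition planar :: "'v set \<Rightarrow> 'v set set \<Rightarrow> bool" where
  "planar V E \<longleftrightarrow> (\<exists>p \<gamma>. plane_drawing V E p \<gamma>)"


section \<open>The total graph of a ring\<close>

text \<open>Zero counts as a zero-divisor, provided that the ring is nonzero.\<close>

definition zero_divisors :: "('a, 'm) ring_scheme \<Rightarrow> 'a set" where
  "zero_divisors R =
     {x \<in> carrier R. \<exists>y\<in>carrier R. y \<noteq> \<zero>\<^bsub>R\<^esub> \<and> x \<otimes>\<^bsub>R\<^esub> y = \<zero>\<^bsub>R\<^esub>}"

definition total_graph_edges :: "('a, 'm) ring_scheme \<Rightarrow> 'a set set" where
  "total_graph_edges R =
     {{x, y} | x y. x \<in> carrier R \<and> y \<in> carrier R \<and> x \<noteq> y \<and> x \<oplus>\<^bsub>R\<^esub> y \<in> zero_divisors R}"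

definition planar_total_graph :: "('a, 'm) ring_scheme \<Rightarrow> bool" where
  "planar_total_graph R \<longleftrightarrow> planar (carrier R) (total_graph_edges R)"

definition local_ring :: "('a, 'm) ring_scheme \<Rightarrow> bool" where
  "local_ring R \<longleftrightarrow> cring R \<and> (\<exists>!M. maximalideal M R)"


section \<open>The rings in the classification\<close>

text \<open>
  In the polynomial ring \<open>P = UP A\<close>, the term \<open>monom P a n\<close> is the polynomial $a X^n$.
\<close>

definition quot_gen :: "('a, 'm) ring_scheme \<Rightarrow> 'a set \<Rightarrow> 'a set ring" where
  "quot_gen R S = R Quot (Idl\<^bsub>R\<^esub> S)"

abbreviation Z2 :: "int ring" where "Z2 \<equiv> residue_ring 2"
abbreviation Z4 :: "int ring" where "Z4 \<equiv> residue_ring 4"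

definition Z2X_X2 :: "(nat \<Rightarrow> int) set ring" where
  "Z2X_X2 = quot_gen (UP Z2) {monom (UP Z2) 1 2}"

definition Z2X_X3 :: "(nat \<Rightarrow> int) set ring" where
  "Z2X_X3 = quot_gen (UP Z2) {monom (UP Z2) 1 3}"

text \<open>
  $\mathbb{Z}_2[X,Y]$ is the iterated polynomial ring $(\mathbb{Z}_2[X])[Y]$. The ideal $(X,Y)^2$ is
  the product of the ideal $(X,Y)$ with itself.
\<close>

definition Z2XY_XY2 :: "(nat \<Rightarrow> nat \<Rightarrow> int) set ring" where
  "Z2XY_XY2 =
     (let P = UP (UP Z2);
          x = monom P (monom (UP Z2) 1 1) 0;
          y = monom P \<one>\<^bsub>UP Z2\<^esub> 1;
          I = Idl\<^bsub>P\<^esub> {x, y}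
      in P Quot (ideal_prod P I I))"

definition Z4X_2X_X2 :: "(nat \<Rightarrow> int) set ring" where
  "Z4X_2X_X2 = quot_gen (UP Z4) {monom (UP Z4) 2 1, monom (UP Z4) 1 2}"

definition Z4X_2X_X2m2 :: "(nat \<Rightarrow> int) set ring" where
  "Z4X_2X_X2m2 =
     quot_gen (UP Z4)
       {monom (UP Z4) 2 1, monom (UP Z4) 1 2 \<ominus>\<^bsub>UP Z4\<^esub> monom (UP Z4) 2 0}"

text \<open>
  The field with four elements is $\mathbb{Z}_2[X]/(X^2+X+1)$, the polynomial $X^2+X+1$ being
  irreducible over $\mathbb{Z}_2$.
\<close>

definition F4 :: "(nat \<Rightarrow> int) set ring" where
  "F4 = quot_gen (UP Z2)
     {monom (UP Z2) 1 2 \<oplus>\<^bsub>UP Z2\<^esub> monom (UP Z2) 1 1 \<oplus>\<^bsub>UP Z2\<^esub> \<one>\<^bsub>UP Z2\<^esub>}"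

definition F4X_X2 :: "(nat \<Rightarrow> (nat \<Rightarrow> int) set) set ring" where
  "F4X_X2 = quot_gen (UP F4) {monom (UP F4) \<one>\<^bsub>F4\<^esub> 2}"

definition Z4X_X2_X_1 :: "(nat \<Rightarrow> int) set ring" where
  "Z4X_X2_X_1 = quot_gen (UP Z4)
     {monom (UP Z4) 1 2 \<oplus>\<^bsub>UP Z4\<^esub> monom (UP Z4) 1 1 \<oplus>\<^bsub>UP Z4\<^esub> \<one>\<^bsub>UP Z4\<^esub>}"

end

theory Submission
  imports Defs
begin

text \<open>
  Planarity is used only through three obstructions: \<open>K\<^sub>5\<close>, \<open>K\<^sub>3\<^sub>,\<^sub>3\<close> and the prism \<open>K\<^sub>4 \<times> K\<^sub>2\<close>. Each of
  them contains a cycle with an odd circular sequence of chords (or paths) in which consecutive members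
  interleave on the cycle. By the Jordan curve theorem interleaving disjoint chords lie on opposite
  sides of the cycle, so sides would alternate along an odd circuit.

  In a local ring the maximal ideal \<open>M\<close> consists of zero divisors, hence spans a complete graph and has
  at most four elements. The cosets of \<open>1\<close> and \<open>-1\<close> force \<open>2 \<in> M\<close> when \<open>M\<close> has at least three, and
  the action of \<open>R\<close> on a socle element then determines the ring. A nonlocal finite ring has a
  nontrivial idempotent \<open>e\<close>, and the same obstructions bound both blocks \<open>eR\<close> and \<open>(1 - e)R\<close>.

  Each ring in the list is a quotient of a polynomial ring with an obvious homomorphism onto \<open>R\<close>.
  Normal forms bound the cardinality of the quotient from above, which makes this map bijective, so that
  the listed quotients need not be computed.
\<close>

section \<open>Crossing chords of a closed curve\<close>

text \<open>A socle element bounds the local case: if \<open>s\<close> is nonzero and killed by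
  \<open>M\<close>, then \<open>r \<mapsto> r s\<close> embeds \<open>R / M\<close> into
  \<open>M\<close>. At most four elements in \<open>M\<close> thus leave a residue field of order 2
  or 4 and a ring of order 4, 8 or 16. When \<open>M\<close> is zero there is no such
  \<open>s\<close>, and the ring is a field of any size.

  The prism is there because the K3,3 argument joins the coset \<open>a + J\<close> to
  \<open>-a + J\<close>, and these coincide when \<open>a + a\<close> lies in \<open>J\<close>. Then
  a four-element \<open>J\<close> yields neither K3,3 in this way nor K5, and a second clique
  \<open>e - J\<close> has to be brought in.

  The side of a chord is recorded as one truth value, whether it misses the inside of a fixed cycle.
  Interleaving makes two such values differ, and an odd circuit of inequalities between truth values
  is contradictory. The cycle has to be the same throughout, although each pair of chords cuts it at
  different points; this is why curves are treated as point sets and not as parametrised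
  loops.\<close>

definition arc_between :: "complex set \<Rightarrow> complex \<Rightarrow> complex \<Rightarrow> bool" where
  "arc_between S a b \<longleftrightarrow> (\<exists>g. arc g \<and> path_image g = S \<and> pathstart g = a \<and> pathfinish g = b)"

lemma arc_between_sym: "arc_between S a b \<Longrightarrow> arc_between S b a"
  unfolding arc_between_def by (metis arc_reversepath path_image_reversepath pathfinish_reversepath pathstart_reversepath)

lemma arc_between_join:
  assumes "arc_between S a b" "arc_between T b c" "S \<inter> T = {b}"
  shows "arc_between (S \<union> T) a c"
proof -
  obtain g h where "arc g" "path_image g = S" "pathstart g = a" "pathfinish g = b"
    "arc h" "path_image h = T" "pathstart h = b" "pathfinish h = c"
    using assms unfolding arc_between_def by metis
  then have "arc (g +++ h)" "path_image (g +++ h) = S \<union> T"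
    using assms(3) by (simp_all add: arc_join path_image_join)
  then show ?thesis unfolding arc_between_def
    using \<open>pathstart g = a\<close> \<open>pathfinish h = c\<close> by (intro exI[of _ "g +++ h"]) auto
qed

text \<open>For the closure clause: an arc is connected with more than one point, so all its points
  are limit points, and deleting the two ends does not change that. Hence a chord can end only in
  the closure of the region that contains its interior.\<close>

lemma arc_betweenD:
  assumes "arc_between S a b"
  shows "a \<in> S" "b \<in> S" "a \<noteq> b" "connected (S - {a, b})" "S \<subseteq> closure (S - {a, b})" "S - {a, b} \<noteq> {}"
proof -
  obtain g where g: "arc g" "path_image g = S" "pathstart g = a" "pathfinish g = b"
    using assms unfolding arc_between_def by metis
  then show "a \<in> S" "b \<in> S" by auto
  show "a \<noteq> b" using arc_distinct_ends g by metis
  have sp: "simple_path g" using g arc_imp_simple_path by blast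
  show conn: "connected (S - {a, b})" using connected_simple_path_endless[OF sp] g by simp
  show ne: "S - {a, b} \<noteq> {}" using nonempty_simple_path_endless[OF sp] g by simp
  have "connected S" using g connected_arc_image by blast
  moreover have S: "S = insert a (insert b (S - {a, b}))"
    using \<open>a \<in> S\<close> \<open>b \<in> S\<close> by blast
  ultimately have "x islimpt S" if "x \<in> S" for x
    using that \<open>a \<in> S\<close> \<open>b \<in> S\<close> \<open>a \<noteq> b\<close> by (intro connected_imp_perfect) auto
  then have "x islimpt (S - {a, b})" if "x \<in> S" for x
    using that S islimpt_insert by metis
  then show "S \<subseteq> closure (S - {a, b})" by (auto simp: closure_def)
qed

text \<open>The Jordan curve theorem for a closed curve given as two arcs with common ends, so that
  the same point set can be cut at different pairs of points.\<close>

lemma Jordan_arcs: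
  assumes "arc_between L a b" "arc_between R a b" "L \<inter> R = {a, b}"
  shows "open (inside (L \<union> R))" "open (outside (L \<union> R))" "connected (outside (L \<union> R))"
    "inside (L \<union> R) \<noteq> {}" "bounded (inside (L \<union> R))" "\<not> bounded (outside (L \<union> R))"
    "closure (inside (L \<union> R)) \<subseteq> inside (L \<union> R) \<union> (L \<union> R)" "compact (L \<union> R)"
    "connected (inside (L \<union> R))"
proof -
  obtain g h where gh: "arc g" "path_image g = L" "pathstart g = a" "pathfinish g = b"
    "arc h" "path_image h = R" "pathstart h = b" "pathfinish h = a"
    using assms(1) arc_between_sym[OF assms(2)] unfolding arc_between_def by metis
  have sp: "simple_path (g +++ h)"
    using gh assms(3) by (intro simple_path_join_loop) auto
  have im: "path_image (g +++ h) = L \<union> R" using gh by (simp add: path_image_join)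
  have cl: "pathfinish (g +++ h) = pathstart (g +++ h)" using gh by simp
  note J = Jordan_inside_outside[OF sp cl, unfolded im]
  show "open (inside (L \<union> R))" "open (outside (L \<union> R))" "connected (outside (L \<union> R))"
    "inside (L \<union> R) \<noteq> {}" "bounded (inside (L \<union> R))" "\<not> bounded (outside (L \<union> R))"
    "connected (inside (L \<union> R))"
    using J by auto
  show "compact (L \<union> R)" using im sp compact_simple_path_image by metis
  have "frontier (inside (L \<union> R)) = L \<union> R" using J by auto
  then show "closure (inside (L \<union> R)) \<subseteq> inside (L \<union> R) \<union> (L \<union> R)"
    by (metis closure_Un_frontier order_refl)
qed

lemma connected_disjoint_inside:
  fixes S :: "'a::real_normed_vector set"
  assumes "connected C" "C \<inter> S = {}" "C \<inter> inside S \<noteq> {}"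
  shows "C \<subseteq> inside S"
proof
  fix z assume "z \<in> C"
  obtain w where w: "w \<in> C" "w \<in> inside S" using assms(3) by auto
  have "connected_component (- S) w z"
    unfolding connected_component_def using assms w \<open>z \<in> C\<close> by (intro exI[of _ C]) auto
  then show "z \<in> inside S" using inside_same_component w by metis
qed

lemma connected_disjoint_outside:
  fixes S :: "'a::real_normed_vector set"
  assumes "connected C" "C \<inter> S = {}" "C \<inter> outside S \<noteq> {}"
  shows "C \<subseteq> outside S"
proof
  fix z assume "z \<in> C"
  obtain w where w: "w \<in> C" "w \<in> outside S" using assms(3) by auto
  have "connected_component (- S) w z"
    unfolding connected_component_def using assms w \<open>z \<in> C\<close> by (intro exI[of _ C]) auto
  then show "z \<in> outside S" using outside_same_component w by metis
qed

text \<open>The curves form a theta: \<open>D\<close> divides the inside into the insides of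
  \<open>L \<union> D\<close> and \<open>R \<union> D\<close>. The interior of \<open>E\<close> is
  connected and avoids all three arcs, so it would stay in one of the two regions, whose closure
  contains only one of \<open>x\<close> and \<open>y\<close>.\<close>

lemma crossing_chords_inside:
  assumes L: "arc_between L a b" and R: "arc_between R a b" and D: "arc_between D a b"
    and E: "arc_between E x y"
    and LR: "L \<inter> R = {a, b}" and LD: "L \<inter> D = {a, b}" and RD: "R \<inter> D = {a, b}"
    and x: "x \<in> L - {a, b}" and y: "y \<in> R - {a, b}"
    and EC: "E \<inter> (L \<union> R) = {x, y}" and DE: "D \<inter> E = {}"
    and Din: "D \<inter> inside (L \<union> R) \<noteq> {}"
  shows "E \<inter> inside (L \<union> R) = {}"
proof (rule ccontr)
  assume Ein: "E \<inter> inside (L \<union> R) \<noteq> {}"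
  obtain l r d where lrd: "arc l" "path_image l = L" "pathstart l = a" "pathfinish l = b"
    "arc r" "path_image r = R" "pathstart r = a" "pathfinish r = b"
    "arc d" "path_image d = D" "pathstart d = a" "pathfinish d = b"
    using L R D unfolding arc_between_def by metis
  have "a \<noteq> b" using arc_betweenD(3)[OF L] .
  obtain dis: "inside (L \<union> D) \<inter> inside (R \<union> D) = {}"
    and un: "inside (L \<union> D) \<union> inside (R \<union> D) \<union> (D - {a, b}) = inside (L \<union> R)"
    using split_inside_simple_closed_curve[of l a b r d] lrd \<open>a \<noteq> b\<close> LR LD RD Din
    by (auto simp: arc_imp_simple_path)
  let ?E = "E - {x, y}"
  have con: "connected ?E" using arc_betweenD(4)[OF E] .
  have nC: "inside (L \<union> R) \<inter> (L \<union> R) = {}" using inside_no_overlap[of "L \<union> R"] by auto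
  have sub: "?E \<subseteq> inside (L \<union> R)"
    using connected_disjoint_inside[OF con, of "L \<union> R"] EC Ein nC by blast
  have sub2: "?E \<subseteq> inside (L \<union> D) \<union> inside (R \<union> D)" using sub un DE by blast
  have nLD: "?E \<inter> (L \<union> D) = {}" "?E \<inter> (R \<union> D) = {}" using DE EC by auto
  have ne: "?E \<noteq> {}" using arc_betweenD(6)[OF E] .
  have cl: "x \<in> closure ?E" "y \<in> closure ?E" using arc_betweenD[OF E] by auto
  show False
  proof (cases "?E \<inter> inside (L \<union> D) = {}")
    case False
    have "?E \<subseteq> inside (L \<union> D)" using connected_disjoint_inside[OF con nLD(1) False] .
    then have "y \<in> inside (L \<union> D) \<union> (L \<union> D)"
      using cl(2) closure_mono Jordan_arcs(7)[OF L D LD] by blast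
    then show False using un nC y LR RD by blast
  next
    case True
    then have "?E \<inter> inside (R \<union> D) \<noteq> {}" using sub2 ne by blast
    then have "?E \<subseteq> inside (R \<union> D)" using connected_disjoint_inside[OF con nLD(2)] by blast
    then have "x \<in> inside (R \<union> D) \<union> (R \<union> D)"
      using cl(1) closure_mono Jordan_arcs(7)[OF R D RD] by blast
    then show False using un nC x LR LD by blast
  qed
qed

lemma arc_between_image:
  assumes "arc_between S a b" "continuous_on S f" "inj_on f S"
  shows "arc_between (f ` S) (f a) (f b)"
proof -
  obtain g where g: "arc g" "path_image g = S" "pathstart g = a" "pathfinish g = b"
    using assms unfolding arc_between_def by metis
  have "arc (f \<circ> g)" using g assms unfolding arc_def
    by (auto intro: path_continuous_image comp_inj_on simp: path_image_def)
  then show ?thesis unfolding arc_between_def using g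
    by (intro exI[of _ "f \<circ> g"]) (auto simp: path_image_compose pathstart_compose pathfinish_compose)
qed

text \<open>An inversion centred inside the curve exchanges the two sides, which reduces outer chords to inner ones.\<close>

lemma inversion_outside_to_inside:
  fixes S :: "complex set"
  assumes S: "compact S" and out: "connected (outside S)" and z0: "z0 \<in> inside S"
    and op: "open (inside S)" and w: "w \<in> outside S"
    and out': "connected (outside ((\<lambda>z. inverse (z - z0)) ` S))"
              "open (outside ((\<lambda>z. inverse (z - z0)) ` S))"
              "\<not> bounded (outside ((\<lambda>z. inverse (z - z0)) ` S))"
  shows "inverse (w - z0) \<in> inside ((\<lambda>z. inverse (z - z0)) ` S)"
proof (rule ccontr)
  let ?i = "\<lambda>z. inverse (z - z0)" let ?j = "\<lambda>u. inverse u + z0"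
  have ji: "?j (?i z) = z" for z by simp
  assume nin: "?i w \<notin> inside (?i ` S)"
  have wS: "w \<notin> S" using w outside_no_overlap[of S] by (meson disjoint_iff)
  have wz: "w \<noteq> z0" using w z0 inside_Int_outside[of S] by (meson disjoint_iff)
  have "?i ` S \<subseteq> - {?i w}" using wS by auto
  then have "?i w \<notin> ?i ` S" by auto
  then have wo: "?i w \<in> outside (?i ` S)" using nin inside_Un_outside[of "?i ` S"] by blast
  obtain r where r: "r > 0" "ball z0 r \<subseteq> inside S" using op z0 open_contains_ball by blast
  obtain u where u: "u \<in> outside (?i ` S)" "cmod u > 1 / r"
    using out'(3) by (metis bounded_iff linorder_not_less)
  have u0: "u \<noteq> 0" using u r by (metis divide_pos_pos norm_zero not_less_iff_gr_or_eq zero_less_one)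
  \<comment> \<open>The origin is the only point where \<open>?j\<close> is discontinuous, and an
    open connected planar set stays connected without it. The image of \<open>?O\<close> under
    \<open>?j\<close> avoids \<open>S\<close> and contains \<open>w\<close>; as the outside is
    unbounded, it also contains a point \<open>?j u\<close> of the ball around \<open>z0\<close>,
    which is inside.\<close>
  let ?O = "outside (?i ` S) - {0}"
  have conO: "connected ?O" using out' by (intro connected_open_delete) auto
  have conJ: "connected (?j ` ?O)"
    by (intro connected_continuous_image conO continuous_intros) auto
  have "?j ` ?O \<inter> S = {}"
  proof -
    have "?j v \<notin> S" if "v \<in> ?O" for v
    proof
      assume "?j v \<in> S"
      then have "v \<in> ?i ` S" by (intro image_eqI[of _ _ "?j v"]) auto
      then show False using that outside_no_overlap[of "?i ` S"] by (meson DiffD1 disjoint_iff)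
    qed
    then show ?thesis by blast
  qed
  moreover have "w \<in> ?j ` ?O" using wo wz by (intro image_eqI[of _ _ "?i w"]) auto
  ultimately have sub: "?j ` ?O \<subseteq> outside S" using w connected_disjoint_outside[OF conJ] by blast
  have "cmod (inverse u) < r"
  proof -
    have "cmod u > 0" using u0 by simp
    have "1 < cmod u * r" using u(2) r(1) by (simp add: field_simps)
    then show ?thesis using \<open>cmod u > 0\<close> by (simp add: norm_divide inverse_eq_divide divide_less_eq mult.commute)
  qed
  then have "?j u \<in> inside S" using r by (auto simp: dist_norm subset_iff)
  moreover have "?j u \<in> ?j ` ?O" using u u0 by blast
  ultimately show False using sub inside_Int_outside[of S] by blast
qed

text \<open>By \<open>crossing_chords_inside\<close> at most one of the chords enters the inside. If
  neither did, both would run outside, and inversion about a point of the inside would turn them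
  into two interleaving inner chords.\<close>

lemma crossing_chords:
  assumes L: "arc_between L a b" and R: "arc_between R a b" and D: "arc_between D a b"
    and E: "arc_between E x y"
    and LR: "L \<inter> R = {a, b}" and LD: "L \<inter> D = {a, b}" and RD: "R \<inter> D = {a, b}"
    and x: "x \<in> L - {a, b}" and y: "y \<in> R - {a, b}"
    and EC: "E \<inter> (L \<union> R) = {x, y}" and DE: "D \<inter> E = {}"
  shows "(D \<inter> inside (L \<union> R) = {}) \<noteq> (E \<inter> inside (L \<union> R) = {})"
proof -
  have "D \<inter> inside (L \<union> R) \<noteq> {}" if out: "E \<inter> inside (L \<union> R) = {}"
  proof
    assume out2: "D \<inter> inside (L \<union> R) = {}"
    let ?C = "L \<union> R"
    note J = Jordan_arcs[OF L R LR]
    obtain z0 where z0: "z0 \<in> inside ?C" using J by auto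
    let ?i = "\<lambda>z. inverse (z - z0)"
    let ?U = "L \<union> R \<union> D \<union> E"
    \<comment> \<open>The centre has to miss all four arcs for \<open>?i\<close> to be continuous on
      them. Injectivity holds even at the centre, where \<open>inverse 0 = 0\<close>.\<close>
    have zU: "z0 \<notin> ?U" using z0 out out2 inside_no_overlap[of ?C] by blast
    have cont: "continuous_on ?U ?i" using zU by (auto intro!: continuous_intros)
    have inj: "inj_on ?i ?U" by (auto simp: inj_on_def)
    have img: "arc_between (?i ` L) (?i a) (?i b)" "arc_between (?i ` R) (?i a) (?i b)"
      "arc_between (?i ` D) (?i a) (?i b)" "arc_between (?i ` E) (?i x) (?i y)"
      using L R D E by (auto intro!: arc_between_image intro: continuous_on_subset[OF cont] inj_on_subset[OF inj])
    have int: "?i ` A \<inter> ?i ` B = ?i ` (A \<inter> B)" if "A \<subseteq> ?U" "B \<subseteq> ?U" for A B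
      using inj_on_image_Int[OF inj that] by simp
    have LR': "?i ` L \<inter> ?i ` R = {?i a, ?i b}" using int[of L R] LR by auto
    have un: "?i ` L \<union> ?i ` R = ?i ` ?C" by blast
    note J' = Jordan_arcs[OF img(1,2) LR', unfolded un]
    have key: "?i w \<in> inside (?i ` ?C)" if "w \<in> outside ?C" for w
      using inversion_outside_to_inside[OF J(8,3) z0 J(1) that J'(3,2,6)] .
    have D': "\<exists>w\<in>D. w \<in> outside ?C"
    proof -
      obtain w where "w \<in> D - {a, b}" using arc_betweenD(6)[OF D] by auto
      then have "w \<notin> ?C" "w \<notin> inside ?C" using out2 LD RD by auto
      then show ?thesis using \<open>w \<in> D - {a, b}\<close> inside_Un_outside[of ?C] by blast
    qed
    have E': "\<exists>w\<in>E. w \<in> outside ?C"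
    proof -
      obtain w where "w \<in> E - {x, y}" using arc_betweenD(6)[OF E] by auto
      then have "w \<notin> ?C" "w \<notin> inside ?C" using out EC by auto
      then show ?thesis using \<open>w \<in> E - {x, y}\<close> inside_Un_outside[of ?C] by blast
    qed
    have ii: "?i u = ?i v \<longleftrightarrow> u = v" for u v by simp
    have "?i ` E \<inter> inside (?i ` L \<union> ?i ` R) = {}"
    proof (rule crossing_chords_inside[OF img LR'])
      show "?i ` L \<inter> ?i ` D = {?i a, ?i b}" "?i ` R \<inter> ?i ` D = {?i a, ?i b}"
        using int[of L D] int[of R D] LD RD by auto
      show "?i x \<in> ?i ` L - {?i a, ?i b}" "?i y \<in> ?i ` R - {?i a, ?i b}" using x y by auto
      show "?i ` E \<inter> (?i ` L \<union> ?i ` R) = {?i x, ?i y}" using int[of E ?C] EC un by auto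
      show "?i ` D \<inter> ?i ` E = {}" using int[of D E] DE by auto
      show "?i ` D \<inter> inside (?i ` L \<union> ?i ` R) \<noteq> {}" using D' key un by auto
    qed
    then show False using E' key un by auto
  qed
  moreover have "E \<inter> inside (L \<union> R) = {}" if "D \<inter> inside (L \<union> R) \<noteq> {}"
    using crossing_chords_inside[OF assms that] .
  ultimately show ?thesis by blast
qed

section \<open>Paths in plane drawings\<close>

fun path_edges :: "'v list \<Rightarrow> 'v set set" where
  "path_edges (u # v # vs) = insert {u, v} (path_edges (v # vs))"
| "path_edges vs = {}"

definition graph_path :: "'v set \<Rightarrow> 'v set set \<Rightarrow> 'v list \<Rightarrow> bool" where
  "graph_path V E vs \<longleftrightarrow> 2 \<le> length vs \<and> distinct vs \<and> set vs \<subseteq> V \<and> path_edges vs \<subseteq> E"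

text \<open>Indexed by edge sets instead of paths, so that a cycle has the same trace however it is
  cut into two paths.\<close>

definition trace :: "('v set \<Rightarrow> real \<Rightarrow> complex) \<Rightarrow> 'v set set \<Rightarrow> complex set" where
  "trace \<gamma> F = (\<Union>e\<in>F. path_image (\<gamma> e))"

lemma trace_Un: "trace \<gamma> (F \<union> G) = trace \<gamma> F \<union> trace \<gamma> G"
  by (auto simp: trace_def)

lemma path_edges_subset: "e \<in> path_edges vs \<Longrightarrow> e \<subseteq> set vs"
  by (induction vs rule: path_edges.induct) auto

lemma Union_path_edges: "2 \<le> length vs \<Longrightarrow> \<Union> (path_edges vs) = set vs"
proof (induction vs rule: path_edges.induct)
  case (1 u v vs) then show ?case by (cases vs) auto
qed auto

lemma plane_drawingD:
  assumes "plane_drawing V E p \<gamma>" "e \<in> E"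
  shows "arc (\<gamma> e)" "{pathstart (\<gamma> e), pathfinish (\<gamma> e)} = p ` e" "p ` e \<subseteq> path_image (\<gamma> e)"
    "f \<in> E \<Longrightarrow> e \<noteq> f \<Longrightarrow> path_image (\<gamma> e) \<inter> path_image (\<gamma> f) \<subseteq> p ` (e \<inter> f)"
proof -
  have *: "arc (\<gamma> e) \<and> {pathstart (\<gamma> e), pathfinish (\<gamma> e)} = p ` e \<and> path_image (\<gamma> e) \<inter> p ` V = p ` e"
    using assms unfolding plane_drawing_def by (elim conjE) (rule bspec)
  then show "arc (\<gamma> e)" "{pathstart (\<gamma> e), pathfinish (\<gamma> e)} = p ` e" by blast+
  show "p ` e \<subseteq> path_image (\<gamma> e)" using * by (metis Int_lower1)
  show "f \<in> E \<Longrightarrow> e \<noteq> f \<Longrightarrow> path_image (\<gamma> e) \<inter> path_image (\<gamma> f) \<subseteq> p ` (e \<inter> f)"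
    using assms unfolding plane_drawing_def by meson
qed

text \<open>Turns intersections of curves into intersections of vertex sets; every incidence
  condition on arcs below becomes a finite question about vertices.\<close>

lemma trace_Int:
  assumes "plane_drawing V E p \<gamma>" "F \<subseteq> E" "G \<subseteq> E" "F \<inter> G = {}" "\<Union> F \<subseteq> V" "\<Union> G \<subseteq> V"
  shows "trace \<gamma> F \<inter> trace \<gamma> G = p ` (\<Union> F \<inter> \<Union> G)"
proof
  show "trace \<gamma> F \<inter> trace \<gamma> G \<subseteq> p ` (\<Union> F \<inter> \<Union> G)"
  proof
    fix z assume "z \<in> trace \<gamma> F \<inter> trace \<gamma> G"
    then obtain e f where ef: "e \<in> F" "f \<in> G" "z \<in> path_image (\<gamma> e) \<inter> path_image (\<gamma> f)"
      unfolding trace_def by auto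
    then have "e \<in> E" "f \<in> E" "e \<noteq> f" using assms by auto
    then have "z \<in> p ` (e \<inter> f)" using plane_drawingD(4)[OF assms(1)] ef(3) by blast
    then show "z \<in> p ` (\<Union> F \<inter> \<Union> G)" using ef by auto
  qed
  have *: "p ` \<Union> H \<subseteq> trace \<gamma> H" if "H \<subseteq> E" for H
    using plane_drawingD(3)[OF assms(1)] that unfolding trace_def by fast
  show "p ` (\<Union> F \<inter> \<Union> G) \<subseteq> trace \<gamma> F \<inter> trace \<gamma> G"
    using *[OF assms(2)] *[OF assms(3)] by blast
qed

text \<open>By distinctness of the vertices, the first edge and the rest of the path share only the
  vertex \<open>v\<close>, and arcs that meet in just one common end concatenate to an arc.\<close>

lemma arc_between_path:
  assumes "plane_drawing V E p \<gamma>" "graph_path V E vs"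
  shows "arc_between (trace \<gamma> (path_edges vs)) (p (hd vs)) (p (last vs))"
  using assms(2)
proof (induction vs rule: path_edges.induct)
  case (1 u v vs)
  have uv: "{u, v} \<in> E" "u \<noteq> v" "u \<in> V" "v \<in> V" using 1(2) by (auto simp: graph_path_def)
  then have uv': "arc (\<gamma> {u, v})" "{pathstart (\<gamma> {u, v}), pathfinish (\<gamma> {u, v})} = {p u, p v}"
    using plane_drawingD(1,2)[OF assms(1)] by fastforce+
  have "arc_between (path_image (\<gamma> {u, v})) (pathstart (\<gamma> {u, v})) (pathfinish (\<gamma> {u, v}))"
    using uv' unfolding arc_between_def by auto
  \<comment> \<open>A drawing determines only the set of the two ends of an edge, so its arc may
    have to be reversed.\<close>
  then have e: "arc_between (trace \<gamma> {{u, v}}) (p u) (p v)"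
    using uv'(2) arc_between_sym by (auto simp: trace_def doubleton_eq_iff)
  show ?case
  proof (cases vs)
    case Nil
    then show ?thesis using e by simp
  next
    case (Cons w ws)
    then have gp: "graph_path V E (v # vs)" using 1(2) by (auto simp: graph_path_def)
    have u: "u \<notin> set (v # vs)" using 1(2) by (auto simp: graph_path_def)
    then have "{u, v} \<notin> path_edges (v # vs)" using path_edges_subset by blast
    then have "trace \<gamma> {{u, v}} \<inter> trace \<gamma> (path_edges (v # vs)) = p ` (\<Union> {{u, v}} \<inter> \<Union> (path_edges (v # vs)))"
      using gp uv by (intro trace_Int[OF assms(1)]) (auto simp: graph_path_def Union_path_edges)
    also have "\<dots> = {p v}" using gp u by (auto simp: graph_path_def Union_path_edges)
    finally have "arc_between (trace \<gamma> {{u, v}} \<union> trace \<gamma> (path_edges (v # vs))) (p u) (p (last (v # vs)))"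
      using arc_between_join[OF e] 1(1)[OF gp] by simp
    then show ?thesis using Cons by (simp add: trace_def)
  qed
qed (auto simp: graph_path_def)

text \<open>The combinatorial form of \<open>crossing_chords\<close>: \<open>ls\<close> and
  \<open>rs\<close> are the two halves of the cycle between \<open>a\<close> and \<open>b\<close>,
  while \<open>ds\<close> and \<open>es\<close> are the interleaving chords. \<open>C\<close> names
  the whole edge set of the cycle, so that instances with different halves speak of the same
  inside.\<close>

lemma crossing_graph_paths:
  assumes pd: "plane_drawing V E p \<gamma>"
    and gp: "graph_path V E ls" "graph_path V E rs" "graph_path V E ds" "graph_path V E es"
    and ends: "hd ls = a" "last ls = b" "hd rs = a" "last rs = b" "hd ds = a" "last ds = b"
      "hd es = x" "last es = y"
    and int: "set ls \<inter> set rs = {a, b}" "set ls \<inter> set ds = {a, b}" "set rs \<inter> set ds = {a, b}"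
      "x \<in> set ls - {a, b}" "y \<in> set rs - {a, b}"
      "set es \<inter> (set ls \<union> set rs) = {x, y}" "set ds \<inter> set es = {}"
    and edg: "path_edges ls \<inter> path_edges rs = {}" "path_edges ls \<inter> path_edges ds = {}"
      "path_edges rs \<inter> path_edges ds = {}" "(path_edges ls \<union> path_edges rs) \<inter> path_edges es = {}"
    and C: "path_edges ls \<union> path_edges rs = C"
  shows "(trace \<gamma> (path_edges ds) \<inter> inside (trace \<gamma> C) = {}) \<noteq>
         (trace \<gamma> (path_edges es) \<inter> inside (trace \<gamma> C) = {})"
proof -
  have sub: "\<Union> (path_edges vs) = set vs" "path_edges vs \<subseteq> E" "set vs \<subseteq> V" if "graph_path V E vs" for vs
    using that Union_path_edges by (auto simp: graph_path_def)
  have "inj_on p V" using pd unfolding plane_drawing_def by (elim conjE)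
  then have inj: "p v \<in> p ` S \<longleftrightarrow> v \<in> S" if "S \<subseteq> V" "v \<in> V" for v S
    using that inj_on_image_mem_iff by metis
  have xy: "x \<in> V" "y \<in> V" "a \<in> V" "b \<in> V"
    using int(1,4,5) sub(3)[OF gp(1)] sub(3)[OF gp(2)] by blast+
  have neq: "p v \<notin> {p a, p b}" if "v \<in> V" "v \<notin> {a, b}" for v
    using inj[of "{a, b}" v] that xy by auto
  have T: "trace \<gamma> F \<inter> trace \<gamma> G = p ` (\<Union> F \<inter> \<Union> G)"
    if "F \<subseteq> E" "G \<subseteq> E" "F \<inter> G = {}" "\<Union> F \<subseteq> V" "\<Union> G \<subseteq> V" for F G
    using trace_Int[OF pd that] .
  have mem: "p v \<in> trace \<gamma> (path_edges vs)" if "graph_path V E vs" "v \<in> set vs" for v vs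
  proof -
    have "trace \<gamma> (path_edges vs) \<inter> trace \<gamma> (path_edges vs) \<supseteq> p ` (\<Union> (path_edges vs))"
      using plane_drawingD(3)[OF pd] sub(2)[OF that(1)] unfolding trace_def by fast
    then show ?thesis using that sub by auto
  qed
  have "(trace \<gamma> (path_edges ds) \<inter> inside (trace \<gamma> (path_edges ls) \<union> trace \<gamma> (path_edges rs)) = {}) \<noteq>
        (trace \<gamma> (path_edges es) \<inter> inside (trace \<gamma> (path_edges ls) \<union> trace \<gamma> (path_edges rs)) = {})"
  proof (rule crossing_chords)
    show "arc_between (trace \<gamma> (path_edges ls)) (p a) (p b)" "arc_between (trace \<gamma> (path_edges rs)) (p a) (p b)"
      "arc_between (trace \<gamma> (path_edges ds)) (p a) (p b)" "arc_between (trace \<gamma> (path_edges es)) (p x) (p y)"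
      using arc_between_path[OF pd gp(1)] arc_between_path[OF pd gp(2)]
        arc_between_path[OF pd gp(3)] arc_between_path[OF pd gp(4)] by (simp_all add: ends)
    show "trace \<gamma> (path_edges ls) \<inter> trace \<gamma> (path_edges rs) = {p a, p b}"
      "trace \<gamma> (path_edges ls) \<inter> trace \<gamma> (path_edges ds) = {p a, p b}"
      "trace \<gamma> (path_edges rs) \<inter> trace \<gamma> (path_edges ds) = {p a, p b}"
      using T edg sub gp int by simp_all
    show "p x \<in> trace \<gamma> (path_edges ls) - {p a, p b}" "p y \<in> trace \<gamma> (path_edges rs) - {p a, p b}"
      using mem gp int neq xy by auto
    have "trace \<gamma> (path_edges es) \<inter> trace \<gamma> (path_edges ls \<union> path_edges rs) = p ` (set es \<inter> (set ls \<union> set rs))"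
      using T[of "path_edges es" "path_edges ls \<union> path_edges rs"] edg sub gp by (simp add: Int_commute)
    then show "trace \<gamma> (path_edges es) \<inter> (trace \<gamma> (path_edges ls) \<union> trace \<gamma> (path_edges rs)) = {p x, p y}"
      using int by (simp add: trace_Un)
    \<comment> \<open>Disjoint vertex sets leave only the empty set as a possible common edge, and
      edges are nonempty.\<close>
    have "path_edges ds \<inter> path_edges es = {}"
    proof -
      have "{} \<notin> path_edges ds" by (induction ds rule: path_edges.induct) auto
      then show ?thesis using path_edges_subset int(7) by (metis disjoint_iff subset_empty le_inf_iff)
    qed
    then show "trace \<gamma> (path_edges ds) \<inter> trace \<gamma> (path_edges es) = {}"
      using T sub gp int by simp
  qed
  then show ?thesis using C by (simp flip: trace_Un)
qed

section \<open>Three nonplanar graphs\<close>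

lemma nonplanar_K33:
  assumes d: "distinct [a1,a2,a3,b1,b2,b3]" and V: "{a1,a2,a3,b1,b2,b3} \<subseteq> V"
    and E: "\<And>a b. a \<in> {a1,a2,a3} \<Longrightarrow> b \<in> {b1,b2,b3} \<Longrightarrow> {a, b} \<in> E"
  shows "\<not> planar V E"
proof
  assume "planar V E"
  then obtain p \<gamma> where pd: "plane_drawing V E p \<gamma>" unfolding planar_def by blast
  have d': "distinct [b3,b2,b1,a3,a2,a1]" using d by auto
  have E': "{a, b} \<in> E" "{b, a} \<in> E" if "a \<in> {a1,a2,a3}" "b \<in> {b1,b2,b3}" for a b
    using E[OF that] by (simp_all add: insert_commute)
  \<comment> \<open>The hexagon \<open>a1 b1 a2 b2 a3 b3\<close>. Its three long diagonals
    interleave pairwise, and three truth values cannot be pairwise different. The last diagonal of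
    the circuit is the first one traversed backwards.\<close>
  let ?C = "{{a1,b1},{b1,a2},{a2,b2},{b2,a3},{a3,b3},{b3,a1}}"
  define s where "s vs \<longleftrightarrow> trace \<gamma> (path_edges vs) \<inter> inside (trace \<gamma> ?C) = {}" for vs
  note cr = crossing_graph_paths[OF pd, where C = ?C, folded s_def]
  have "s [a1,b2] \<noteq> s [b1,a3]"
    by (rule cr[of "[a1,b1,a2,b2]" "[a1,b3,a3,b2]" "[a1,b2]" "[b1,a3]" a1 b2 b1 a3])
      (use d d' V in \<open>simp_all add: graph_path_def E' doubleton_eq_iff insert_commute\<close>)
  moreover have "s [b1,a3] \<noteq> s [a2,b3]"
    by (rule cr[of "[b1,a2,b2,a3]" "[b1,a1,b3,a3]" "[b1,a3]" "[a2,b3]" b1 a3 a2 b3])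
      (use d d' V in \<open>simp_all add: graph_path_def E' doubleton_eq_iff insert_commute\<close>)
  moreover have "s [a2,b3] \<noteq> s [b2,a1]"
    by (rule cr[of "[a2,b2,a3,b3]" "[a2,b1,a1,b3]" "[a2,b3]" "[b2,a1]" a2 b3 b2 a1])
      (use d d' V in \<open>simp_all add: graph_path_def E' doubleton_eq_iff insert_commute\<close>)
  moreover have "s [b2,a1] = s [a1,b2]" by (simp add: s_def insert_commute)
  ultimately show False by blast
qed

text \<open>In the pentagon \<open>v1 v2 v3 v4 w\<close> each of the five diagonals interleaves with
  the next one in cyclic order, and five is odd.\<close>

lemma nonplanar_K5:
  assumes d: "distinct [v1,v2,v3,v4,w]" and V: "{v1,v2,v3,v4,w} \<subseteq> V"
    and E: "\<And>a b. a \<in> {v1,v2,v3,v4,w} \<Longrightarrow> b \<in> {v1,v2,v3,v4,w} \<Longrightarrow> a \<noteq> b \<Longrightarrow> {a, b} \<in> E"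
  shows "\<not> planar V E"
proof
  assume "planar V E"
  then obtain p \<gamma> where pd: "plane_drawing V E p \<gamma>" unfolding planar_def by blast
  have d': "distinct [w,v4,v3,v2,v1]" using d by auto
  note E' = E
  let ?C = "{{v1,v2},{v2,v3},{v3,v4},{v4,w},{w,v1}}"
  define s where "s vs \<longleftrightarrow> trace \<gamma> (path_edges vs) \<inter> inside (trace \<gamma> ?C) = {}" for vs
  note cr = crossing_graph_paths[OF pd, where C = ?C, folded s_def]
  have "s [v1,v3] \<noteq> s [v2,v4]"
    by (rule cr[of "[v1,v2,v3]" "[v1,w,v4,v3]" "[v1,v3]" "[v2,v4]" v1 v3 v2 v4])
      (use d d' V in \<open>simp_all add: graph_path_def E' doubleton_eq_iff insert_commute\<close>)
  moreover have "s [v2,v4] \<noteq> s [v3,w]"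
    by (rule cr[of "[v2,v3,v4]" "[v2,v1,w,v4]" "[v2,v4]" "[v3,w]" v2 v4 v3 w])
      (use d d' V in \<open>simp_all add: graph_path_def E' doubleton_eq_iff insert_commute\<close>)
  moreover have "s [v3,w] \<noteq> s [v4,v1]"
    by (rule cr[of "[v3,v4,w]" "[v3,v2,v1,w]" "[v3,w]" "[v4,v1]" v3 w v4 v1])
      (use d d' V in \<open>simp_all add: graph_path_def E' doubleton_eq_iff insert_commute\<close>)
  moreover have "s [v4,v1] \<noteq> s [w,v2]"
    by (rule cr[of "[v4,w,v1]" "[v4,v3,v2,v1]" "[v4,v1]" "[w,v2]" v4 v1 w v2])
      (use d d' V in \<open>simp_all add: graph_path_def E' doubleton_eq_iff insert_commute\<close>)
  moreover have "s [w,v2] \<noteq> s [v1,v3]"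
    by (rule cr[of "[w,v1,v2]" "[w,v4,v3,v2]" "[w,v2]" "[v1,v3]" w v2 v1 v3])
      (use d d' V in \<open>simp_all add: graph_path_def E' doubleton_eq_iff insert_commute\<close>)
  ultimately show False by blast
qed

text \<open>Contracting the copy \<open>w1 w2 w3 w4\<close> to a point gives K5, and the circuit is
  the one of \<open>nonplanar_K5\<close> with its fifth vertex blown up: the cycle passes through
  the copy along the edge from \<open>w4\<close> to \<open>w1\<close>, and the two diagonals at the
  fifth vertex become the paths through \<open>w3\<close> and \<open>w2\<close> that end in
  \<open>w1\<close>.\<close>

lemma nonplanar_K4_box_K2:
  assumes d: "distinct [v1,v2,v3,v4,w1,w2,w3,w4]" and V: "{v1,v2,v3,v4,w1,w2,w3,w4} \<subseteq> V"
    and E: "\<And>a b. a \<in> {v1,v2,v3,v4} \<Longrightarrow> b \<in> {v1,v2,v3,v4} \<Longrightarrow> a \<noteq> b \<Longrightarrow> {a, b} \<in> E"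
      "\<And>a b. a \<in> {w1,w2,w3,w4} \<Longrightarrow> b \<in> {w1,w2,w3,w4} \<Longrightarrow> a \<noteq> b \<Longrightarrow> {a, b} \<in> E"
      "{v1,w1} \<in> E" "{v2,w2} \<in> E" "{v3,w3} \<in> E" "{v4,w4} \<in> E"
  shows "\<not> planar V E"
proof
  assume "planar V E"
  then obtain p \<gamma> where pd: "plane_drawing V E p \<gamma>" unfolding planar_def by blast
  have d': "distinct [w4,w3,w2,w1,v4,v3,v2,v1]" using d by auto
  have "{w1,v1} \<in> E" "{w2,v2} \<in> E" "{w3,v3} \<in> E" "{w4,v4} \<in> E"
    using E(3-6) by (simp_all add: insert_commute)
  note E' = E this
  let ?C = "{{v1,v2},{v2,v3},{v3,v4},{v4,w4},{w4,w1},{w1,v1}}"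
  define s where "s vs \<longleftrightarrow> trace \<gamma> (path_edges vs) \<inter> inside (trace \<gamma> ?C) = {}" for vs
  note cr = crossing_graph_paths[OF pd, where C = ?C, folded s_def]
  have "s [v1,v3] \<noteq> s [v2,v4]"
    by (rule cr[of "[v1,v2,v3]" "[v1,w1,w4,v4,v3]" "[v1,v3]" "[v2,v4]" v1 v3 v2 v4])
      (use d d' V in \<open>simp_all add: graph_path_def E' doubleton_eq_iff insert_commute\<close>)
  moreover have "s [v2,v4] \<noteq> s [v3,w3,w1]"
    by (rule cr[of "[v2,v3,v4]" "[v2,v1,w1,w4,v4]" "[v2,v4]" "[v3,w3,w1]" v2 v4 v3 w1])
      (use d d' V in \<open>simp_all add: graph_path_def E' doubleton_eq_iff insert_commute\<close>)
  moreover have "s [v3,w3,w1] \<noteq> s [v4,v1]"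
    by (rule cr[of "[v3,v4,w4,w1]" "[v3,v2,v1,w1]" "[v3,w3,w1]" "[v4,v1]" v3 w1 v4 v1])
      (use d d' V in \<open>simp_all add: graph_path_def E' doubleton_eq_iff insert_commute\<close>)
  moreover have "s [v4,v1] \<noteq> s [w1,w2,v2]"
    by (rule cr[of "[v4,w4,w1,v1]" "[v4,v3,v2,v1]" "[v4,v1]" "[w1,w2,v2]" v4 v1 w1 v2])
      (use d d' V in \<open>simp_all add: graph_path_def E' doubleton_eq_iff insert_commute\<close>)
  moreover have "s [w1,w2,v2] \<noteq> s [v1,v3]"
    by (rule cr[of "[w1,v1,v2]" "[w1,w4,v4,v3,v2]" "[w1,w2,v2]" "[v1,v3]" w1 v2 v1 v3])
      (use d d' V in \<open>simp_all add: graph_path_def E' doubleton_eq_iff insert_commute\<close>)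
  ultimately show False by blast
qed

section \<open>Generated rings and their cardinality\<close>

text \<open>Generation without negation. In positive characteristic nothing is lost, since
  \<open>-x\<close> is a sum of copies of \<open>x\<close>, and normal forms stay free of signs.
  Multiplication is by elements of \<open>G\<close> only, so closure of an additive span is checked
  on one product for each generator and each spanning element.\<close>

definition ring_generated :: "('a, 'm) ring_scheme \<Rightarrow> 'a set \<Rightarrow> bool" where
  "ring_generated Q G \<longleftrightarrow>
     (\<forall>S \<subseteq> carrier Q. \<zero>\<^bsub>Q\<^esub> \<in> S \<and> \<one>\<^bsub>Q\<^esub> \<in> S \<and> (\<forall>x\<in>S. \<forall>y\<in>S. x \<oplus>\<^bsub>Q\<^esub> y \<in> S) \<and>
        (\<forall>g\<in>G. \<forall>x\<in>S. g \<otimes>\<^bsub>Q\<^esub> x \<in> S) \<longrightarrow> carrier Q \<subseteq> S)"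

lemma ring_generatedI:
  assumes "\<And>S. \<lbrakk>S \<subseteq> carrier Q; \<zero>\<^bsub>Q\<^esub> \<in> S; \<one>\<^bsub>Q\<^esub> \<in> S; \<And>x y. x \<in> S \<Longrightarrow> y \<in> S \<Longrightarrow> x \<oplus>\<^bsub>Q\<^esub> y \<in> S;
      \<And>g x. g \<in> G \<Longrightarrow> x \<in> S \<Longrightarrow> g \<otimes>\<^bsub>Q\<^esub> x \<in> S\<rbrakk> \<Longrightarrow> carrier Q \<subseteq> S"
  shows "ring_generated Q G"
  unfolding ring_generated_def by (intro allI impI, elim conjE, rule assms) simp_all

lemma ring_generatedD:
  assumes "ring_generated Q G" "S \<subseteq> carrier Q" "\<zero>\<^bsub>Q\<^esub> \<in> S" "\<one>\<^bsub>Q\<^esub> \<in> S"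
    "\<And>x y. x \<in> S \<Longrightarrow> y \<in> S \<Longrightarrow> x \<oplus>\<^bsub>Q\<^esub> y \<in> S" "\<And>g x. g \<in> G \<Longrightarrow> x \<in> S \<Longrightarrow> g \<otimes>\<^bsub>Q\<^esub> x \<in> S"
    "z \<in> carrier Q"
  shows "z \<in> S"
  by (rule subsetD[OF assms(1)[unfolded ring_generated_def, THEN spec[of _ S], THEN mp, THEN mp]])
    (intro conjI ballI assms | assumption)+

lemma ring_generated_residue_ring:
  assumes "n > 1"
  shows "ring_generated (residue_ring n) {}"
proof (rule ring_generatedI)
  interpret residues n "residue_ring n" using assms by unfold_locales
  fix S assume S: "S \<subseteq> carrier (residue_ring n)" "\<zero>\<^bsub>residue_ring n\<^esub> \<in> S" "\<one>\<^bsub>residue_ring n\<^esub> \<in> S"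
    "\<And>x y. x \<in> S \<Longrightarrow> y \<in> S \<Longrightarrow> x \<oplus>\<^bsub>residue_ring n\<^esub> y \<in> S"
  have "int k < n \<Longrightarrow> int k \<in> S" for k
  proof (induction k)
    case 0 then show ?case using S(2) by (simp add: res_zero_eq)
  next
    case (Suc k)
    then have "int k \<in> S" by simp
    then show ?case using S(4)[OF _ S(3), of "int k"] Suc(2) assms
      by (simp add: res_add_eq res_one_eq add.commute)
  qed
  then show "carrier (residue_ring n) \<subseteq> S"
    by (auto simp: res_carrier_eq) (metis atLeastAtMost_iff int_nat_eq zle_diff1_eq)
qed

text \<open>Constants are reached because \<open>A\<close> is generated by \<open>G\<close>,
  monomials by repeated multiplication with \<open>X\<close>, and polynomials as finite sums of
  monomials.\<close>

lemma ring_generated_UP: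
  assumes "cring A" "ring_generated A G" "G \<subseteq> carrier A"
  shows "ring_generated (UP A) (insert (up_ring.monom (UP A) \<one>\<^bsub>A\<^esub> 1) ((\<lambda>a. up_ring.monom (UP A) a 0) ` G))"
proof (rule ring_generatedI)
  interpret A: cring A by fact
  interpret UP_cring A "UP A" by unfold_locales
  fix S assume S: "S \<subseteq> carrier (UP A)" "\<zero>\<^bsub>UP A\<^esub> \<in> S" "\<one>\<^bsub>UP A\<^esub> \<in> S"
    "\<And>x y. x \<in> S \<Longrightarrow> y \<in> S \<Longrightarrow> x \<oplus>\<^bsub>UP A\<^esub> y \<in> S"
    "\<And>g x. g \<in> insert (up_ring.monom (UP A) \<one>\<^bsub>A\<^esub> 1) ((\<lambda>a. up_ring.monom (UP A) a 0) ` G) \<Longrightarrow> x \<in> S \<Longrightarrow> g \<otimes>\<^bsub>UP A\<^esub> x \<in> S"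
  let ?T = "{a \<in> carrier A. up_ring.monom (UP A) a 0 \<in> S}"
  have const: "a \<in> ?T" if "a \<in> carrier A" for a
  proof (rule ring_generatedD[OF assms(2) _ _ _ _ _ that])
    show "\<zero>\<^bsub>A\<^esub> \<in> ?T" "\<one>\<^bsub>A\<^esub> \<in> ?T" using S by simp_all
    show "x \<oplus>\<^bsub>A\<^esub> y \<in> ?T" if "x \<in> ?T" "y \<in> ?T" for x y using that S(4) by simp
    show "g \<otimes>\<^bsub>A\<^esub> x \<in> ?T" if "g \<in> G" "x \<in> ?T" for g x
      using that S(5)[of "up_ring.monom (UP A) g 0" "up_ring.monom (UP A) x 0"] assms(3) monom_mult[of g x 0 0] by auto
  qed auto
  have mon: "up_ring.monom (UP A) a k \<in> S" if "a \<in> carrier A" for a k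
  proof (induction k)
    case 0 then show ?case using const[OF that] by simp
  next
    case (Suc k)
    then show ?case using S(5)[of "up_ring.monom (UP A) \<one>\<^bsub>A\<^esub> 1"] monom_mult[of "\<one>\<^bsub>A\<^esub>" a 1 k] that by simp
  qed
  have fin: "finite F \<Longrightarrow> f ` F \<subseteq> S \<Longrightarrow> finsum (UP A) f F \<in> S" for F and f :: "nat \<Rightarrow> _"
  proof (induction F rule: finite_induct)
    case (insert x F)
    then have "f \<in> F \<rightarrow> carrier (UP A)" "f x \<in> carrier (UP A)" using S(1) by auto
    then show ?case using insert S(4) by (simp add: P.finsum_insert)
  qed (use S in simp)
  show "carrier (UP A) \<subseteq> S"
  proof
    fix p assume p: "p \<in> carrier (UP A)"
    have "(\<Oplus>\<^bsub>UP A\<^esub>i\<in>{..UnivPoly.deg A p}. up_ring.monom (UP A) (up_ring.coeff (UP A) p i) i) \<in> S"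
      using fin mon p by (auto simp: image_subset_iff)
    then show "p \<in> S" using up_repr[OF p] by simp
  qed
qed

lemma ring_generated_Quot:
  assumes "ideal I P" "ring_generated P G" "G \<subseteq> carrier P"
  shows "ring_generated (P Quot I) ((+>\<^bsub>P\<^esub>) I ` G)"
proof (rule ring_generatedI)
  interpret ideal I P by fact
  note h = ring_hom_memE[OF rcos_ring_hom]
  fix S assume S: "S \<subseteq> carrier (P Quot I)" "\<zero>\<^bsub>P Quot I\<^esub> \<in> S" "\<one>\<^bsub>P Quot I\<^esub> \<in> S"
    "\<And>x y. x \<in> S \<Longrightarrow> y \<in> S \<Longrightarrow> x \<oplus>\<^bsub>P Quot I\<^esub> y \<in> S"
    "\<And>g x. g \<in> (+>\<^bsub>P\<^esub>) I ` G \<Longrightarrow> x \<in> S \<Longrightarrow> g \<otimes>\<^bsub>P Quot I\<^esub> x \<in> S"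
  let ?T = "{p \<in> carrier P. I +>\<^bsub>P\<^esub> p \<in> S}"
  have "p \<in> ?T" if "p \<in> carrier P" for p
  proof (rule ring_generatedD[OF assms(2) _ _ _ _ _ that])
    have "I +>\<^bsub>P\<^esub> \<zero>\<^bsub>P\<^esub> = \<zero>\<^bsub>P Quot I\<^esub>"
      by (simp add: FactRing_def a_rcos_zero is_ideal)
    then show "\<zero>\<^bsub>P\<^esub> \<in> ?T" using S by simp
    show "\<one>\<^bsub>P\<^esub> \<in> ?T" using S h(4) by simp
    show "x \<oplus>\<^bsub>P\<^esub> y \<in> ?T" if "x \<in> ?T" "y \<in> ?T" for x y using that S(4) h(3) by simp
    show "g \<otimes>\<^bsub>P\<^esub> x \<in> ?T" if "g \<in> G" "x \<in> ?T" for g x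
      using that S(5)[of "I +>\<^bsub>P\<^esub> g" "I +>\<^bsub>P\<^esub> x"] h(2)[of g x] assms(3) by auto
  qed auto
  then show "carrier (P Quot I) \<subseteq> S" by (auto simp: FactRing_def A_RCOSETS_def')
qed

section \<open>Cardinality bounds from additive spanning sets\<close>

definition adjoin :: "('a, 'm) ring_scheme \<Rightarrow> 'a \<Rightarrow> 'a set \<Rightarrow> 'a set" where
  "adjoin Q v S = S \<union> (\<lambda>s. v \<oplus>\<^bsub>Q\<^esub> s) ` S"

text \<open>Only an upper bound on the cardinality is carried along, so coincidences among the
  elements produced by successive \<open>adjoin\<close> steps are harmless.\<close>

definition small_submonoid :: "('a, 'm) ring_scheme \<Rightarrow> nat \<Rightarrow> 'a set \<Rightarrow> bool" where
  "small_submonoid Q n S \<longleftrightarrow> S \<subseteq> carrier Q \<and> \<zero>\<^bsub>Q\<^esub> \<in> S \<and> (\<forall>x\<in>S. \<forall>y\<in>S. x \<oplus>\<^bsub>Q\<^esub> y \<in> S) \<and>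
     finite S \<and> card S \<le> n"

lemma (in ring) small_submonoid_zero: "small_submonoid R 1 {\<zero>}"
  by (simp add: small_submonoid_def)

text \<open>Because \<open>v \<oplus> v\<close> falls back into \<open>S\<close>, the union of
  \<open>S\<close> and its translate by \<open>v\<close> is already closed under addition. Each such
  step at most doubles the size.\<close>

lemma (in ring) small_submonoid_adjoin:
  assumes "small_submonoid R n S" "v \<in> carrier R" "v \<oplus> v \<in> S"
  shows "small_submonoid R (2 * n) (adjoin R v S)"
proof -
  note S = assms(1)[unfolded small_submonoid_def]
  have sub: "s \<in> carrier R" if "s \<in> S" for s using S that by auto
  have "(v \<oplus> x) \<oplus> (v \<oplus> y) = (v \<oplus> v) \<oplus> (x \<oplus> y)" "(v \<oplus> x) \<oplus> y = v \<oplus> (x \<oplus> y)" "x \<oplus> (v \<oplus> y) = v \<oplus> (x \<oplus> y)"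
    if "x \<in> S" "y \<in> S" for x y
    using assms(2) sub[OF that(1)] sub[OF that(2)] by (simp_all add: a_ac)
  then have "x \<oplus> y \<in> adjoin R v S" if "x \<in> adjoin R v S" "y \<in> adjoin R v S" for x y
    using that assms(3) S unfolding adjoin_def by (auto simp del: a_assoc)
  moreover have "card (adjoin R v S) \<le> 2 * n"
  proof -
    have "card (adjoin R v S) \<le> card S + card ((\<lambda>s. v \<oplus> s) ` S)"
      unfolding adjoin_def by (rule card_Un_le)
    also have "\<dots> \<le> n + n" using S card_image_le[of S "(\<oplus>) v"] by linarith
    finally show ?thesis by simp
  qed
  ultimately show ?thesis using S assms(2) by (auto simp: small_submonoid_def adjoin_def)
qed

lemma ring_generated_card_le:
  assumes "ring_generated Q G" "small_submonoid Q n S" "\<one>\<^bsub>Q\<^esub> \<in> S"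
    "\<And>g x. g \<in> G \<Longrightarrow> x \<in> S \<Longrightarrow> g \<otimes>\<^bsub>Q\<^esub> x \<in> S"
  shows "finite (carrier Q)" "card (carrier Q) \<le> n"
proof -
  have "carrier Q = S"
    using assms(2,3) ring_generatedD[OF assms(1), of S] assms(4) unfolding small_submonoid_def by blast
  then show "finite (carrier Q)" "card (carrier Q) \<le> n" using assms(2) unfolding small_submonoid_def by auto
qed

lemma (in ring) adjoin_mult_closed:
  assumes "g \<in> carrier R" "v \<in> carrier R" "S \<subseteq> carrier R" "T \<subseteq> carrier R"
    "\<And>x y. x \<in> T \<Longrightarrow> y \<in> T \<Longrightarrow> x \<oplus> y \<in> T" "g \<otimes> v \<in> T" "\<And>x. x \<in> S \<Longrightarrow> g \<otimes> x \<in> T"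
    "x \<in> adjoin R v S"
  shows "g \<otimes> x \<in> T"
proof -
  have "g \<otimes> (v \<oplus> s) = g \<otimes> v \<oplus> g \<otimes> s" if "s \<in> S" for s using that assms(1-3) by (auto simp: r_distr)
  then show ?thesis using assms by (auto simp: adjoin_def)
qed

text \<open>A chain spanned by \<open>s\<close>, then \<open>t\<close>, then \<open>1\<close>. The
  double of each new element may be any element of the span below it, which lets one statement serve
  characteristics 2 and 4. The three conditions \<open>mul\<close> are the products of a generator
  with \<open>1\<close>, \<open>t\<close> and \<open>s\<close>.\<close>

lemma (in ring) card_le_8:
  assumes gen: "ring_generated R G" "G \<subseteq> carrier R" and st: "s \<in> carrier R" "t \<in> carrier R"
    and T: "T = adjoin R \<one> (adjoin R t (adjoin R s {\<zero>}))"
    and rel: "s \<oplus> s = \<zero>" "t \<oplus> t \<in> {\<zero>, s}" "\<one> \<oplus> \<one> \<in> {\<zero>, s, t, t \<oplus> s}"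
    and mul: "\<And>g. g \<in> G \<Longrightarrow> g \<in> T" "\<And>g. g \<in> G \<Longrightarrow> g \<otimes> t \<in> T" "\<And>g. g \<in> G \<Longrightarrow> g \<otimes> s \<in> T"
  shows "finite (carrier R)" "card (carrier R) \<le> 8"
proof -
  have s1: "small_submonoid R 2 (adjoin R s {\<zero>})"
    using small_submonoid_adjoin[OF small_submonoid_zero st(1)] rel st by simp
  have e0: "adjoin R s {\<zero>} = {\<zero>, s}" using st by (auto simp: adjoin_def)
  have e: "adjoin R t (adjoin R s {\<zero>}) = {\<zero>, s, t, t \<oplus> s}" using st by (auto simp: adjoin_def)
  have s2: "small_submonoid R 4 (adjoin R t (adjoin R s {\<zero>}))"
    using small_submonoid_adjoin[OF s1 st(2)] rel(2) e0 by simp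
  have s3: "small_submonoid R 8 T"
    using small_submonoid_adjoin[OF s2, of \<one>] rel(3) e unfolding T by simp
  have cl: "T \<subseteq> carrier R" "\<zero> \<in> T" "\<And>x y. x \<in> T \<Longrightarrow> y \<in> T \<Longrightarrow> x \<oplus> y \<in> T"
    using s3 by (auto simp: small_submonoid_def)
  have "g \<otimes> x \<in> T" if g: "g \<in> G" and x: "x \<in> T" for g x
  proof -
    have gc: "g \<in> carrier R" using g gen by auto
    have m1: "g \<otimes> x \<in> T" if "x \<in> adjoin R s {\<zero>}" for x
      using adjoin_mult_closed[OF gc st(1) _ cl(1,3) mul(3)[OF g] _ that] cl gc by simp
    have m2: "g \<otimes> x \<in> T" if "x \<in> adjoin R t (adjoin R s {\<zero>})" for x
      using adjoin_mult_closed[OF gc st(2) _ cl(1,3) mul(2)[OF g] m1 that] st by (auto simp: adjoin_def)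
    show ?thesis
      using adjoin_mult_closed[OF gc one_closed _ cl(1,3) _ m2 x[unfolded T]] st mul(1)[OF g] gc by (auto simp: adjoin_def)
  qed
  then show "finite (carrier R)" "card (carrier R) \<le> 8"
    using ring_generated_card_le[OF gen(1) s3] by (auto simp: T adjoin_def)
qed

lemma (in ring) card_le_4:
  assumes gen: "ring_generated R G" "G \<subseteq> carrier R" and st: "s \<in> carrier R"
    and T: "T = adjoin R \<one> (adjoin R s {\<zero>})"
    and rel: "s \<oplus> s = \<zero>" "\<one> \<oplus> \<one> \<in> {\<zero>, s}"
    and mul: "\<And>g. g \<in> G \<Longrightarrow> g \<in> T" "\<And>g. g \<in> G \<Longrightarrow> g \<otimes> s \<in> T"
  shows "finite (carrier R)" "card (carrier R) \<le> 4"
proof -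
  have s1: "small_submonoid R 2 (adjoin R s {\<zero>})"
    using small_submonoid_adjoin[OF small_submonoid_zero st(1)] rel st by simp
  have s3: "small_submonoid R 4 T"
    using small_submonoid_adjoin[OF s1, of \<one>] rel st by (auto simp: adjoin_def T)
  have cl: "T \<subseteq> carrier R" "\<zero> \<in> T" "\<And>x y. x \<in> T \<Longrightarrow> y \<in> T \<Longrightarrow> x \<oplus> y \<in> T"
    using s3 by (auto simp: small_submonoid_def)
  have "g \<otimes> x \<in> T" if g: "g \<in> G" and x: "x \<in> T" for g x
  proof -
    have gc: "g \<in> carrier R" using g gen by auto
    have m1: "g \<otimes> x \<in> T" if "x \<in> adjoin R s {\<zero>}" for x
      using adjoin_mult_closed[OF gc st(1) _ cl(1,3) mul(2)[OF g] _ that] cl gc by simp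
    show ?thesis
      using adjoin_mult_closed[OF gc one_closed _ cl(1,3) _ m1 x[unfolded T]] st mul(1)[OF g] gc by (auto simp: adjoin_def)
  qed
  then show "finite (carrier R)" "card (carrier R) \<le> 4"
    using ring_generated_card_le[OF gen(1) s3] by (auto simp: T adjoin_def)
qed

text \<open>Here \<open>u\<close> stands for a root of \<open>X^2 + X + 1\<close>. Over Z4 the
  elements \<open>s\<close>, \<open>t\<close> are \<open>2\<close> and \<open>2 u\<close>, which is
  why the double of \<open>u\<close> may be \<open>t\<close>; over F4 they are a square-zero element
  and its multiple by \<open>u\<close>.\<close>

lemma (in ring) card_le_16:
  assumes gen: "ring_generated R G" "G \<subseteq> carrier R" and st: "s \<in> carrier R" "t \<in> carrier R" "u \<in> carrier R"
    and T: "T = adjoin R u (adjoin R \<one> (adjoin R t (adjoin R s {\<zero>})))"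
    and rel: "s \<oplus> s = \<zero>" "t \<oplus> t = \<zero>" "\<one> \<oplus> \<one> \<in> {\<zero>, s}" "u \<oplus> u \<in> {\<zero>, t}"
    and mul: "\<And>g. g \<in> G \<Longrightarrow> g \<in> T" "\<And>g. g \<in> G \<Longrightarrow> g \<otimes> t \<in> T" "\<And>g. g \<in> G \<Longrightarrow> g \<otimes> s \<in> T"
      "\<And>g. g \<in> G \<Longrightarrow> g \<otimes> u \<in> T"
  shows "finite (carrier R)" "card (carrier R) \<le> 16"
proof -
  have s1: "small_submonoid R 2 (adjoin R s {\<zero>})"
    using small_submonoid_adjoin[OF small_submonoid_zero st(1)] rel st by simp
  have e0: "adjoin R s {\<zero>} = {\<zero>, s}" using st by (auto simp: adjoin_def)
  have e: "adjoin R t (adjoin R s {\<zero>}) = {\<zero>, s, t, t \<oplus> s}" using st by (auto simp: adjoin_def)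
  have s2: "small_submonoid R 4 (adjoin R t (adjoin R s {\<zero>}))"
    using small_submonoid_adjoin[OF s1 st(2)] rel(2) e0 by simp
  have s3: "small_submonoid R 8 (adjoin R \<one> (adjoin R t (adjoin R s {\<zero>})))"
    using small_submonoid_adjoin[OF s2, of \<one>] rel(3) e by auto
  have "u \<oplus> u \<in> adjoin R t (adjoin R s {\<zero>})" unfolding e using rel(4) by blast
  then have "u \<oplus> u \<in> adjoin R \<one> (adjoin R t (adjoin R s {\<zero>}))"
    by (simp add: adjoin_def[of R \<one>])
  then have s4: "small_submonoid R 16 T"
    using small_submonoid_adjoin[OF s3 st(3)] unfolding T by simp
  have cl: "T \<subseteq> carrier R" "\<zero> \<in> T" "\<And>x y. x \<in> T \<Longrightarrow> y \<in> T \<Longrightarrow> x \<oplus> y \<in> T"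
    using s4 by (auto simp: small_submonoid_def)
  have "g \<otimes> x \<in> T" if g: "g \<in> G" and x: "x \<in> T" for g x
  proof -
    have gc: "g \<in> carrier R" using g gen by auto
    have m1: "g \<otimes> x \<in> T" if "x \<in> adjoin R s {\<zero>}" for x
      using adjoin_mult_closed[OF gc st(1) _ cl(1,3) mul(3)[OF g] _ that] cl gc by simp
    have m2: "g \<otimes> x \<in> T" if "x \<in> adjoin R t (adjoin R s {\<zero>})" for x
      using adjoin_mult_closed[OF gc st(2) _ cl(1,3) mul(2)[OF g] m1 that] st by (auto simp: adjoin_def)
    have m3: "g \<otimes> x \<in> T" if "x \<in> adjoin R \<one> (adjoin R t (adjoin R s {\<zero>}))" for x
      using adjoin_mult_closed[OF gc one_closed _ cl(1,3) _ m2 that] st mul(1)[OF g] gc by (auto simp: adjoin_def)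
    show ?thesis
      using adjoin_mult_closed[OF gc st(3) _ cl(1,3) mul(4)[OF g] m3 x[unfolded T]] st by (auto simp: adjoin_def)
  qed
  then show "finite (carrier R)" "card (carrier R) \<le> 16"
    using ring_generated_card_le[OF gen(1) s4] by (auto simp: T adjoin_def)
qed

section \<open>Homomorphisms out of residue rings and quotients of polynomial rings\<close>

lemma (in cring) residue_ring_hom:
  assumes "n > 1" "[nat n] \<cdot> \<one> = \<zero>"
  shows "(\<lambda>k. [nat k] \<cdot> \<one>) \<in> ring_hom (residue_ring n) R"
proof -
  interpret Z: residues n "residue_ring n" using assms by unfold_locales
  have dist: "[(i * j)] \<cdot> \<one> = [i] \<cdot> \<one> \<otimes> [j] \<cdot> \<one>" for i j :: nat
    by (simp add: add_pow_ldistr add.nat_pow_pow mult.commute)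
  have mod: "[nat (k mod n)] \<cdot> \<one> = [nat k] \<cdot> \<one>" if "k \<ge> 0" for k
  proof -
    have "nat k = nat n * nat (k div n) + nat (k mod n)"
      using that assms(1) by (simp flip: nat_mult_distrib nat_add_distrib add: pos_imp_zdiv_nonneg_iff)
    then have "[nat k] \<cdot> \<one> = [nat n] \<cdot> \<one> \<otimes> [nat (k div n)] \<cdot> \<one> \<oplus> [nat (k mod n)] \<cdot> \<one>"
      by (simp add: dist add.nat_pow_mult[symmetric])
    then show ?thesis using assms(2) by simp
  qed
  show ?thesis
  proof (rule ring_hom_memI)
    show "[nat x] \<cdot> \<one> \<in> carrier R" for x by simp
    fix x y assume "x \<in> carrier (residue_ring n)" "y \<in> carrier (residue_ring n)"
    then have xy: "x \<ge> 0" "y \<ge> 0" by (auto simp: Z.res_carrier_eq)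
    show "[nat (x \<otimes>\<^bsub>residue_ring n\<^esub> y)] \<cdot> \<one> = [nat x] \<cdot> \<one> \<otimes> [nat y] \<cdot> \<one>"
      using xy by (simp add: Z.res_mult_eq mod nat_mult_distrib dist)
    show "[nat (x \<oplus>\<^bsub>residue_ring n\<^esub> y)] \<cdot> \<one> = [nat x] \<cdot> \<one> \<oplus> [nat y] \<cdot> \<one>"
      using xy by (simp add: Z.res_add_eq mod nat_add_distrib add.nat_pow_mult)
  next
    show "[nat \<one>\<^bsub>residue_ring n\<^esub>] \<cdot> \<one> = \<one>" by (simp add: Z.res_one_eq)
  qed
qed

lemma UP_ring_hom_extend:
  assumes "cring A" "cring R" "h \<in> ring_hom A R" "x \<in> carrier R"
  obtains k where "k \<in> ring_hom (UP A) R" "\<And>a. a \<in> carrier A \<Longrightarrow> k (up_ring.monom (UP A) a 0) = h a"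
    "k (up_ring.monom (UP A) \<one>\<^bsub>A\<^esub> 1) = x"
proof -
  interpret A: cring A by fact
  interpret R: cring R by fact
  interpret UP_pre_univ_prop A R h "UP A"
    using assms by (unfold_locales) auto
  show ?thesis
    using that[of "UnivPoly.eval A R h x"] eval_ring_hom assms eval_const eval_monom1 by auto
qed

lemma Quot_ring_hom_factor:
  assumes "ideal I P" "ring R" "h \<in> ring_hom P R" "\<And>i. i \<in> I \<Longrightarrow> h i = \<zero>\<^bsub>R\<^esub>"
  obtains k where "k \<in> ring_hom (P Quot I) R" "\<And>p. p \<in> carrier P \<Longrightarrow> k (I +>\<^bsub>P\<^esub> p) = h p"
proof -
  interpret ideal I P by fact
  interpret R: ring R by fact
  note h = ring_hom_memE[OF assms(3)]
  \<comment> \<open>The map \<open>h\<close> is constant on each coset, so the image of a coset is a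
    singleton and its only element is the value wanted.\<close>
  define k where "k U = the_elem (h ` U)" for U
  have k: "k (I +>\<^bsub>P\<^esub> p) = h p" if p: "p \<in> carrier P" for p
  proof -
    have "h (i \<oplus>\<^bsub>P\<^esub> p) = h p" if "i \<in> I" for i using that p assms(4) h(1)[OF p] h(3)[OF Icarr[OF that] p] by simp
    moreover have "\<zero>\<^bsub>P\<^esub> \<in> I" by (rule additive_subgroup.zero_closed[OF is_additive_subgroup])
    moreover have "h ` (I +>\<^bsub>P\<^esub> p) = (\<lambda>i. h (i \<oplus>\<^bsub>P\<^esub> p)) ` I"
      by (auto simp: a_r_coset_def')
    ultimately have "h ` (I +>\<^bsub>P\<^esub> p) = {h p}"
      using image_constant[of "\<zero>\<^bsub>P\<^esub>" I "h p"] by (simp cong: image_cong)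
    then show ?thesis by (simp add: k_def)
  qed
  note r = ring_hom_memE[OF rcos_ring_hom]
  have c: "\<exists>p\<in>carrier P. U = I +>\<^bsub>P\<^esub> p" if "U \<in> carrier (P Quot I)" for U
    using that by (auto simp: FactRing_def A_RCOSETS_def')
  have "k \<in> ring_hom (P Quot I) R"
  proof (rule ring_hom_memI)
    fix U assume "U \<in> carrier (P Quot I)"
    from c[OF this] obtain p where "p \<in> carrier P" "U = I +>\<^bsub>P\<^esub> p" ..
    then show "k U \<in> carrier R" using k[of p] h(1)[of p] by simp
  next
    fix U W assume UW: "U \<in> carrier (P Quot I)" "W \<in> carrier (P Quot I)"
    from c[OF UW(1)] obtain p where p: "p \<in> carrier P" "U = I +>\<^bsub>P\<^esub> p" ..
    from c[OF UW(2)] obtain q where q: "q \<in> carrier P" "W = I +>\<^bsub>P\<^esub> q" ..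
    note pq = p q
    show "k (U \<otimes>\<^bsub>P Quot I\<^esub> W) = k U \<otimes>\<^bsub>R\<^esub> k W"
      using pq(1,3) k[of p] k[of q] k[of "p \<otimes>\<^bsub>P\<^esub> q"] h(2)[of p q] r(2)[of p q] unfolding pq(2,4) by simp
    show "k (U \<oplus>\<^bsub>P Quot I\<^esub> W) = k U \<oplus>\<^bsub>R\<^esub> k W"
      using pq(1,3) k[of p] k[of q] k[of "p \<oplus>\<^bsub>P\<^esub> q"] h(3)[of p q] r(3)[of p q] unfolding pq(2,4) by simp
  next
    show "k \<one>\<^bsub>P Quot I\<^esub> = \<one>\<^bsub>R\<^esub>"
      using k[of "\<one>\<^bsub>P\<^esub>"] h(4) r(4) by simp
  qed
  then show ?thesis using that k by blast
qed

text \<open>A surjection from a finite set onto one that is at least as large is injective. This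
  makes \<open>h\<close> an isomorphism from \<open>Q\<close> to \<open>R\<close>, and its inverse
  gives the direction stated.\<close>

lemma ring_iso_of_surj:
  assumes "ring Q" "ring R" "h \<in> ring_hom Q R" "finite (carrier Q)" "card (carrier Q) \<le> card (carrier R)"
    "carrier R \<subseteq> h ` carrier Q"
  shows "R \<simeq> Q"
proof -
  have im: "h ` carrier Q = carrier R" using assms(6) ring_hom_memE(1)[OF assms(3)] by auto
  then have "inj_on h (carrier Q)"
    using assms(4,5) card_image_le[OF assms(4), of h] by (intro eq_card_imp_inj_on) auto
  then have "h \<in> ring_iso Q R" using im assms(3) by (simp add: ring_iso_def bij_betw_def)
  then show ?thesis using ring_iso_set_sym[OF assms(1)] unfolding is_ring_iso_def by blast
qed

text \<open>The working interface to a quotient of \<open>A[X]\<close>: \<open>\<iota>\<close> gives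
  the classes of constants, \<open>\<xi>\<close> is the class of \<open>X\<close>,
  \<open>\<pi>\<close> the projection and \<open>h\<close> the induced map to \<open>R\<close>.
  Relations in the quotient are read off through \<open>\<pi>\<close>; relations in \<open>R\<close>
  are what \<open>ker\<close> asks for. \<open>ker\<close> speaks of any homomorphism with the
  prescribed values on monomials, which hides polynomial evaluation from its users.\<close>

lemma UP_Quot_hom:
  fixes A :: "('a, 'm) ring_scheme" and R :: "('b, 'n) ring_scheme"
  assumes "cring A" "ring_generated A G" "G \<subseteq> carrier A" "cring R" "\<phi> \<in> ring_hom A R" "x \<in> carrier R"
    and I: "ideal I (UP A)"
    and ker: "\<And>k f. \<lbrakk>k \<in> ring_hom (UP A) R; \<And>a n. a \<in> carrier A \<Longrightarrow>
       k (up_ring.monom (UP A) a n) = \<phi> a \<otimes>\<^bsub>R\<^esub> x [^]\<^bsub>R\<^esub> n; f \<in> I\<rbrakk> \<Longrightarrow> k f = \<zero>\<^bsub>R\<^esub>"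
  obtains \<pi> \<iota> \<xi> h where "cring (UP A Quot I)" "\<xi> \<in> carrier (UP A Quot I)" "\<iota> \<in> ring_hom A (UP A Quot I)"
    "h \<in> ring_hom (UP A Quot I) R" "\<And>a. a \<in> carrier A \<Longrightarrow> h (\<iota> a) = \<phi> a" "h \<xi> = x"
    "ring_generated (UP A Quot I) (insert \<xi> (\<iota> ` G))"
    "\<pi> \<in> ring_hom (UP A) (UP A Quot I)" "\<And>f. f \<in> I \<Longrightarrow> \<pi> f = \<zero>\<^bsub>UP A Quot I\<^esub>"
    "\<And>a n. a \<in> carrier A \<Longrightarrow> \<pi> (up_ring.monom (UP A) a n) = \<iota> a \<otimes>\<^bsub>UP A Quot I\<^esub> \<xi> [^]\<^bsub>UP A Quot I\<^esub> n"
proof -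
  interpret A: cring A by fact
  interpret R: cring R by fact
  interpret P: UP_cring A "UP A" by unfold_locales
  interpret I: ideal I "UP A" by fact
  interpret \<phi>: UP_pre_univ_prop A R \<phi> "UP A"
    using assms by (unfold_locales) auto
  let ?Q = "UP A Quot I"
  let ?X = "up_ring.monom (UP A) \<one>\<^bsub>A\<^esub> 1"
  define \<pi> where "\<pi> = (+>\<^bsub>UP A\<^esub>) I"
  have \<pi>: "\<pi> \<in> ring_hom (UP A) ?Q" unfolding \<pi>_def by (rule I.rcos_ring_hom)
  have cQ: "cring ?Q" using I.quotient_is_cring P.UP_cring by blast
  interpret Q: cring ?Q by fact
  let ?k = "UnivPoly.eval A R \<phi> x"
  have k: "?k \<in> ring_hom (UP A) R" "\<And>a n. a \<in> carrier A \<Longrightarrow>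
       ?k (up_ring.monom (UP A) a n) = \<phi> a \<otimes>\<^bsub>R\<^esub> x [^]\<^bsub>R\<^esub> n"
    using \<phi>.eval_ring_hom \<phi>.eval_monom assms(6) by auto
  obtain h where h: "h \<in> ring_hom ?Q R" "\<And>p. p \<in> carrier (UP A) \<Longrightarrow> h (\<pi> p) = ?k p"
    using Quot_ring_hom_factor[OF I R.ring_axioms k(1) ker[OF k]] unfolding \<pi>_def by blast
  note \<pi>E = ring_hom_memE[OF \<pi>]
  let ?\<iota> = "\<lambda>a. \<pi> (up_ring.monom (UP A) a 0)"
  have \<iota>: "?\<iota> \<in> ring_hom A ?Q"
    using ring_hom_trans[OF P.const_ring_hom \<pi>] by (simp add: comp_def)
  have mon: "\<pi> (up_ring.monom (UP A) a n) = ?\<iota> a \<otimes>\<^bsub>?Q\<^esub> \<pi> ?X [^]\<^bsub>?Q\<^esub> n" if a: "a \<in> carrier A" for a n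
  proof (induction n)
    case 0 then show ?case using \<pi>E(1) a by simp
  next
    case (Suc n)
    have "up_ring.monom (UP A) a (Suc n) = up_ring.monom (UP A) a n \<otimes>\<^bsub>UP A\<^esub> ?X"
      using P.monom_mult[OF a A.one_closed, of n 1] a by simp
    then show ?case using Suc \<pi>E(1) \<pi>E(2)[of "up_ring.monom (UP A) a n" ?X] a by (simp add: Q.m_assoc)
  qed
  show ?thesis
  proof (rule that[of "\<pi> ?X" ?\<iota> h \<pi>])
    show "cring ?Q" "?\<iota> \<in> ring_hom A ?Q" "h \<in> ring_hom ?Q R" "\<pi> \<in> ring_hom (UP A) ?Q" by fact+
    show "\<pi> ?X \<in> carrier ?Q" using \<pi>E(1) by simp
    show "h (?\<iota> a) = \<phi> a" if "a \<in> carrier A" for a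
      using that h(2) k(2)[of a 0] \<phi>.hom_closed by simp
    show "h (\<pi> ?X) = x" using h(2) k(2)[of "\<one>\<^bsub>A\<^esub>" 1] assms(6) by simp
    have "(\<lambda>a. up_ring.monom (UP A) a 0) ` G \<subseteq> carrier (UP A)" using assms(3) by auto
    then show "ring_generated ?Q (insert (\<pi> ?X) (?\<iota> ` G))"
      using ring_generated_Quot[OF I ring_generated_UP[OF assms(1-3)]] by (simp add: image_image \<pi>_def)
    show "\<pi> f = \<zero>\<^bsub>?Q\<^esub>" if "f \<in> I" for f
      using that I.rcos_const_imp_mem I.a_rcos_const by (simp add: \<pi>_def FactRing_def)
    show "\<pi> (up_ring.monom (UP A) a n) = ?\<iota> a \<otimes>\<^bsub>?Q\<^esub> \<pi> ?X [^]\<^bsub>?Q\<^esub> n" if "a \<in> carrier A" for a n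
      using mon[OF that] .
  qed
qed

lemma genideal_kernel:
  assumes "ring P" "ring R" "k \<in> ring_hom P R" "S \<subseteq> carrier P" "\<And>f. f \<in> S \<Longrightarrow> k f = \<zero>\<^bsub>R\<^esub>"
    "f \<in> Idl\<^bsub>P\<^esub> S"
  shows "k f = \<zero>\<^bsub>R\<^esub>"
proof -
  interpret ring_hom_ring P R k using assms(1-3) by (intro ring_hom_ringI2)
  have "S \<subseteq> a_kernel P R k"
    unfolding a_kernel_def' using assms(4,5) by blast
  then have "Idl\<^bsub>P\<^esub> S \<subseteq> a_kernel P R k"
    using ring.genideal_minimal[OF assms(1) kernel_is_ideal] by simp
  then show ?thesis using assms(6) unfolding a_kernel_def' by blast
qed

lemma ring_hom_image_closed:
  assumes "ring Q" "ring R" "h \<in> ring_hom Q R"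
  shows "\<zero>\<^bsub>R\<^esub> \<in> h ` carrier Q" "\<one>\<^bsub>R\<^esub> \<in> h ` carrier Q"
    "\<And>x y. x \<in> h ` carrier Q \<Longrightarrow> y \<in> h ` carrier Q \<Longrightarrow> x \<oplus>\<^bsub>R\<^esub> y \<in> h ` carrier Q"
    "\<And>x y. x \<in> h ` carrier Q \<Longrightarrow> y \<in> h ` carrier Q \<Longrightarrow> x \<otimes>\<^bsub>R\<^esub> y \<in> h ` carrier Q"
proof -
  interpret ring_hom_ring Q R h using assms by (intro ring_hom_ringI2)
  show "\<zero>\<^bsub>R\<^esub> \<in> h ` carrier Q" by (rule image_eqI[of _ _ "\<zero>\<^bsub>Q\<^esub>"]) auto
  show "\<one>\<^bsub>R\<^esub> \<in> h ` carrier Q" by (rule image_eqI[of _ _ "\<one>\<^bsub>Q\<^esub>"]) auto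
  show "x \<oplus>\<^bsub>R\<^esub> y \<in> h ` carrier Q" if "x \<in> h ` carrier Q" "y \<in> h ` carrier Q" for x y
  proof -
    obtain a b where ab: "a \<in> carrier Q" "b \<in> carrier Q" "x = h a" "y = h b"
      using \<open>x \<in> h ` carrier Q\<close> \<open>y \<in> h ` carrier Q\<close> by blast
    then show ?thesis by (intro image_eqI[of _ _ "a \<oplus>\<^bsub>Q\<^esub> b"]) simp_all
  qed
  show "x \<otimes>\<^bsub>R\<^esub> y \<in> h ` carrier Q" if "x \<in> h ` carrier Q" "y \<in> h ` carrier Q" for x y
  proof -
    obtain a b where ab: "a \<in> carrier Q" "b \<in> carrier Q" "x = h a" "y = h b"
      using \<open>x \<in> h ` carrier Q\<close> \<open>y \<in> h ` carrier Q\<close> by blast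
    then show ?thesis by (intro image_eqI[of _ _ "a \<otimes>\<^bsub>Q\<^esub> b"]) simp_all
  qed
qed

text \<open>The condition \<open>surj\<close> says that \<open>1\<close> generates \<open>R\<close>
  additively. It is applied to the image of the residue ring, which is such a set
  \<open>D\<close>.\<close>

lemma residue_ring_iso:
  fixes R (structure)
  assumes "cring R" "n > 1" "[nat n] \<cdot> \<one> = \<zero>" "card (carrier R) = nat n"
    and surj: "\<And>D. \<lbrakk>\<zero> \<in> D; \<one> \<in> D; \<And>x y. x \<in> D \<Longrightarrow> y \<in> D \<Longrightarrow> x \<oplus> y \<in> D\<rbrakk> \<Longrightarrow> carrier R \<subseteq> D"
  shows "R \<simeq> residue_ring n"
proof -
  interpret R: cring R by fact
  interpret Z: residues n "residue_ring n" using assms by unfold_locales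
  note hom = R.residue_ring_hom[OF assms(2,3)]
  show ?thesis
  proof (rule ring_iso_of_surj[OF Z.ring_axioms R.ring_axioms hom])
    show "finite (carrier (residue_ring n))" by simp
    show "card (carrier (residue_ring n)) \<le> card (carrier R)" by (simp add: Z.res_carrier_eq assms(4))
    show "carrier R \<subseteq> (\<lambda>k. [nat k] \<cdot> \<one>) ` carrier (residue_ring n)"
      using ring_hom_image_closed[OF Z.ring_axioms R.ring_axioms hom] by (intro surj)
  qed
qed

lemma ring_hom_double_zero:
  assumes "\<iota> \<in> ring_hom (residue_ring 2) Q" "ring Q"
  shows "\<one>\<^bsub>Q\<^esub> \<oplus>\<^bsub>Q\<^esub> \<one>\<^bsub>Q\<^esub> = \<zero>\<^bsub>Q\<^esub>"
proof -
  interpret Z: residues 2 "residue_ring 2" by unfold_locales simp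
  interpret ring_hom_ring "residue_ring 2" Q \<iota> using assms Z.ring_axioms by (intro ring_hom_ringI2)
  have "\<iota> (\<one>\<^bsub>Z2\<^esub> \<oplus>\<^bsub>Z2\<^esub> \<one>\<^bsub>Z2\<^esub>) = \<one>\<^bsub>Q\<^esub> \<oplus>\<^bsub>Q\<^esub> \<one>\<^bsub>Q\<^esub>"
    by simp
  moreover have "\<one>\<^bsub>Z2\<^esub> \<oplus>\<^bsub>Z2\<^esub> \<one>\<^bsub>Z2\<^esub> = \<zero>\<^bsub>Z2\<^esub>"
    by (simp add: Z.res_one_eq Z.res_zero_eq Z.res_add_eq)
  ultimately show ?thesis by simp
qed

lemma ring_hom_Z4:
  assumes "\<iota> \<in> ring_hom (residue_ring 4) Q" "ring Q"
  shows "\<iota> 2 = \<one>\<^bsub>Q\<^esub> \<oplus>\<^bsub>Q\<^esub> \<one>\<^bsub>Q\<^esub>" "\<iota> 1 = \<one>\<^bsub>Q\<^esub>"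
    "(\<one>\<^bsub>Q\<^esub> \<oplus>\<^bsub>Q\<^esub> \<one>\<^bsub>Q\<^esub>) \<oplus>\<^bsub>Q\<^esub> (\<one>\<^bsub>Q\<^esub> \<oplus>\<^bsub>Q\<^esub> \<one>\<^bsub>Q\<^esub>) = \<zero>\<^bsub>Q\<^esub>"
proof -
  interpret Z: residues 4 "residue_ring 4" by unfold_locales simp
  interpret ring_hom_ring "residue_ring 4" Q \<iota> using assms Z.ring_axioms by (intro ring_hom_ringI2)
  have "\<iota> (\<one>\<^bsub>Z4\<^esub> \<oplus>\<^bsub>Z4\<^esub> \<one>\<^bsub>Z4\<^esub>) = \<one>\<^bsub>Q\<^esub> \<oplus>\<^bsub>Q\<^esub> \<one>\<^bsub>Q\<^esub>"
    by simp
  moreover have "\<one>\<^bsub>Z4\<^esub> \<oplus>\<^bsub>Z4\<^esub> \<one>\<^bsub>Z4\<^esub> = 2"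
    by (simp add: Z.res_one_eq Z.res_add_eq)
  ultimately show 1: "\<iota> 2 = \<one>\<^bsub>Q\<^esub> \<oplus>\<^bsub>Q\<^esub> \<one>\<^bsub>Q\<^esub>" by simp
  show "\<iota> 1 = \<one>\<^bsub>Q\<^esub>" using hom_one by (simp add: Z.res_one_eq)
  have "\<iota> (2 \<oplus>\<^bsub>Z4\<^esub> 2) = \<iota> 2 \<oplus>\<^bsub>Q\<^esub> \<iota> 2"
    by (rule hom_add) (auto simp: Z.res_carrier_eq)
  moreover have "2 \<oplus>\<^bsub>Z4\<^esub> 2 = \<zero>\<^bsub>Z4\<^esub>" by (simp add: Z.res_zero_eq Z.res_add_eq)
  ultimately show "(\<one>\<^bsub>Q\<^esub> \<oplus>\<^bsub>Q\<^esub> \<one>\<^bsub>Q\<^esub>) \<oplus>\<^bsub>Q\<^esub> (\<one>\<^bsub>Q\<^esub> \<oplus>\<^bsub>Q\<^esub> \<one>\<^bsub>Q\<^esub>) = \<zero>\<^bsub>Q\<^esub>"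
    using 1 by simp
qed

section \<open>Recognising the listed rings\<close>

lemma ring_iso_of_generators:
  assumes "ring Q" "ring R" "h \<in> ring_hom Q R" "finite (carrier Q)" "card (carrier Q) \<le> card (carrier R)"
    "ring_generated R G" "G \<subseteq> h ` carrier Q"
  shows "R \<simeq> Q"
proof (rule ring_iso_of_surj[OF assms(1-5)])
  note D = ring_hom_image_closed[OF assms(1-3)]
  show "carrier R \<subseteq> h ` carrier Q"
  proof
    fix z assume z: "z \<in> carrier R"
    show "z \<in> h ` carrier Q"
    proof (rule ring_generatedD[OF assms(6) _ D(1,2,3) _ z])
      show "h ` carrier Q \<subseteq> carrier R" using ring_hom_memE(1)[OF assms(3)] by blast
      show "g \<otimes>\<^bsub>R\<^esub> x \<in> h ` carrier Q" if "g \<in> G" "x \<in> h ` carrier Q" for g x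
        using D(4) that assms(7) by (meson subsetD)
    qed
  qed
qed

text \<open>For coefficients in a residue ring \<open>\<xi>\<close> alone generates the quotient,
  since constants are sums of copies of \<open>1\<close>. Here \<open>ker\<close> has to be checked
  only on the generators \<open>S\<close> of the ideal.\<close>

lemma residue_ring_Quot_hom:
  fixes R (structure)
  assumes R: "cring R" and n: "n > 1" "[nat n] \<cdot> \<one> = \<zero>" and x: "x \<in> carrier R"
    and S: "S \<subseteq> carrier (UP (residue_ring n))"
    and ker: "\<And>k f. \<lbrakk>ring_hom_ring (UP (residue_ring n)) R k; \<And>a i. a \<in> carrier (residue_ring n) \<Longrightarrow>
       k (up_ring.monom (UP (residue_ring n)) a i) = [nat a] \<cdot> \<one> \<otimes> x [^] i; f \<in> S\<rbrakk> \<Longrightarrow> k f = \<zero>"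
  defines "Q \<equiv> quot_gen (UP (residue_ring n)) S"
  obtains \<pi> \<iota> \<xi> h where "cring Q" "\<xi> \<in> carrier Q" "\<iota> \<in> ring_hom (residue_ring n) Q"
    "h \<in> ring_hom Q R" "h \<xi> = x" "ring_generated Q {\<xi>}"
    "ring_hom_ring (UP (residue_ring n)) Q \<pi>" "\<And>f. f \<in> S \<Longrightarrow> \<pi> f = \<zero>\<^bsub>Q\<^esub>"
    "\<And>a i. a \<in> carrier (residue_ring n) \<Longrightarrow>
       \<pi> (up_ring.monom (UP (residue_ring n)) a i) = \<iota> a \<otimes>\<^bsub>Q\<^esub> \<xi> [^]\<^bsub>Q\<^esub> i"
proof -
  interpret R: cring R by fact
  interpret Z: residues n "residue_ring n" using assms by unfold_locales
  interpret P: UP_cring "residue_ring n" "UP (residue_ring n)" by unfold_locales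
  have Q: "Q = UP (residue_ring n) Quot (Idl\<^bsub>UP (residue_ring n)\<^esub> S)" by (simp add: Q_def quot_gen_def)
  have I: "ideal (Idl\<^bsub>UP (residue_ring n)\<^esub> S) (UP (residue_ring n))" using P.P.genideal_ideal[OF S] .
  have ker': "k f = \<zero>" if "k \<in> ring_hom (UP (residue_ring n)) R"
    "\<And>a i. a \<in> carrier (residue_ring n) \<Longrightarrow> k (up_ring.monom (UP (residue_ring n)) a i) = [nat a] \<cdot> \<one> \<otimes> x [^] i"
    "f \<in> Idl\<^bsub>UP (residue_ring n)\<^esub> S" for k f
  proof -
    note k = that(2)
    show ?thesis
    proof (rule genideal_kernel[OF P.P.ring_axioms R.ring_axioms that(1) S _ that(3)])
      have "ring_hom_ring (UP (residue_ring n)) R k"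
        using that(1) P.P.ring_axioms R.ring_axioms by (intro ring_hom_ringI2)
      then show "k f = \<zero>" if "f \<in> S" for f using ker[OF _ k that] by blast
    qed
  qed
  obtain \<pi> \<iota> \<xi> h where *: "cring Q" "\<xi> \<in> carrier Q" "\<iota> \<in> ring_hom (residue_ring n) Q"
    "h \<in> ring_hom Q R" "\<And>a. a \<in> carrier (residue_ring n) \<Longrightarrow> h (\<iota> a) = [nat a] \<cdot> \<one>" "h \<xi> = x"
    "ring_generated Q (insert \<xi> (\<iota> ` {}))"
    "\<pi> \<in> ring_hom (UP (residue_ring n)) Q" "\<And>f. f \<in> Idl\<^bsub>UP (residue_ring n)\<^esub> S \<Longrightarrow> \<pi> f = \<zero>\<^bsub>Q\<^esub>"
    "\<And>a i. a \<in> carrier (residue_ring n) \<Longrightarrow>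
       \<pi> (up_ring.monom (UP (residue_ring n)) a i) = \<iota> a \<otimes>\<^bsub>Q\<^esub> \<xi> [^]\<^bsub>Q\<^esub> i"
  proof (rule UP_Quot_hom[OF Z.cring ring_generated_residue_ring[OF n(1)] empty_subsetI R R.residue_ring_hom[OF n] x I, folded Q])
    show "k f = \<zero>" if "k \<in> ring_hom (UP (residue_ring n)) R"
      "\<And>a i. a \<in> carrier (residue_ring n) \<Longrightarrow> k (up_ring.monom (UP (residue_ring n)) a i) = [nat a] \<cdot> \<one> \<otimes> x [^] i"
      "f \<in> Idl\<^bsub>UP (residue_ring n)\<^esub> S" for k f
      using ker'[OF that] .
  qed (rule that)
  show ?thesis
  proof (rule that[OF *(1-4) *(6)])
    show "ring_generated Q {\<xi>}" using *(7) by simp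
    show "ring_hom_ring (UP (residue_ring n)) Q \<pi>"
      using *(8) P.P.ring_axioms cring.axioms(1)[OF *(1)] by (intro ring_hom_ringI2)
    show "\<pi> f = \<zero>\<^bsub>Q\<^esub>" if "f \<in> S" for f using *(9) P.P.genideal_self[OF S] that by blast
  qed (fact *(10))
qed

lemma (in ring) add_pow_two: "x \<in> carrier R \<Longrightarrow> [(2::nat)] \<cdot> x = x \<oplus> x"
  by (simp add: numeral_2_eq_2)

lemma (in ring) add_pow_four: "[(4::nat)] \<cdot> \<one> = (\<one> \<oplus> \<one>) \<oplus> (\<one> \<oplus> \<one>)"
proof -
  have "(4::nat) = Suc (Suc (Suc (Suc 0)))" by simp
  then show ?thesis by (simp only: add.nat_pow_Suc add.nat_pow_0) (simp add: a_ac)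
qed

lemma Z2_Quot_hom:
  fixes R (structure)
  assumes R: "cring R" and n: "[(2::nat)] \<cdot> \<one> = \<zero>" and x: "x \<in> carrier R"
    and S: "S \<subseteq> carrier (UP Z2)"
    and ker: "\<And>k f. \<lbrakk>ring_hom_ring (UP Z2) R k; \<And>i. k (monom (UP Z2) 1 i) = x [^] i; f \<in> S\<rbrakk> \<Longrightarrow> k f = \<zero>"
  defines "Q \<equiv> quot_gen (UP Z2) S"
  obtains \<pi> \<xi> h where "cring Q" "\<xi> \<in> carrier Q"
    "h \<in> ring_hom Q R" "h \<xi> = x" "ring_generated Q {\<xi>}"
    "\<one>\<^bsub>Q\<^esub> \<oplus>\<^bsub>Q\<^esub> \<one>\<^bsub>Q\<^esub> = \<zero>\<^bsub>Q\<^esub>"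
    "ring_hom_ring (UP Z2) Q \<pi>" "\<And>f. f \<in> S \<Longrightarrow> \<pi> f = \<zero>\<^bsub>Q\<^esub>"
    "\<And>i. \<pi> (monom (UP Z2) 1 i) = \<xi> [^]\<^bsub>Q\<^esub> i"
proof -
  interpret R: cring R by fact
  interpret Z: residues 2 Z2 by unfold_locales simp
  have one: "1 \<in> carrier Z2" by (simp add: Z.res_carrier_eq)
  
  obtain \<pi> \<iota> \<xi> h where Q: "cring Q" "\<xi> \<in> carrier Q" "\<iota> \<in> ring_hom Z2 Q"
    "h \<in> ring_hom Q R" "h \<xi> = x" "ring_generated Q {\<xi>}"
    "ring_hom_ring (UP Z2) Q \<pi>" "\<And>f. f \<in> S \<Longrightarrow> \<pi> f = \<zero>\<^bsub>Q\<^esub>"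
    "\<And>a i. a \<in> carrier Z2 \<Longrightarrow> \<pi> (monom (UP Z2) a i) = \<iota> a \<otimes>\<^bsub>Q\<^esub> \<xi> [^]\<^bsub>Q\<^esub> i"
  proof (rule residue_ring_Quot_hom[OF R _ _ x S, folded Q_def])
    show "k f = \<zero>" if "ring_hom_ring (UP Z2) R k" "\<And>a i. a \<in> carrier Z2 \<Longrightarrow> k (monom (UP Z2) a i) = [nat a] \<cdot> \<one> \<otimes> x [^] i"
        "f \<in> S" for k f
      by (rule ker[OF that(1) _  that(3)]) (simp_all add: that(2) one x R.add_pow_two )
  qed (use n in simp_all)
  interpret Q: cring Q by fact
  have i1: "\<iota> 1 = \<one>\<^bsub>Q\<^esub>" using ring_hom_memE(4)[OF Q(3)] by (simp add: Z.res_one_eq)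
  show ?thesis
    by (rule that[OF Q(1,2,4-6) _ Q(7,8)])
      (simp_all add: Q(2,9) one i1 ring_hom_double_zero[OF Q(3) Q.ring_axioms])
qed

lemma Z4_Quot_hom:
  fixes R (structure)
  assumes R: "cring R" and n: "[(4::nat)] \<cdot> \<one> = \<zero>" and x: "x \<in> carrier R"
    and S: "S \<subseteq> carrier (UP Z4)"
    and ker: "\<And>k f. \<lbrakk>ring_hom_ring (UP Z4) R k; \<And>i. k (monom (UP Z4) 1 i) = x [^] i; \<And>i. k (monom (UP Z4) 2 i) = (\<one> \<oplus> \<one>) \<otimes> x [^] i; f \<in> S\<rbrakk> \<Longrightarrow> k f = \<zero>"
  defines "Q \<equiv> quot_gen (UP Z4) S"
  obtains \<pi> \<xi> h where "cring Q" "\<xi> \<in> carrier Q"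
    "h \<in> ring_hom Q R" "h \<xi> = x" "ring_generated Q {\<xi>}"
    "(\<one>\<^bsub>Q\<^esub> \<oplus>\<^bsub>Q\<^esub> \<one>\<^bsub>Q\<^esub>) \<oplus>\<^bsub>Q\<^esub> (\<one>\<^bsub>Q\<^esub> \<oplus>\<^bsub>Q\<^esub> \<one>\<^bsub>Q\<^esub>) = \<zero>\<^bsub>Q\<^esub>"
    "ring_hom_ring (UP Z4) Q \<pi>" "\<And>f. f \<in> S \<Longrightarrow> \<pi> f = \<zero>\<^bsub>Q\<^esub>"
    "\<And>i. \<pi> (monom (UP Z4) 1 i) = \<xi> [^]\<^bsub>Q\<^esub> i"
    "\<And>i. \<pi> (monom (UP Z4) 2 i) = (\<one>\<^bsub>Q\<^esub> \<oplus>\<^bsub>Q\<^esub> \<one>\<^bsub>Q\<^esub>) \<otimes>\<^bsub>Q\<^esub> \<xi> [^]\<^bsub>Q\<^esub> i"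
proof -
  interpret R: cring R by fact
  interpret Z: residues 4 Z4 by unfold_locales simp
  have one: "1 \<in> carrier Z4" by (simp add: Z.res_carrier_eq)
  have two: "2 \<in> carrier Z4" by (simp add: Z.res_carrier_eq)
  obtain \<pi> \<iota> \<xi> h where Q: "cring Q" "\<xi> \<in> carrier Q" "\<iota> \<in> ring_hom Z4 Q"
    "h \<in> ring_hom Q R" "h \<xi> = x" "ring_generated Q {\<xi>}"
    "ring_hom_ring (UP Z4) Q \<pi>" "\<And>f. f \<in> S \<Longrightarrow> \<pi> f = \<zero>\<^bsub>Q\<^esub>"
    "\<And>a i. a \<in> carrier Z4 \<Longrightarrow> \<pi> (monom (UP Z4) a i) = \<iota> a \<otimes>\<^bsub>Q\<^esub> \<xi> [^]\<^bsub>Q\<^esub> i"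
  proof (rule residue_ring_Quot_hom[OF R _ _ x S, folded Q_def])
    show "k f = \<zero>" if "ring_hom_ring (UP Z4) R k" "\<And>a i. a \<in> carrier Z4 \<Longrightarrow> k (monom (UP Z4) a i) = [nat a] \<cdot> \<one> \<otimes> x [^] i"
        "f \<in> S" for k f
      by (rule ker[OF that(1) _ _ that(3)]) (simp_all add: that(2) one x R.add_pow_two two)
  qed (use n in simp_all)
  interpret Q: cring Q by fact
  have i1: "\<iota> 1 = \<one>\<^bsub>Q\<^esub>" using ring_hom_memE(4)[OF Q(3)] by (simp add: Z.res_one_eq)
  show ?thesis
    by (rule that[OF Q(1,2,4-6) _ Q(7,8)])
      (simp_all add: Q(2,9) one i1 two ring_hom_Z4(1,3)[OF Q(3) Q.ring_axioms])
qed

lemma (in cring) double_zero: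
  assumes "\<one> \<oplus> \<one> = \<zero>" "z \<in> carrier R"
  shows "z \<oplus> z = \<zero>"
proof -
  have "z \<oplus> z = (\<one> \<oplus> \<one>) \<otimes> z" using assms(2) by (simp add: l_distr)
  then show ?thesis using assms by simp
qed

text \<open>The additive span of \<open>2\<close>, \<open>2 x\<close>, \<open>1\<close> and
  \<open>x\<close> is closed under multiplication by \<open>x\<close>, because modulo 4 the root
  equation gives \<open>x^2 = 3 x + 3\<close> and \<open>x (2 x) = 2 x + 2\<close>. A root of
  \<open>X^2 + X + 1\<close> has cube \<open>1\<close>, hence the name.\<close>

lemma (in cring) card_le_Z4_cube_root:
  assumes x: "x \<in> carrier R" and gen: "ring_generated R {x}"
    and four: "(\<one> \<oplus> \<one>) \<oplus> (\<one> \<oplus> \<one>) = \<zero>" and root: "x \<otimes> x \<oplus> x \<oplus> \<one> = \<zero>"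
  shows "finite (carrier R)" "card (carrier R) \<le> 16"
proof -
  let ?t = "\<one> \<oplus> \<one>"
  have sq: "x \<otimes> x = x \<oplus> x \<oplus> x \<oplus> \<one> \<oplus> ?t"
  proof -
    \<comment> \<open>The root equation gives \<open>x^2 = -x - 1\<close>. Adding
      \<open>4 (x + 1)\<close>, which is zero, turns the right side into \<open>3 x + 3\<close>, a
      sum without signs.\<close>
    have "x \<otimes> x = (x \<otimes> x \<oplus> x \<oplus> \<one>) \<oplus> (x \<oplus> x \<oplus> x \<oplus> \<one> \<oplus> ?t) \<ominus> (?t \<oplus> ?t) \<otimes> (\<one> \<oplus> x)"
      using x by algebra
    also have "\<dots> = x \<oplus> x \<oplus> x \<oplus> \<one> \<oplus> ?t"
      unfolding root four using x by (simp add: a_minus_def)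
    finally show ?thesis .
  qed
  have xx: "x \<otimes> x = x \<oplus> (\<one> \<oplus> ((x \<oplus> x) \<oplus> ?t))" using sq x by (simp add: a_ac)
  have xt: "x \<otimes> (x \<oplus> x) = (x \<oplus> x) \<oplus> ?t"
  proof -
    have "x \<otimes> (x \<oplus> x) = x \<otimes> x \<oplus> x \<otimes> x" using x by (simp add: r_distr)
    also have "\<dots> = (x \<oplus> x) \<oplus> ?t \<oplus> (?t \<oplus> ?t) \<otimes> (x \<oplus> \<one>)"
      unfolding sq using x by algebra
    also have "\<dots> = (x \<oplus> x) \<oplus> ?t" unfolding four using x by simp
    finally show ?thesis .
  qed
  have xs: "x \<otimes> ?t = x \<oplus> x" using x by (simp add: r_distr)
  have d: "(x \<oplus> x) \<oplus> (x \<oplus> x) = \<zero>"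
  proof -
    have "(x \<oplus> x) \<oplus> (x \<oplus> x) = (?t \<oplus> ?t) \<otimes> x" using x by algebra
    then show ?thesis using four x by simp
  qed
  let ?T = "adjoin R x (adjoin R \<one> (adjoin R (x \<oplus> x) (adjoin R ?t {\<zero>})))"
  have mem: "x \<in> ?T" "x \<oplus> x \<in> ?T" "(x \<oplus> x) \<oplus> ?t \<in> ?T" "x \<oplus> (\<one> \<oplus> ((x \<oplus> x) \<oplus> ?t)) \<in> ?T"
    using x by (simp_all add: adjoin_def)
  show "finite (carrier R)" "card (carrier R) \<le> 16"
    by (rule card_le_16[OF gen _ a_closed[OF one_closed one_closed] a_closed[OF x x] x refl];
      simp add: x four d mem xx xt xs)+
qed

text \<open>The additive span of \<open>s\<close>, \<open>u s\<close>, \<open>1\<close> and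
  \<open>u\<close> is closed under multiplication by \<open>s\<close> and \<open>u\<close>, by
  \<open>u^2 = u + 1\<close> and \<open>s^2 = 0\<close>.\<close>

lemma (in cring) card_le_F4_dual_numbers:
  assumes us: "u \<in> carrier R" "s \<in> carrier R" and gen: "ring_generated R {s, u}"
    and two: "\<one> \<oplus> \<one> = \<zero>" and root: "u \<otimes> u \<oplus> u \<oplus> \<one> = \<zero>" and sq: "s \<otimes> s = \<zero>"
  shows "finite (carrier R)" "card (carrier R) \<le> 16"
proof -
  have uu: "u \<otimes> u = u \<oplus> \<one>"
  proof -
    have "u \<otimes> u = (u \<otimes> u \<oplus> u \<oplus> \<one>) \<oplus> (u \<oplus> \<one>) \<ominus> (\<one> \<oplus> \<one>) \<otimes> (u \<oplus> \<one>)"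
      using us by algebra
    also have "\<dots> = u \<oplus> \<one>"
      unfolding root two using us by (simp add: a_minus_def)
    finally show ?thesis .
  qed
  have r: "s \<otimes> (u \<otimes> s) = \<zero>" "u \<otimes> (u \<otimes> s) = u \<otimes> s \<oplus> s" "s \<otimes> u = u \<otimes> s"
  proof -
    have "s \<otimes> (u \<otimes> s) = u \<otimes> (s \<otimes> s)" using us by (simp add: m_ac)
    then show "s \<otimes> (u \<otimes> s) = \<zero>" using sq us by simp
    show "u \<otimes> (u \<otimes> s) = u \<otimes> s \<oplus> s" using uu us by (simp add: m_assoc[symmetric] l_distr)
    show "s \<otimes> u = u \<otimes> s" using us by (simp add: m_comm)
  qed
  let ?T = "adjoin R u (adjoin R \<one> (adjoin R (u \<otimes> s) (adjoin R s {\<zero>})))"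
  have mem: "\<zero> \<in> ?T" "s \<in> ?T" "u \<in> ?T" "u \<otimes> s \<in> ?T" "u \<otimes> s \<oplus> s \<in> ?T" "u \<oplus> \<one> \<in> ?T"
    using us by (simp_all add: adjoin_def)
  have T: "g \<in> ?T \<and> g \<otimes> (u \<otimes> s) \<in> ?T \<and> g \<otimes> s \<in> ?T \<and> g \<otimes> u \<in> ?T" if g: "g \<in> {s, u}" for g
  proof -
    consider "g = s" | "g = u" using g by blast
    then show ?thesis by cases (simp_all only: r sq uu mem simp_thms)
  qed
  show "finite (carrier R)" "card (carrier R) \<le> 16"
    by (rule card_le_16[OF gen _ us(2) m_closed[OF us] us(1) refl]; use T us double_zero[OF two] in simp)+
qed

lemma (in cring) card_le_square_zero:
  assumes st: "s \<in> carrier R" "t \<in> carrier R" and gen: "ring_generated R {t, s}"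
    and two: "\<one> \<oplus> \<one> = \<zero>" and r: "s \<otimes> s = \<zero>" "s \<otimes> t = \<zero>" "t \<otimes> s = \<zero>" "t \<otimes> t = \<zero>"
  shows "finite (carrier R)" "card (carrier R) \<le> 8"
proof -
  let ?T = "adjoin R \<one> (adjoin R t (adjoin R s {\<zero>}))"
  have mem: "\<zero> \<in> ?T" "t \<in> ?T" "s \<in> ?T" using st by (simp_all add: adjoin_def)
  have T: "g \<in> ?T \<and> g \<otimes> t \<in> ?T \<and> g \<otimes> s \<in> ?T" if g: "g \<in> {t, s}" for g
  proof -
    consider "g = t" | "g = s" using g by blast
    then show ?thesis by cases (simp_all only: r mem simp_thms)
  qed
  show "finite (carrier R)" "card (carrier R) \<le> 8"
    by (rule card_le_8[OF gen _ st refl]; use T st double_zero[OF two] in simp)+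
qed

text \<open>The pattern for all the quotients: the relations of \<open>x\<close> in \<open>R\<close>
  yield a homomorphism \<open>h\<close> with \<open>\<xi> \<mapsto> x\<close>; the same relations,
  read in the quotient, bound its order by that of \<open>R\<close>; and \<open>h\<close> is onto
  because \<open>x\<close> generates \<open>R\<close>.\<close>

lemma iso_Z2X_X2:
  fixes R (structure)
  assumes R: "cring R" "card (carrier R) = 4" and x: "x \<in> carrier R" "ring_generated R {x}"
    and rel: "\<one> \<oplus> \<one> = \<zero>" "x \<otimes> x = \<zero>"
  shows "R \<simeq> Z2X_X2"
proof -
  interpret R: cring R by fact
  interpret Z: residues 2 Z2 by unfold_locales simp
  interpret P: UP_cring Z2 "UP Z2" by unfold_locales
  have m: "monom (UP Z2) a i \<in> carrier (UP Z2)" if "0 \<le> a" "a < 2" for a i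
    using that P.monom_closed by (simp add: Z.res_carrier_eq)
  obtain \<pi> \<xi> h where Q: "cring Z2X_X2" "\<xi> \<in> carrier Z2X_X2"
    "h \<in> ring_hom Z2X_X2 R" "h \<xi> = x" "ring_generated Z2X_X2 {\<xi>}"
    "\<one>\<^bsub>Z2X_X2\<^esub> \<oplus>\<^bsub>Z2X_X2\<^esub> \<one>\<^bsub>Z2X_X2\<^esub> = \<zero>\<^bsub>Z2X_X2\<^esub>"
    "ring_hom_ring (UP Z2) Z2X_X2 \<pi>" "\<And>f. f \<in> {monom (UP Z2) 1 2} \<Longrightarrow> \<pi> f = \<zero>\<^bsub>Z2X_X2\<^esub>"
    "\<And>i. \<pi> (monom (UP Z2) 1 i) = \<xi> [^]\<^bsub>Z2X_X2\<^esub> i"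
  proof (rule Z2_Quot_hom[OF R(1) _ x(1), where S = "{monom (UP Z2) 1 2}", folded Z2X_X2_def])
    show "k f = \<zero>" if "ring_hom_ring (UP Z2) R k" "\<And>i. k (monom (UP Z2) 1 i) = x [^] i"
       "f \<in> {monom (UP Z2) 1 2}" for k f
    proof -
      interpret k: ring_hom_ring "UP Z2" R k by fact
      show ?thesis using that(2)[of 2] that(3) x rel by (simp add: numeral_2_eq_2)
    qed
    show "[(2::nat)] \<cdot> \<one> = \<zero>" using rel by (simp add: R.add_pow_two)
    show "{monom (UP Z2) 1 2} \<subseteq> carrier (UP Z2)" using m by simp
  qed (rule that)
  interpret Q: cring Z2X_X2 by fact
  interpret \<pi>: ring_hom_ring "UP Z2" Z2X_X2 \<pi> by fact
  note dbl = Q.double_zero[OF Q(6)]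
  have sq: "\<xi> \<otimes>\<^bsub>Z2X_X2\<^esub> \<xi> = \<zero>\<^bsub>Z2X_X2\<^esub>"
    using Q(8)[of "monom (UP Z2) 1 2"] Q(9)[of 2] Q(2) by (simp add: numeral_2_eq_2)
  have c: "finite (carrier Z2X_X2)" "card (carrier Z2X_X2) \<le> 4"
    using Q.card_le_4[OF Q(5) _ Q(2) refl] Q(2) sq Q(6) dbl[OF Q(2)] by (auto simp: adjoin_def)
  show ?thesis
    using ring_iso_of_generators[OF Q.ring_axioms R.ring_axioms Q(3) c(1) _ x(2)] c(2) R(2) Q(2,4) by auto
qed

lemma iso_Z2X_X3:
  fixes R (structure)
  assumes R: "cring R" "card (carrier R) = 8" and x: "x \<in> carrier R" "ring_generated R {x}"
    and rel: "\<one> \<oplus> \<one> = \<zero>" "x \<otimes> (x \<otimes> x) = \<zero>"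
  shows "R \<simeq> Z2X_X3"
proof -
  interpret R: cring R by fact
  interpret Z: residues 2 Z2 by unfold_locales simp
  interpret P: UP_cring Z2 "UP Z2" by unfold_locales
  have m: "monom (UP Z2) a i \<in> carrier (UP Z2)" if "0 \<le> a" "a < 2" for a i
    using that P.monom_closed by (simp add: Z.res_carrier_eq)
  obtain \<pi> \<xi> h where Q: "cring Z2X_X3" "\<xi> \<in> carrier Z2X_X3"
    "h \<in> ring_hom Z2X_X3 R" "h \<xi> = x" "ring_generated Z2X_X3 {\<xi>}"
    "\<one>\<^bsub>Z2X_X3\<^esub> \<oplus>\<^bsub>Z2X_X3\<^esub> \<one>\<^bsub>Z2X_X3\<^esub> = \<zero>\<^bsub>Z2X_X3\<^esub>"
    "ring_hom_ring (UP Z2) Z2X_X3 \<pi>" "\<And>f. f \<in> {monom (UP Z2) 1 3} \<Longrightarrow> \<pi> f = \<zero>\<^bsub>Z2X_X3\<^esub>"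
    "\<And>i. \<pi> (monom (UP Z2) 1 i) = \<xi> [^]\<^bsub>Z2X_X3\<^esub> i"
  proof (rule Z2_Quot_hom[OF R(1) _ x(1), where S = "{monom (UP Z2) 1 3}", folded Z2X_X3_def])
    show "k f = \<zero>" if "ring_hom_ring (UP Z2) R k" "\<And>i. k (monom (UP Z2) 1 i) = x [^] i"
       "f \<in> {monom (UP Z2) 1 3}" for k f
    proof -
      interpret k: ring_hom_ring "UP Z2" R k by fact
      show ?thesis using that(2)[of 3] that(3) x rel by (simp add: numeral_3_eq_3 R.m_assoc)
    qed
    show "[(2::nat)] \<cdot> \<one> = \<zero>" using rel by (simp add: R.add_pow_two)
    show "{monom (UP Z2) 1 3} \<subseteq> carrier (UP Z2)" using m by simp
  qed (rule that)
  interpret Q: cring Z2X_X3 by fact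
  interpret \<pi>: ring_hom_ring "UP Z2" Z2X_X3 \<pi> by fact
  note dbl = Q.double_zero[OF Q(6)]
  have sq: "\<xi> \<otimes>\<^bsub>Z2X_X3\<^esub> (\<xi> \<otimes>\<^bsub>Z2X_X3\<^esub> \<xi>) = \<zero>\<^bsub>Z2X_X3\<^esub>"
    using Q(8)[of "monom (UP Z2) 1 3"] Q(9)[of 3] Q(2) by (simp add: numeral_3_eq_3 Q.m_assoc)
  \<comment> \<open>The chain below \<open>1\<close> is spanned by \<open>\<xi>^2\<close> and then
    by \<open>\<xi>\<close>.\<close>
  have c: "finite (carrier Z2X_X3)" "card (carrier Z2X_X3) \<le> 8"
    using Q.card_le_8[OF Q(5) _ Q.m_closed[OF Q(2) Q(2)] Q(2) refl] Q(2) sq Q(6) dbl[OF Q(2)] dbl[OF Q.m_closed[OF Q(2) Q(2)]]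
    by (auto simp: adjoin_def)
  show ?thesis
    using ring_iso_of_generators[OF Q.ring_axioms R.ring_axioms Q(3) c(1) _ x(2)] c(2) R(2) Q(2,4) by auto
qed

lemma iso_Z4X_2X_X2:
  fixes R (structure)
  assumes R: "cring R" "card (carrier R) = 8" and x: "x \<in> carrier R" "ring_generated R {x}"
    and rel: "(\<one> \<oplus> \<one>) \<oplus> (\<one> \<oplus> \<one>) = \<zero>" "(\<one> \<oplus> \<one>) \<otimes> x = \<zero>" "x \<otimes> x = \<zero>"
  shows "R \<simeq> Z4X_2X_X2"
proof -
  interpret R: cring R by fact
  interpret Z: residues 4 Z4 by unfold_locales simp
  interpret P: UP_cring Z4 "UP Z4" by unfold_locales
  have m: "monom (UP Z4) a i \<in> carrier (UP Z4)" if "0 \<le> a" "a < 4" for a i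
    using that P.monom_closed by (simp add: Z.res_carrier_eq)
  obtain \<pi> \<xi> h where Q: "cring Z4X_2X_X2" "\<xi> \<in> carrier Z4X_2X_X2"
    "h \<in> ring_hom Z4X_2X_X2 R" "h \<xi> = x" "ring_generated Z4X_2X_X2 {\<xi>}"
    "(\<one>\<^bsub>Z4X_2X_X2\<^esub> \<oplus>\<^bsub>Z4X_2X_X2\<^esub> \<one>\<^bsub>Z4X_2X_X2\<^esub>) \<oplus>\<^bsub>Z4X_2X_X2\<^esub> (\<one>\<^bsub>Z4X_2X_X2\<^esub> \<oplus>\<^bsub>Z4X_2X_X2\<^esub> \<one>\<^bsub>Z4X_2X_X2\<^esub>) = \<zero>\<^bsub>Z4X_2X_X2\<^esub>"
    "ring_hom_ring (UP Z4) Z4X_2X_X2 \<pi>" "\<And>f. f \<in> {monom (UP Z4) 2 1, monom (UP Z4) 1 2} \<Longrightarrow> \<pi> f = \<zero>\<^bsub>Z4X_2X_X2\<^esub>"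
    "\<And>i. \<pi> (monom (UP Z4) 1 i) = \<xi> [^]\<^bsub>Z4X_2X_X2\<^esub> i"
    "\<And>i. \<pi> (monom (UP Z4) 2 i) = (\<one>\<^bsub>Z4X_2X_X2\<^esub> \<oplus>\<^bsub>Z4X_2X_X2\<^esub> \<one>\<^bsub>Z4X_2X_X2\<^esub>) \<otimes>\<^bsub>Z4X_2X_X2\<^esub> \<xi> [^]\<^bsub>Z4X_2X_X2\<^esub> i"
  proof (rule Z4_Quot_hom[OF R(1) _ x(1), where S = "{monom (UP Z4) 2 1, monom (UP Z4) 1 2}", folded Z4X_2X_X2_def])
    show "k f = \<zero>" if "ring_hom_ring (UP Z4) R k" "\<And>i. k (monom (UP Z4) 1 i) = x [^] i"
      "\<And>i. k (monom (UP Z4) 2 i) = (\<one> \<oplus> \<one>) \<otimes> x [^] i" "f \<in> {monom (UP Z4) 2 1, monom (UP Z4) 1 2}" for k f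
    proof -
      interpret k: ring_hom_ring "UP Z4" R k by fact
      show ?thesis using that(2)[of 2] that(3)[of 1] that(4) x rel by (auto simp: numeral_2_eq_2)
    qed
    show "[(4::nat)] \<cdot> \<one> = \<zero>" using rel by (simp add: R.add_pow_four)
    show "{monom (UP Z4) 2 1, monom (UP Z4) 1 2} \<subseteq> carrier (UP Z4)" using m by simp
  qed (rule that)
  interpret Q: cring Z4X_2X_X2 by fact
  interpret \<pi>: ring_hom_ring "UP Z4" Z4X_2X_X2 \<pi> by fact
  have sq: "\<xi> \<otimes>\<^bsub>Z4X_2X_X2\<^esub> \<xi> = \<zero>\<^bsub>Z4X_2X_X2\<^esub>"
    using Q(8)[of "monom (UP Z4) 1 2"] Q(9)[of 2] Q(2) by (simp add: numeral_2_eq_2)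
  have tw: "(\<one>\<^bsub>Z4X_2X_X2\<^esub> \<oplus>\<^bsub>Z4X_2X_X2\<^esub> \<one>\<^bsub>Z4X_2X_X2\<^esub>) \<otimes>\<^bsub>Z4X_2X_X2\<^esub> \<xi> = \<zero>\<^bsub>Z4X_2X_X2\<^esub>"
    using Q(8)[of "monom (UP Z4) 2 1"] Q(10)[of 1] Q(2) by simp
  have d: "\<xi> \<oplus>\<^bsub>Z4X_2X_X2\<^esub> \<xi> = \<zero>\<^bsub>Z4X_2X_X2\<^esub>"
    using tw Q(2) by (simp add: Q.l_distr)
  have tw': "\<xi> \<otimes>\<^bsub>Z4X_2X_X2\<^esub> (\<one>\<^bsub>Z4X_2X_X2\<^esub> \<oplus>\<^bsub>Z4X_2X_X2\<^esub> \<one>\<^bsub>Z4X_2X_X2\<^esub>) = \<zero>\<^bsub>Z4X_2X_X2\<^esub>"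
    using tw Q(2) by (simp add: Q.m_comm)
  have c: "finite (carrier Z4X_2X_X2)" "card (carrier Z4X_2X_X2) \<le> 8"
    using Q.card_le_8[OF Q(5) _ Q(2) Q.a_closed[OF Q.one_closed Q.one_closed] refl] Q(2) sq tw' Q(6) d by (auto simp: adjoin_def)
  show ?thesis
    using ring_iso_of_generators[OF Q.ring_axioms R.ring_axioms Q(3) c(1) _ x(2)] c(2) R(2) Q(2,4) by auto
qed

lemma iso_Z4X_2X_X2m2:
  fixes R (structure)
  assumes R: "cring R" "card (carrier R) = 8" and x: "x \<in> carrier R" "ring_generated R {x}"
    and rel: "(\<one> \<oplus> \<one>) \<oplus> (\<one> \<oplus> \<one>) = \<zero>" "(\<one> \<oplus> \<one>) \<otimes> x = \<zero>" "x \<otimes> x = \<one> \<oplus> \<one>"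
  shows "R \<simeq> Z4X_2X_X2m2"
proof -
  interpret R: cring R by fact
  interpret Z: residues 4 Z4 by unfold_locales simp
  interpret P: UP_cring Z4 "UP Z4" by unfold_locales
  have m: "monom (UP Z4) a i \<in> carrier (UP Z4)" if "0 \<le> a" "a < 4" for a i
    using that P.monom_closed by (simp add: Z.res_carrier_eq)
  obtain \<pi> \<xi> h where Q: "cring Z4X_2X_X2m2" "\<xi> \<in> carrier Z4X_2X_X2m2"
    "h \<in> ring_hom Z4X_2X_X2m2 R" "h \<xi> = x" "ring_generated Z4X_2X_X2m2 {\<xi>}"
    "(\<one>\<^bsub>Z4X_2X_X2m2\<^esub> \<oplus>\<^bsub>Z4X_2X_X2m2\<^esub> \<one>\<^bsub>Z4X_2X_X2m2\<^esub>) \<oplus>\<^bsub>Z4X_2X_X2m2\<^esub> (\<one>\<^bsub>Z4X_2X_X2m2\<^esub> \<oplus>\<^bsub>Z4X_2X_X2m2\<^esub> \<one>\<^bsub>Z4X_2X_X2m2\<^esub>) = \<zero>\<^bsub>Z4X_2X_X2m2\<^esub>"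
    "ring_hom_ring (UP Z4) Z4X_2X_X2m2 \<pi>" "\<And>f. f \<in> {monom (UP Z4) 2 1, monom (UP Z4) 1 2 \<ominus>\<^bsub>UP Z4\<^esub> monom (UP Z4) 2 0} \<Longrightarrow> \<pi> f = \<zero>\<^bsub>Z4X_2X_X2m2\<^esub>"
    "\<And>i. \<pi> (monom (UP Z4) 1 i) = \<xi> [^]\<^bsub>Z4X_2X_X2m2\<^esub> i"
    "\<And>i. \<pi> (monom (UP Z4) 2 i) = (\<one>\<^bsub>Z4X_2X_X2m2\<^esub> \<oplus>\<^bsub>Z4X_2X_X2m2\<^esub> \<one>\<^bsub>Z4X_2X_X2m2\<^esub>) \<otimes>\<^bsub>Z4X_2X_X2m2\<^esub> \<xi> [^]\<^bsub>Z4X_2X_X2m2\<^esub> i"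
  proof (rule Z4_Quot_hom[OF R(1) _ x(1), where S = "{monom (UP Z4) 2 1, monom (UP Z4) 1 2 \<ominus>\<^bsub>UP Z4\<^esub> monom (UP Z4) 2 0}", folded Z4X_2X_X2m2_def])
    show "k f = \<zero>" if "ring_hom_ring (UP Z4) R k" "\<And>i. k (monom (UP Z4) 1 i) = x [^] i"
      "\<And>i. k (monom (UP Z4) 2 i) = (\<one> \<oplus> \<one>) \<otimes> x [^] i" "f \<in> {monom (UP Z4) 2 1, monom (UP Z4) 1 2 \<ominus>\<^bsub>UP Z4\<^esub> monom (UP Z4) 2 0}" for k f
    proof -
      interpret k: ring_hom_ring "UP Z4" R k by fact
      show ?thesis using that(2)[of 2] that(3)[of 1] that(3)[of 0] that(4) x rel m by (auto simp: numeral_2_eq_2 a_minus_def R.r_neg)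
    qed
    show "[(4::nat)] \<cdot> \<one> = \<zero>" using rel by (simp add: R.add_pow_four)
    show "{monom (UP Z4) 2 1, monom (UP Z4) 1 2 \<ominus>\<^bsub>UP Z4\<^esub> monom (UP Z4) 2 0} \<subseteq> carrier (UP Z4)"
      using m by (auto intro!: P.P.minus_closed)
  qed (rule that)
  interpret Q: cring Z4X_2X_X2m2 by fact
  interpret \<pi>: ring_hom_ring "UP Z4" Z4X_2X_X2m2 \<pi> by fact
  have "\<xi> \<otimes>\<^bsub>Z4X_2X_X2m2\<^esub> \<xi> \<ominus>\<^bsub>Z4X_2X_X2m2\<^esub> (\<one>\<^bsub>Z4X_2X_X2m2\<^esub> \<oplus>\<^bsub>Z4X_2X_X2m2\<^esub> \<one>\<^bsub>Z4X_2X_X2m2\<^esub>) = \<zero>\<^bsub>Z4X_2X_X2m2\<^esub>"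
    using Q(8)[of "monom (UP Z4) 1 2 \<ominus>\<^bsub>UP Z4\<^esub> monom (UP Z4) 2 0"] Q(9)[of 2] Q(10)[of 0] Q(2) m by (simp add: numeral_2_eq_2 a_minus_def)
  then have sq: "\<xi> \<otimes>\<^bsub>Z4X_2X_X2m2\<^esub> \<xi> = \<one>\<^bsub>Z4X_2X_X2m2\<^esub> \<oplus>\<^bsub>Z4X_2X_X2m2\<^esub> \<one>\<^bsub>Z4X_2X_X2m2\<^esub>"
    using Q(2) by simp
  have tw: "(\<one>\<^bsub>Z4X_2X_X2m2\<^esub> \<oplus>\<^bsub>Z4X_2X_X2m2\<^esub> \<one>\<^bsub>Z4X_2X_X2m2\<^esub>) \<otimes>\<^bsub>Z4X_2X_X2m2\<^esub> \<xi> = \<zero>\<^bsub>Z4X_2X_X2m2\<^esub>"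
    using Q(8)[of "monom (UP Z4) 2 1"] Q(10)[of 1] Q(2) by simp
  have d: "\<xi> \<oplus>\<^bsub>Z4X_2X_X2m2\<^esub> \<xi> = \<zero>\<^bsub>Z4X_2X_X2m2\<^esub>"
    using tw Q(2) by (simp add: Q.l_distr)
  have tw': "\<xi> \<otimes>\<^bsub>Z4X_2X_X2m2\<^esub> (\<one>\<^bsub>Z4X_2X_X2m2\<^esub> \<oplus>\<^bsub>Z4X_2X_X2m2\<^esub> \<one>\<^bsub>Z4X_2X_X2m2\<^esub>) = \<zero>\<^bsub>Z4X_2X_X2m2\<^esub>"
    using tw Q(2) by (simp add: Q.m_comm)
  have c: "finite (carrier Z4X_2X_X2m2)" "card (carrier Z4X_2X_X2m2) \<le> 8"
    using Q.card_le_8[OF Q(5) _ Q.a_closed[OF Q.one_closed Q.one_closed] Q(2) refl] Q(2) sq tw' Q(6) d by (auto simp: adjoin_def)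
  show ?thesis
    using ring_iso_of_generators[OF Q.ring_axioms R.ring_axioms Q(3) c(1) _ x(2)] c(2) R(2) Q(2,4) by auto
qed

lemma iso_Z4X_X2_X_1:
  fixes R (structure)
  assumes R: "cring R" "card (carrier R) = 16" and x: "x \<in> carrier R" "ring_generated R {x}"
    and rel: "(\<one> \<oplus> \<one>) \<oplus> (\<one> \<oplus> \<one>) = \<zero>" "x \<otimes> x \<oplus> x \<oplus> \<one> = \<zero>"
  shows "R \<simeq> Z4X_X2_X_1"
proof -
  interpret R: cring R by fact
  interpret Z: residues 4 Z4 by unfold_locales simp
  interpret P: UP_cring Z4 "UP Z4" by unfold_locales
  have m: "monom (UP Z4) a i \<in> carrier (UP Z4)" if "0 \<le> a" "a < 4" for a i
    using that P.monom_closed by (simp add: Z.res_carrier_eq)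
  obtain \<pi> \<xi> h where Q: "cring Z4X_X2_X_1" "\<xi> \<in> carrier Z4X_X2_X_1"
    "h \<in> ring_hom Z4X_X2_X_1 R" "h \<xi> = x" "ring_generated Z4X_X2_X_1 {\<xi>}"
    "(\<one>\<^bsub>Z4X_X2_X_1\<^esub> \<oplus>\<^bsub>Z4X_X2_X_1\<^esub> \<one>\<^bsub>Z4X_X2_X_1\<^esub>) \<oplus>\<^bsub>Z4X_X2_X_1\<^esub> (\<one>\<^bsub>Z4X_X2_X_1\<^esub> \<oplus>\<^bsub>Z4X_X2_X_1\<^esub> \<one>\<^bsub>Z4X_X2_X_1\<^esub>) = \<zero>\<^bsub>Z4X_X2_X_1\<^esub>"
    "ring_hom_ring (UP Z4) Z4X_X2_X_1 \<pi>" "\<And>f. f \<in> {monom (UP Z4) 1 2 \<oplus>\<^bsub>UP Z4\<^esub> monom (UP Z4) 1 1 \<oplus>\<^bsub>UP Z4\<^esub> \<one>\<^bsub>UP Z4\<^esub>} \<Longrightarrow> \<pi> f = \<zero>\<^bsub>Z4X_X2_X_1\<^esub>"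
    "\<And>i. \<pi> (monom (UP Z4) 1 i) = \<xi> [^]\<^bsub>Z4X_X2_X_1\<^esub> i"
    "\<And>i. \<pi> (monom (UP Z4) 2 i) = (\<one>\<^bsub>Z4X_X2_X_1\<^esub> \<oplus>\<^bsub>Z4X_X2_X_1\<^esub> \<one>\<^bsub>Z4X_X2_X_1\<^esub>) \<otimes>\<^bsub>Z4X_X2_X_1\<^esub> \<xi> [^]\<^bsub>Z4X_X2_X_1\<^esub> i"
  proof (rule Z4_Quot_hom[OF R(1) _ x(1), where S = "{monom (UP Z4) 1 2 \<oplus>\<^bsub>UP Z4\<^esub> monom (UP Z4) 1 1 \<oplus>\<^bsub>UP Z4\<^esub> \<one>\<^bsub>UP Z4\<^esub>}", folded Z4X_X2_X_1_def])
    show "k f = \<zero>" if "ring_hom_ring (UP Z4) R k" "\<And>i. k (monom (UP Z4) 1 i) = x [^] i"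
      "\<And>i. k (monom (UP Z4) 2 i) = (\<one> \<oplus> \<one>) \<otimes> x [^] i" "f \<in> {monom (UP Z4) 1 2 \<oplus>\<^bsub>UP Z4\<^esub> monom (UP Z4) 1 1 \<oplus>\<^bsub>UP Z4\<^esub> \<one>\<^bsub>UP Z4\<^esub>}" for k f
    proof -
      interpret k: ring_hom_ring "UP Z4" R k by fact
      show ?thesis using that(2)[of 2] that(2)[of 1] that(4) x rel m by (auto simp: numeral_2_eq_2)
    qed
    show "[(4::nat)] \<cdot> \<one> = \<zero>" using rel by (simp add: R.add_pow_four)
    show "{monom (UP Z4) 1 2 \<oplus>\<^bsub>UP Z4\<^esub> monom (UP Z4) 1 1 \<oplus>\<^bsub>UP Z4\<^esub> \<one>\<^bsub>UP Z4\<^esub>} \<subseteq> carrier (UP Z4)"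
      using m by (auto intro!: P.P.a_closed)
  qed (rule that)
  interpret Q: cring Z4X_X2_X_1 by fact
  interpret \<pi>: ring_hom_ring "UP Z4" Z4X_X2_X_1 \<pi> by fact
  have sq: "\<xi> \<otimes>\<^bsub>Z4X_X2_X_1\<^esub> \<xi> \<oplus>\<^bsub>Z4X_X2_X_1\<^esub> \<xi> \<oplus>\<^bsub>Z4X_X2_X_1\<^esub> \<one>\<^bsub>Z4X_X2_X_1\<^esub> = \<zero>\<^bsub>Z4X_X2_X_1\<^esub>"
    using Q(8)[of "monom (UP Z4) 1 2 \<oplus>\<^bsub>UP Z4\<^esub> monom (UP Z4) 1 1 \<oplus>\<^bsub>UP Z4\<^esub> \<one>\<^bsub>UP Z4\<^esub>"] Q(9)[of 2] Q(9)[of 1] Q(2) m by (simp add: numeral_2_eq_2)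
  note c = Q.card_le_Z4_cube_root[OF Q(2,5,6) sq]
  show ?thesis
    using ring_iso_of_generators[OF Q.ring_axioms R.ring_axioms Q(3) c(1) _ x(2)] c(2) R(2) Q(2,4) by auto
qed

text \<open>Built in two storeys: \<open>\<omega> \<mapsto> u\<close> maps \<open>F4\<close> to
  \<open>R\<close>, and this map is then the coefficient homomorphism for
  \<open>X \<mapsto> s\<close>. What enters about \<open>F4\<close> is that \<open>\<omega>\<close>
  generates it, that \<open>\<omega>\<close> is a root of \<open>X^2 + X + 1\<close>, and that
  \<open>2 = 0\<close>.\<close>

lemma iso_F4X_X2:
  fixes R (structure)
  assumes R: "cring R" "card (carrier R) = 16" and u: "u \<in> carrier R" "s \<in> carrier R" "ring_generated R {u, s}"
    and rel: "\<one> \<oplus> \<one> = \<zero>" "u \<otimes> u \<oplus> u \<oplus> \<one> = \<zero>" "s \<otimes> s = \<zero>"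
  shows "R \<simeq> F4X_X2"
proof -
  interpret R: cring R by fact
  interpret Z: residues 2 Z2 by unfold_locales simp
  interpret P: UP_cring Z2 "UP Z2" by unfold_locales
  have m: "monom (UP Z2) a i \<in> carrier (UP Z2)" if "0 \<le> a" "a < 2" for a i
    using that P.monom_closed by (simp add: Z.res_carrier_eq)
  obtain \<rho> \<omega> g where F: "cring F4" "\<omega> \<in> carrier F4"
    "g \<in> ring_hom F4 R" "g \<omega> = u" "ring_generated F4 {\<omega>}"
    "\<one>\<^bsub>F4\<^esub> \<oplus>\<^bsub>F4\<^esub> \<one>\<^bsub>F4\<^esub> = \<zero>\<^bsub>F4\<^esub>"
    "ring_hom_ring (UP Z2) F4 \<rho>" "\<And>f. f \<in> {monom (UP Z2) 1 2 \<oplus>\<^bsub>UP Z2\<^esub> monom (UP Z2) 1 1 \<oplus>\<^bsub>UP Z2\<^esub> \<one>\<^bsub>UP Z2\<^esub>} \<Longrightarrow> \<rho> f = \<zero>\<^bsub>F4\<^esub>"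
    "\<And>i. \<rho> (monom (UP Z2) 1 i) = \<omega> [^]\<^bsub>F4\<^esub> i"
  proof (rule Z2_Quot_hom[OF R(1) _ u(1), where S = "{monom (UP Z2) 1 2 \<oplus>\<^bsub>UP Z2\<^esub> monom (UP Z2) 1 1 \<oplus>\<^bsub>UP Z2\<^esub> \<one>\<^bsub>UP Z2\<^esub>}", folded F4_def])
    show "k f = \<zero>" if "ring_hom_ring (UP Z2) R k" "\<And>i. k (monom (UP Z2) 1 i) = u [^] i"
       "f \<in> {monom (UP Z2) 1 2 \<oplus>\<^bsub>UP Z2\<^esub> monom (UP Z2) 1 1 \<oplus>\<^bsub>UP Z2\<^esub> \<one>\<^bsub>UP Z2\<^esub>}" for k f
    proof -
      interpret k: ring_hom_ring "UP Z2" R k by fact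
      show ?thesis using that(2)[of 2] that(2)[of 1] that(3) u rel m by (auto simp: numeral_2_eq_2)
    qed
    show "[(2::nat)] \<cdot> \<one> = \<zero>" using rel by (simp add: R.add_pow_two)
    show "{monom (UP Z2) 1 2 \<oplus>\<^bsub>UP Z2\<^esub> monom (UP Z2) 1 1 \<oplus>\<^bsub>UP Z2\<^esub> \<one>\<^bsub>UP Z2\<^esub>} \<subseteq> carrier (UP Z2)"
      using m by (auto intro!: P.P.a_closed)
  qed (rule that)
  interpret F: cring F4 by fact
  interpret \<rho>: ring_hom_ring "UP Z2" F4 \<rho> by fact
  have om: "\<omega> \<otimes>\<^bsub>F4\<^esub> \<omega> \<oplus>\<^bsub>F4\<^esub> \<omega> \<oplus>\<^bsub>F4\<^esub> \<one>\<^bsub>F4\<^esub> = \<zero>\<^bsub>F4\<^esub>"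
    using F(8)[of "monom (UP Z2) 1 2 \<oplus>\<^bsub>UP Z2\<^esub> monom (UP Z2) 1 1 \<oplus>\<^bsub>UP Z2\<^esub> \<one>\<^bsub>UP Z2\<^esub>"] F(9)[of 2] F(9)[of 1] F(2) m by (simp add: numeral_2_eq_2)
  interpret PF: UP_cring F4 "UP F4" by unfold_locales
  let ?X2 = "up_ring.monom (UP F4) \<one>\<^bsub>F4\<^esub> 2"
  have X2: "{?X2} \<subseteq> carrier (UP F4)" by simp
  let ?I = "Idl\<^bsub>UP F4\<^esub> {?X2}"
  have I: "ideal ?I (UP F4)" using PF.P.genideal_ideal[OF X2] .
  have G: "{\<omega>} \<subseteq> carrier F4" using F(2) by simp
  have def: "UP F4 Quot ?I = F4X_X2" by (simp add: F4X_X2_def quot_gen_def)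
  obtain \<pi> \<iota> \<xi> h where Q: "cring F4X_X2" "\<xi> \<in> carrier F4X_X2" "\<iota> \<in> ring_hom F4 F4X_X2"
    "h \<in> ring_hom F4X_X2 R" "\<And>a. a \<in> carrier F4 \<Longrightarrow> h (\<iota> a) = g a" "h \<xi> = s"
    "ring_generated F4X_X2 (insert \<xi> (\<iota> ` {\<omega>}))"
    "\<pi> \<in> ring_hom (UP F4) F4X_X2" "\<And>f. f \<in> ?I \<Longrightarrow> \<pi> f = \<zero>\<^bsub>F4X_X2\<^esub>"
    "\<And>a n. a \<in> carrier F4 \<Longrightarrow> \<pi> (up_ring.monom (UP F4) a n) = \<iota> a \<otimes>\<^bsub>F4X_X2\<^esub> \<xi> [^]\<^bsub>F4X_X2\<^esub> n"
  proof (rule UP_Quot_hom[OF F(1) F(5) G R(1) F(3) u(2) I, unfolded def])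
    fix k f assume k: "k \<in> ring_hom (UP F4) R"
      "\<And>a n. a \<in> carrier F4 \<Longrightarrow> k (up_ring.monom (UP F4) a n) = g a \<otimes> s [^] n" "f \<in> ?I"
    have "k ?X2 = \<zero>"
      using k(2)[of "\<one>\<^bsub>F4\<^esub>" 2] ring_hom_memE(4)[OF F(3)] u(2) rel(3) by (simp add: numeral_2_eq_2)
    then show "k f = \<zero>" using genideal_kernel[OF PF.P.ring_axioms R.ring_axioms k(1) X2 _ k(3)] by simp
  qed (rule that)
  interpret Q: cring F4X_X2 by fact
  interpret \<iota>: ring_hom_ring F4 F4X_X2 \<iota> using Q(3) F.ring_axioms Q.ring_axioms by (intro ring_hom_ringI2)
  define u' where "u' = \<iota> \<omega>"
  have u': "u' \<in> carrier F4X_X2" using F(2) by (simp add: u'_def)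
  have "\<iota> (\<one>\<^bsub>F4\<^esub> \<oplus>\<^bsub>F4\<^esub> \<one>\<^bsub>F4\<^esub>) = \<one>\<^bsub>F4X_X2\<^esub> \<oplus>\<^bsub>F4X_X2\<^esub> \<one>\<^bsub>F4X_X2\<^esub>"
    by simp
  then have two: "\<one>\<^bsub>F4X_X2\<^esub> \<oplus>\<^bsub>F4X_X2\<^esub> \<one>\<^bsub>F4X_X2\<^esub> = \<zero>\<^bsub>F4X_X2\<^esub>"
    using F(6) by simp
  have "\<iota> (\<omega> \<otimes>\<^bsub>F4\<^esub> \<omega> \<oplus>\<^bsub>F4\<^esub> \<omega> \<oplus>\<^bsub>F4\<^esub> \<one>\<^bsub>F4\<^esub>) = u' \<otimes>\<^bsub>F4X_X2\<^esub> u' \<oplus>\<^bsub>F4X_X2\<^esub> u' \<oplus>\<^bsub>F4X_X2\<^esub> \<one>\<^bsub>F4X_X2\<^esub>"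
    using F(2) by (simp add: u'_def)
  then have uu0: "u' \<otimes>\<^bsub>F4X_X2\<^esub> u' \<oplus>\<^bsub>F4X_X2\<^esub> u' \<oplus>\<^bsub>F4X_X2\<^esub> \<one>\<^bsub>F4X_X2\<^esub> = \<zero>\<^bsub>F4X_X2\<^esub>"
    using om by simp
  have "?X2 \<in> ?I" using PF.P.genideal_self[OF X2] by blast
  then have sq: "\<xi> \<otimes>\<^bsub>F4X_X2\<^esub> \<xi> = \<zero>\<^bsub>F4X_X2\<^esub>"
    using Q(9)[of ?X2] Q(10)[of "\<one>\<^bsub>F4\<^esub>" 2] Q(2) by (simp add: numeral_2_eq_2)
  have gen: "ring_generated F4X_X2 {\<xi>, u'}" using Q(7) unfolding u'_def by (simp only: image_insert image_empty)
  note c = Q.card_le_F4_dual_numbers[OF u' Q(2) gen two uu0 sq]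
  have "{u, s} \<subseteq> h ` carrier F4X_X2" using Q(2,6) u' Q(5)[OF F(2)] F(4) by (auto simp: u'_def image_iff)
  then show ?thesis
    using ring_iso_of_generators[OF Q.ring_axioms R.ring_axioms Q(4) c(1) _ u(3)] c(2) R(2) by simp
qed

text \<open>The annihilator of \<open>c\<close> is an ideal and so is its preimage under
  \<open>k\<close>; hence testing the generators suffices. Used twice, this handles products of two
  elements of an ideal without a description of its elements.\<close>

lemma genideal_annihilated:
  fixes R (structure)
  assumes "ring P" "cring R" "k \<in> ring_hom P R" "c \<in> carrier R" "S \<subseteq> carrier P"
    "\<And>f. f \<in> S \<Longrightarrow> c \<otimes> k f = \<zero>" "f \<in> Idl\<^bsub>P\<^esub> S"
  shows "c \<otimes> k f = \<zero>"
proof -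
  interpret R: cring R by fact
  interpret k: ring_hom_ring P R k using assms(1,3) R.ring_axioms by (intro ring_hom_ringI2)
  let ?J = "{r \<in> carrier R. c \<otimes> r = \<zero>}"
  have "ideal ?J R"
  proof (rule idealI[OF R.ring_axioms])
    show "subgroup ?J (add_monoid R)"
      using assms(4) by unfold_locales (auto simp: R.r_distr R.r_minus simp flip: a_inv_def)
    fix a x assume ax: "a \<in> ?J" "x \<in> carrier R"
    have "c \<otimes> (x \<otimes> a) = x \<otimes> (c \<otimes> a)" using ax assms(4) R.m_lcomm[of c x a] by simp
    then show "x \<otimes> a \<in> ?J" using ax by simp
    then show "a \<otimes> x \<in> ?J" using ax R.m_comm[of a x] by simp
  qed
  then have "ideal {r \<in> carrier P. k r \<in> ?J} P" by (rule k.ideal_vimage)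
  moreover have "S \<subseteq> {r \<in> carrier P. k r \<in> ?J}" using assms(5,6) k.hom_closed by blast
  ultimately have "Idl\<^bsub>P\<^esub> S \<subseteq> {r \<in> carrier P. k r \<in> ?J}" by (rule k.R.genideal_minimal)
  then show ?thesis using assms(7) by blast
qed

lemma iso_Z2XY_XY2:
  fixes R (structure)
  assumes R: "cring R" "card (carrier R) = 8" and st: "s \<in> carrier R" "t \<in> carrier R" "ring_generated R {s, t}"
    and rel: "\<one> \<oplus> \<one> = \<zero>" "s \<otimes> s = \<zero>" "s \<otimes> t = \<zero>" "t \<otimes> t = \<zero>"
  shows "R \<simeq> Z2XY_XY2"
proof -
  interpret R: cring R by fact
  interpret Z: residues 2 Z2 by unfold_locales simp
  interpret A: UP_cring Z2 "UP Z2" by unfold_locales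
  interpret P: UP_cring "UP Z2" "UP (UP Z2)" by unfold_locales
  let ?P = "UP (UP Z2)"
  let ?X = "up_ring.monom (UP Z2) \<one>\<^bsub>Z2\<^esub> 1"
  let ?x = "up_ring.monom ?P ?X 0" and ?y = "up_ring.monom ?P \<one>\<^bsub>UP Z2\<^esub> 1"
  let ?I = "Idl\<^bsub>?P\<^esub> {?x, ?y}"
  let ?J = "ideal_prod ?P ?I ?I"
  have xy: "{?x, ?y} \<subseteq> carrier ?P" by simp
  have I: "ideal ?I ?P" using P.P.genideal_ideal[OF xy] .
  have J: "ideal ?J ?P" using P.P.ideal_prod_is_ideal[OF I I] .
  \<comment> \<open>The definition writes the leading coefficient of \<open>X\<close> as the integer
    \<open>1\<close>, which is the unit of \<open>Z2\<close>.\<close>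
  have def: "?P Quot ?J = Z2XY_XY2" by (simp add: Z2XY_XY2_def Let_def Z.res_one_eq)
  have genA: "ring_generated (UP Z2) {?X}"
    using ring_generated_UP[OF Z.cring ring_generated_residue_ring] by simp
  have G: "{?X} \<subseteq> carrier (UP Z2)" by simp
  have "[nat 2] \<cdot> \<one> = \<zero>" using rel by (simp add: R.add_pow_two)
  then have base: "(\<lambda>k. [nat k] \<cdot> \<one>) \<in> ring_hom Z2 R" by (intro R.residue_ring_hom) simp_all
  obtain g where g: "g \<in> ring_hom (UP Z2) R" "g ?X = s"
    using UP_ring_hom_extend[OF Z.cring R(1) base st(1)] by metis
  obtain \<pi> \<iota> \<xi> h where Q: "cring Z2XY_XY2" "\<xi> \<in> carrier Z2XY_XY2" "\<iota> \<in> ring_hom (UP Z2) Z2XY_XY2"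
    "h \<in> ring_hom Z2XY_XY2 R" "\<And>a. a \<in> carrier (UP Z2) \<Longrightarrow> h (\<iota> a) = g a" "h \<xi> = t"
    "ring_generated Z2XY_XY2 (insert \<xi> (\<iota> ` {?X}))"
    "\<pi> \<in> ring_hom ?P Z2XY_XY2" "\<And>f. f \<in> ?J \<Longrightarrow> \<pi> f = \<zero>\<^bsub>Z2XY_XY2\<^esub>"
    "\<And>a n. a \<in> carrier (UP Z2) \<Longrightarrow> \<pi> (up_ring.monom ?P a n) = \<iota> a \<otimes>\<^bsub>Z2XY_XY2\<^esub> \<xi> [^]\<^bsub>Z2XY_XY2\<^esub> n"
  proof (rule UP_Quot_hom[OF A.UP_cring genA G R(1) g(1) st(2) J, unfolded def])
    fix k f assume k: "k \<in> ring_hom ?P R"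
      "\<And>a n. a \<in> carrier (UP Z2) \<Longrightarrow> k (up_ring.monom ?P a n) = g a \<otimes> t [^] n" "f \<in> ?J"
    interpret k: ring_hom_ring ?P R k using k(1) P.P.ring_axioms R.ring_axioms by (intro ring_hom_ringI2)
    have kx: "k ?x = s" using k(2)[of ?X 0] g st by simp
    have ky: "k ?y = t" using k(2)[of "\<one>\<^bsub>UP Z2\<^esub>" 1] ring_hom_memE(4)[OF g(1)] st by simp
    have ts: "t \<otimes> s = \<zero>" using rel st by (simp add: R.m_comm)
    note ann = genideal_annihilated[OF P.P.ring_axioms R(1) k(1) _ xy]
    have ks: "s \<otimes> k i = \<zero>" if "i \<in> ?I" for i
      using ann[OF st(1) _ that] kx ky rel by auto
    have kt: "t \<otimes> k i = \<zero>" if "i \<in> ?I" for i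
      using ann[OF st(2) _ that] kx ky rel ts by auto
    \<comment> \<open>The second use of annihilators, now with \<open>c = k i\<close>: by
      \<open>ks\<close> and \<open>kt\<close> this element kills \<open>s\<close> and
      \<open>t\<close>, the images of the two generators.\<close>
    have kk: "k i \<otimes> k j = \<zero>" if i: "i \<in> ?I" and j: "j \<in> ?I" for i j
    proof -
      have ki: "k i \<in> carrier R" using ideal.Icarr[OF I i] by simp
      have "k i \<otimes> s = \<zero>" "k i \<otimes> t = \<zero>"
        using ks[OF i] kt[OF i] R.m_comm[OF ki st(1)] R.m_comm[OF ki st(2)] by simp_all
      then show ?thesis using ann[OF ki _ j] kx ky by auto
    qed
    from k(3) show "k f = \<zero>"
    proof (induction f rule: ideal_prod.induct)
      case (prod i j)
      then show ?case using kk[OF prod] ideal.Icarr[OF I] by simp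
    next
      case (sum a b)
      then show ?case using P.P.ideal_prod_in_carrier[OF I I] by (simp add: subset_iff)
    qed
  qed (rule that)
  interpret Q: cring Z2XY_XY2 by fact
  interpret \<pi>: ring_hom_ring ?P Z2XY_XY2 \<pi> using Q(8) P.P.ring_axioms Q.ring_axioms by (intro ring_hom_ringI2)
  interpret \<iota>: ring_hom_ring "UP Z2" Z2XY_XY2 \<iota> using Q(3) A.P.ring_axioms Q.ring_axioms by (intro ring_hom_ringI2)
  define \<eta> where "\<eta> = \<iota> ?X"
  have \<eta>: "\<eta> \<in> carrier Z2XY_XY2" by (simp add: \<eta>_def)
  have "(\<iota> \<circ> (\<lambda>a. up_ring.monom (UP Z2) a 0)) \<in> ring_hom Z2 Z2XY_XY2"
    using ring_hom_trans[OF A.const_ring_hom Q(3)] .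
  then have two: "\<one>\<^bsub>Z2XY_XY2\<^esub> \<oplus>\<^bsub>Z2XY_XY2\<^esub> \<one>\<^bsub>Z2XY_XY2\<^esub> = \<zero>\<^bsub>Z2XY_XY2\<^esub>"
    using ring_hom_double_zero Q.ring_axioms by blast
  have px: "\<pi> ?x = \<eta>" using Q(10)[of ?X 0] \<eta> by (simp add: \<eta>_def)
  have py: "\<pi> ?y = \<xi>" using Q(10)[of "\<one>\<^bsub>UP Z2\<^esub>" 1] Q(2) by simp
  have xI: "?x \<in> ?I" "?y \<in> ?I" using P.P.genideal_self[OF xy] by auto
  have z: "\<pi> i \<otimes>\<^bsub>Z2XY_XY2\<^esub> \<pi> j = \<zero>\<^bsub>Z2XY_XY2\<^esub>" if i: "i \<in> ?I" and j: "j \<in> ?I" for i j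
  proof -
    have "i \<otimes>\<^bsub>?P\<^esub> j \<in> ?J" using i j by (rule ideal_prod.prod)
    then show ?thesis using Q(9) \<pi>.hom_mult[OF ideal.Icarr[OF I i] ideal.Icarr[OF I j]] by simp
  qed
  have r: "\<eta> \<otimes>\<^bsub>Z2XY_XY2\<^esub> \<eta> = \<zero>\<^bsub>Z2XY_XY2\<^esub>" "\<eta> \<otimes>\<^bsub>Z2XY_XY2\<^esub> \<xi> = \<zero>\<^bsub>Z2XY_XY2\<^esub>" "\<xi> \<otimes>\<^bsub>Z2XY_XY2\<^esub> \<eta> = \<zero>\<^bsub>Z2XY_XY2\<^esub>" "\<xi> \<otimes>\<^bsub>Z2XY_XY2\<^esub> \<xi> = \<zero>\<^bsub>Z2XY_XY2\<^esub>"
    using z[OF xI(1) xI(1)] z[OF xI(1) xI(2)] z[OF xI(2) xI(1)] z[OF xI(2) xI(2)] unfolding px py by blast+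
  have gen: "ring_generated Z2XY_XY2 {\<xi>, \<eta>}"
    using Q(7) unfolding \<eta>_def by (simp only: image_insert image_empty)
  note c = Q.card_le_square_zero[OF \<eta> Q(2) gen two r]
  have "h \<eta> = s" using Q(5)[of ?X] g(2) by (simp add: \<eta>_def)
  then have "{s, t} \<subseteq> h ` carrier Z2XY_XY2" using Q(2,6) \<eta> by (auto simp: image_iff)
  then show ?thesis
    using ring_iso_of_generators[OF Q.ring_axioms R.ring_axioms Q(4) c(1) _ st(3)] c(2) R(2) by simp
qed

section \<open>Zero divisors and the total graph\<close>

lemma total_graph_edgesI:
  assumes "x \<in> carrier R" "y \<in> carrier R" "x \<noteq> y" "x \<oplus>\<^bsub>R\<^esub> y \<in> zero_divisors R"
  shows "{x, y} \<in> total_graph_edges R"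
  using assms unfolding total_graph_edges_def by blast

lemma obtain_distinct_list:
  assumes "n \<le> card A"
  obtains xs where "distinct xs" "length xs = n" "set xs \<subseteq> A"
proof -
  obtain B where B: "B \<subseteq> A" "card B = n" "finite B"
    using obtain_subset_with_card_n[OF assms] by blast
  then obtain xs where "set xs = B" "distinct xs" using finite_distinct_list by blast
  then show ?thesis using that B distinct_card by metis
qed

lemma (in ring) nonplanar_of_five_zero_divisors:
  assumes J: "additive_subgroup J R" "J \<subseteq> zero_divisors R" "5 \<le> card J"
  shows "\<not> planar_total_graph R"
proof -
  interpret J: additive_subgroup J R by fact
  obtain xs where xs: "distinct xs" "length xs = 5" "set xs \<subseteq> J" using obtain_distinct_list[OF J(3)] .
  then obtain a b c d e where x: "xs = [a, b, c, d, e]"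
    by (auto simp: numeral_eq_Suc length_Suc_conv)
  show ?thesis unfolding planar_total_graph_def
  proof (rule nonplanar_K5)
    show "distinct [a, b, c, d, e]" using xs x by simp
    show "{a, b, c, d, e} \<subseteq> carrier R" using xs x J.a_Hcarr by auto
    fix v w assume vw: "v \<in> {a, b, c, d, e}" "w \<in> {a, b, c, d, e}" "v \<noteq> w"
    then have vwJ: "v \<in> J" "w \<in> J" using xs(3) x by auto
    show "{v, w} \<in> total_graph_edges R"
      using vw(3) J(2) J.a_closed[OF vwJ] J.a_Hcarr[OF vwJ(1)] J.a_Hcarr[OF vwJ(2)] by (intro total_graph_edgesI) auto
  qed
qed

text \<open>The sum of \<open>a + x\<close> and \<open>-a + y\<close> is \<open>x + y\<close>, so
  the cosets \<open>a + J\<close> and \<open>-a + J\<close> are completely joined; they are disjoint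
  as \<open>a + a\<close> is not in \<open>J\<close>. Used with \<open>J\<close> the maximal ideal
  and \<open>a = 1\<close>, and with \<open>J\<close> a block and \<open>a\<close> the idempotent of
  the other block.\<close>

lemma (in ring) nonplanar_of_three_zero_divisors:
  assumes J: "additive_subgroup J R" "J \<subseteq> zero_divisors R" "3 \<le> card J"
    and a: "a \<in> carrier R" "a \<oplus> a \<notin> J" and comm: "cring R"
  shows "\<not> planar_total_graph R"
proof -
  interpret J: additive_subgroup J R by fact
  interpret cring R by fact
  obtain xs where xs: "distinct xs" "length xs = 3" "set xs \<subseteq> J" using obtain_distinct_list[OF J(3)] .
  then obtain i j k where x: "xs = [i, j, k]"
    by (auto simp: numeral_eq_Suc length_Suc_conv)
  have ijk: "i \<in> J" "j \<in> J" "k \<in> J" "i \<noteq> j" "i \<noteq> k" "j \<noteq> k" using xs x by auto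
  have c: "i \<in> carrier R" "j \<in> carrier R" "k \<in> carrier R" using ijk J.a_Hcarr by auto
  have ne: "a \<oplus> x \<noteq> \<ominus> a \<oplus> y" if "x \<in> J" "y \<in> J" for x y
  proof
    assume eq: "a \<oplus> x = \<ominus> a \<oplus> y"
    have xy: "x \<in> carrier R" "y \<in> carrier R" using that J.a_Hcarr by auto
    have "a \<oplus> a = a \<oplus> (a \<oplus> x) \<ominus> x" using a xy by algebra
    also have "\<dots> = y \<ominus> x" unfolding eq using a xy by algebra
    finally show False using a(2) that J.a_closed J.a_inv_closed by (simp add: a_minus_def)
  qed
  have edge: "{a \<oplus> x, \<ominus> a \<oplus> y} \<in> total_graph_edges R" if "x \<in> J" "y \<in> J" for x y
  proof (rule total_graph_edgesI)
    have xy: "x \<in> carrier R" "y \<in> carrier R" using that J.a_Hcarr by auto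
    then show "a \<oplus> x \<in> carrier R" "\<ominus> a \<oplus> y \<in> carrier R" using a by auto
    show "a \<oplus> x \<noteq> \<ominus> a \<oplus> y" using ne that .
    have "(a \<oplus> x) \<oplus> (\<ominus> a \<oplus> y) = x \<oplus> y" using a xy by algebra
    then show "(a \<oplus> x) \<oplus> (\<ominus> a \<oplus> y) \<in> zero_divisors R"
      using J.a_closed[OF that] J(2) by auto
  qed
  have aa: "a \<noteq> \<ominus> a" using ne[OF ijk(1,1)] by auto
  show ?thesis unfolding planar_total_graph_def
  proof (rule nonplanar_K33)
    show "distinct [a \<oplus> i, a \<oplus> j, a \<oplus> k, \<ominus> a \<oplus> i, \<ominus> a \<oplus> j, \<ominus> a \<oplus> k]"
      using ne aa ijk c a by simp
    show "{a \<oplus> i, a \<oplus> j, a \<oplus> k, \<ominus> a \<oplus> i, \<ominus> a \<oplus> j, \<ominus> a \<oplus> k} \<subseteq> carrier R"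
      using a c by simp
    fix v w assume "v \<in> {a \<oplus> i, a \<oplus> j, a \<oplus> k}" "w \<in> {\<ominus> a \<oplus> i, \<ominus> a \<oplus> j, \<ominus> a \<oplus> k}"
    then obtain x y where "v = a \<oplus> x" "w = \<ominus> a \<oplus> y" "x \<in> J" "y \<in> J" using ijk by blast
    then show "{v, w} \<in> total_graph_edges R" using edge by simp
  qed
qed

text \<open>From \<open>e + e = 0\<close> the sum of \<open>e - x\<close> and \<open>e - y\<close>
  is \<open>-(x + y)\<close>, so \<open>e - J\<close> is a clique like \<open>J\<close>. Subtracting
  from \<open>e\<close> makes \<open>x\<close> and \<open>e - x\<close> sum to \<open>e\<close>,
  which provides the matching between the two cliques.\<close>

lemma (in ring) nonplanar_of_four_zero_divisors:
  assumes J: "additive_subgroup J R" "J \<subseteq> zero_divisors R" "4 \<le> card J"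
    and e: "e \<in> zero_divisors R" "e \<notin> J" "e \<oplus> e = \<zero>" and comm: "cring R"
  shows "\<not> planar_total_graph R"
proof -
  interpret J: additive_subgroup J R by fact
  interpret cring R by fact
  have ec: "e \<in> carrier R" using e(1) by (simp add: zero_divisors_def)
  obtain xs where xs: "distinct xs" "length xs = 4" "set xs \<subseteq> J" using obtain_distinct_list[OF J(3)] .
  then obtain i j k l where x: "xs = [i, j, k, l]"
    by (auto simp: numeral_eq_Suc length_Suc_conv)
  have ijk: "i \<in> J" "j \<in> J" "k \<in> J" "l \<in> J" "i \<noteq> j" "i \<noteq> k" "i \<noteq> l" "j \<noteq> k" "j \<noteq> l" "k \<noteq> l"
    using xs x by auto
  have c: "i \<in> carrier R" "j \<in> carrier R" "k \<in> carrier R" "l \<in> carrier R" using ijk J.a_Hcarr by auto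
  have ne: "x \<noteq> e \<ominus> y" if "x \<in> J" "y \<in> J" for x y
  proof
    assume eq: "x = e \<ominus> y"
    have xy: "x \<in> carrier R" "y \<in> carrier R" using that J.a_Hcarr by auto
    have "e = (e \<ominus> y) \<oplus> y" using ec xy by algebra
    then have "e = x \<oplus> y" unfolding eq .
    then show False using e(2) J.a_closed[OF that] by simp
  qed
  have inj: "e \<ominus> x = e \<ominus> y \<longleftrightarrow> x = y" if "x \<in> J" "y \<in> J" for x y
  proof -
    have "x = e \<ominus> (e \<ominus> x)" "y = e \<ominus> (e \<ominus> y)"
      using ec J.a_Hcarr[OF that(1)] J.a_Hcarr[OF that(2)] by algebra+
    then show ?thesis by metis
  qed
  have edge1: "{x, y} \<in> total_graph_edges R" if xy: "x \<in> J" "y \<in> J" "x \<noteq> y" for x y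
    using xy(3) J.a_closed[OF xy(1,2)] J.a_Hcarr[OF xy(1)] J.a_Hcarr[OF xy(2)] J(2) by (intro total_graph_edgesI) auto
  have edge2: "{e \<ominus> x, e \<ominus> y} \<in> total_graph_edges R" if xyJ: "x \<in> J" "y \<in> J" "x \<noteq> y" for x y
  proof (rule total_graph_edgesI)
    have xy: "x \<in> carrier R" "y \<in> carrier R" using xyJ J.a_Hcarr by auto
    then show "e \<ominus> x \<in> carrier R" "e \<ominus> y \<in> carrier R" using ec by auto
    show "e \<ominus> x \<noteq> e \<ominus> y" using inj xyJ by simp
    have "(e \<ominus> x) \<oplus> (e \<ominus> y) = (e \<oplus> e) \<ominus> (x \<oplus> y)" using ec xy by algebra
    also have "\<dots> = \<ominus> (x \<oplus> y)" using e(3) xy by (simp add: a_minus_def)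
    finally show "(e \<ominus> x) \<oplus> (e \<ominus> y) \<in> zero_divisors R"
      using J.a_inv_closed[OF J.a_closed[OF xyJ(1,2)]] J(2) by auto
  qed
  have edge3: "{x, e \<ominus> x} \<in> total_graph_edges R" if xJ: "x \<in> J" for x
  proof (rule total_graph_edgesI)
    show x: "x \<in> carrier R" using xJ J.a_Hcarr by auto
    then show "e \<ominus> x \<in> carrier R" using ec by auto
    show "x \<noteq> e \<ominus> x" using ne xJ by simp
    have "x \<oplus> (e \<ominus> x) = e" using ec x by algebra
    then show "x \<oplus> (e \<ominus> x) \<in> zero_divisors R" using e(1) by simp
  qed
  show ?thesis unfolding planar_total_graph_def
  proof (rule nonplanar_K4_box_K2)
    show "distinct [i, j, k, l, e \<ominus> i, e \<ominus> j, e \<ominus> k, e \<ominus> l]"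
      using ne inj ijk by simp
    show "{i, j, k, l, e \<ominus> i, e \<ominus> j, e \<ominus> k, e \<ominus> l} \<subseteq> carrier R"
      using ec c by simp
    show "{v, w} \<in> total_graph_edges R" if "v \<in> {i, j, k, l}" "w \<in> {i, j, k, l}" "v \<noteq> w" for v w
      using that ijk by (intro edge1) blast+
    show "{v, w} \<in> total_graph_edges R"
      if vw: "v \<in> {e \<ominus> i, e \<ominus> j, e \<ominus> k, e \<ominus> l}" "w \<in> {e \<ominus> i, e \<ominus> j, e \<ominus> k, e \<ominus> l}" "v \<noteq> w" for v w
    proof -
      obtain x y where "v = e \<ominus> x" "w = e \<ominus> y" "x \<in> J" "y \<in> J" using vw ijk by blast
      then show ?thesis using edge2[of x y] vw(3) by auto
    qed
  qed (use edge3 ijk in blast)+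
qed

section \<open>Units, maximal ideals and idempotents in finite rings\<close>

lemma (in cring) nonunit_zero_divisor:
  assumes "finite (carrier R)" "x \<in> carrier R" "x \<notin> Units R"
  shows "x \<in> zero_divisors R"
proof (rule ccontr)
  assume nz: "x \<notin> zero_divisors R"
  have "inj_on ((\<otimes>) x) (carrier R)"
  proof (rule inj_onI)
    fix y z assume yz: "y \<in> carrier R" "z \<in> carrier R" "x \<otimes> y = x \<otimes> z"
    have "x \<otimes> (y \<ominus> z) = x \<otimes> y \<ominus> x \<otimes> z" using assms yz(1,2) by algebra
    also have "\<dots> = \<zero>" using yz assms by (simp add: a_minus_def r_neg)
    finally have "x \<otimes> (y \<ominus> z) = \<zero>" .
    moreover have "y \<ominus> z \<in> carrier R" using yz by simp
    ultimately have "y \<ominus> z = \<zero>" using nz assms(2) unfolding zero_divisors_def by blast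
    then show "y = z" using yz by simp
  qed
  \<comment> \<open>On a finite set injectivity gives surjectivity, so \<open>1\<close> is a
    multiple of \<open>x\<close>.\<close>
  then have "(\<otimes>) x ` carrier R = carrier R"
    using assms by (intro endo_inj_surj) auto
  then obtain y where "y \<in> carrier R" "x \<otimes> y = \<one>" by (metis imageE one_closed)
  then show False using assms m_comm unfolding Units_def by auto
qed

lemma (in cring) ideal_proper_iff:
  assumes "ideal I R"
  shows "I = carrier R \<longleftrightarrow> \<not> I \<inter> Units R = {}"
proof
  assume "I = carrier R" then show "\<not> I \<inter> Units R = {}" using one_closed Units_one_closed by blast
next
  interpret ideal I R by fact
  assume "\<not> I \<inter> Units R = {}"
  then obtain u where u: "u \<in> I" "u \<in> Units R" by blast
  then have "inv u \<otimes> u \<in> I" by (intro I_l_closed) auto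
  then show "I = carrier R" using one_imp_carrier u by simp
qed

lemma (in cring) maximal_ideal_above:
  assumes "finite (carrier R)" "ideal I R" "I \<noteq> carrier R"
  obtains M where "maximalideal M R" "I \<subseteq> M"
proof -
  let ?F = "{J. ideal J R \<and> I \<subseteq> J \<and> J \<noteq> carrier R}"
  have "?F \<subseteq> {J. J \<subseteq> carrier R}"
  proof
    fix J assume "J \<in> ?F"
    then have "ideal J R" by simp
    then show "J \<in> {J. J \<subseteq> carrier R}" using ideal.Icarr[of J R] by (intro CollectI subsetI)
  qed
  then have fin: "finite ?F" using finite_Collect_subsets[OF assms(1)] finite_subset by blast
  have "I \<in> ?F" using assms by auto
  from finite_has_maximal2[OF fin this] obtain M
    where M: "M \<in> ?F" "I \<subseteq> M \<and> (\<forall>J\<in>?F. M \<subseteq> J \<longrightarrow> M = J)" ..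
  have "maximalideal M R"
  proof (rule maximalidealI)
    show "ideal M R" "carrier R \<noteq> M" using M(1) by auto
    fix J assume J: "ideal J R" "M \<subseteq> J" "J \<subseteq> carrier R"
    show "J = M \<or> J = carrier R"
    proof (cases "J = carrier R")
      case False
      then have "J \<in> ?F" using J M(1) by auto
      then have "M = J" using M(2) J(2) by blast
      then show ?thesis by simp
    qed simp
  qed
  then show ?thesis using that[of M] M(1) by simp
qed

text \<open>The principal ideal of a nonunit is proper, hence lies in a maximal ideal, and there is
  only one of these.\<close>

lemma (in cring) local_ring_nonunits:
  assumes "finite (carrier R)" "local_ring R"
  obtains M where "maximalideal M R" "M = carrier R - Units R"
proof -
  obtain M where M: "maximalideal M R" "\<And>N. maximalideal N R \<Longrightarrow> N = M"
    using assms(2) unfolding local_ring_def by blast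
  interpret maximalideal M R by fact
  have "M \<inter> Units R = {}" using ideal_proper_iff[OF is_ideal] I_notcarr by blast
  moreover have "x \<in> M" if x: "x \<in> carrier R" "x \<notin> Units R" for x
  proof -
    have "PIdl x \<inter> Units R = {}"
    proof -
      have "y \<otimes> x \<notin> Units R" if "y \<in> carrier R" for y using unit_factor x that m_comm by metis
      then show ?thesis by (auto simp: cgenideal_def)
    qed
    then have "PIdl x \<noteq> carrier R" using ideal_proper_iff[OF cgenideal_ideal[OF x(1)]] by blast
    then obtain N where "maximalideal N R" "PIdl x \<subseteq> N"
      by (rule maximal_ideal_above[OF assms(1) cgenideal_ideal[OF x(1)]])
    then show ?thesis using M(2)[of N] cgenideal_self[OF x(1)] by auto
  qed
  moreover have "M \<subseteq> carrier R" using Icarr by (rule subsetI)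
  ultimately have "M = carrier R - Units R" by auto
  then show ?thesis by (rule that[OF M(1)])
qed

text \<open>The powers of \<open>x\<close> are periodic from some exponent \<open>i\<close> on, with
  a period \<open>p\<close>. An exponent \<open>n \<ge> i\<close> that is divisible by
  \<open>p\<close> gives \<open>x^(2 n) = x^n\<close>.\<close>

lemma (in cring) finite_pow_idempotent:
  assumes "finite (carrier R)" "x \<in> carrier R"
  obtains n :: nat where "n > 0" "x [^] n \<otimes> x [^] n = x [^] n"
proof -
  have "\<not> inj_on (\<lambda>n::nat. x [^] n) UNIV"
  proof
    assume "inj_on (\<lambda>n::nat. x [^] n) UNIV"
    moreover have "range (\<lambda>n::nat. x [^] n) \<subseteq> carrier R" using assms(2) by auto
    ultimately show False using assms(1) finite_subset finite_imageD infinite_UNIV_nat by metis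
  qed
  then obtain i j :: nat where ij: "i < j" "x [^] i = x [^] j"
    unfolding inj_on_def by (metis linorder_neqE_nat UNIV_I)
  define p where "p = j - i"
  have p: "p > 0" "x [^] (i + p) = x [^] i" using ij by (simp_all add: p_def)
  have step: "x [^] (m + p) = x [^] m" if "m \<ge> i" for m
  proof -
    from le_Suc_ex[OF that] obtain k where k: "m = i + k" by blast
    have "x [^] (m + p) = x [^] (i + p) \<otimes> x [^] k" "x [^] m = x [^] i \<otimes> x [^] k"
      unfolding k using nat_pow_mult[OF assms(2), of "i + p" k] nat_pow_mult[OF assms(2), of i k]
      by (simp_all add: ac_simps)
    then show ?thesis using p(2) by simp
  qed
  have mult: "x [^] (m + q * p) = x [^] m" if "m \<ge> i" for m q
  proof (induction q)
    case (Suc q)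
    have "x [^] (m + Suc q * p) = x [^] ((m + q * p) + p)" by (simp add: algebra_simps)
    then show ?case using step[of "m + q * p"] Suc that by simp
  qed simp
  \<comment> \<open>A multiple of \<open>p\<close> that is at least \<open>i\<close>;
    \<open>Suc i\<close> instead of \<open>i\<close> keeps it positive when
    \<open>i = 0\<close>.\<close>
  let ?n = "Suc i * p"
  have "?n > 0" using p(1) by simp
  moreover have "?n \<ge> i" using p(1) by (metis Suc_leD mult.commute mult_le_mono1 nat_mult_1 Suc_leI One_nat_def)
  then have "x [^] (?n + ?n) = x [^] ?n" using mult[of ?n "Suc i"] by blast
  then have "x [^] ?n \<otimes> x [^] ?n = x [^] ?n" using assms(2) by (simp add: nat_pow_mult)
  ultimately show ?thesis using that by blast
qed

text \<open>If nonunits were closed under addition, they would form the unique maximal ideal. So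
  there are nonunits with a unit as sum, and after scaling \<open>a + b = 1\<close>. The idempotent
  is a power of \<open>a\<close>: it is not \<open>1\<close> because \<open>a\<close> is no unit,
  and not \<open>0\<close> because \<open>a\<close> is \<open>1\<close> modulo the nonunit
  \<open>b\<close>.\<close>

lemma (in cring) nonlocal_idempotent:
  assumes "finite (carrier R)" "\<one> \<noteq> \<zero>" "\<not> local_ring R"
  obtains e where "e \<in> carrier R" "e \<otimes> e = e" "e \<noteq> \<zero>" "e \<noteq> \<one>"
proof -
  let ?N = "carrier R - Units R"
  have mulN: "r \<otimes> x \<in> ?N" if "x \<in> ?N" "r \<in> carrier R" for x r
    using that unit_factor[of x r] m_comm[of x r] by auto
  have "\<exists>x\<in>?N. \<exists>y\<in>?N. x \<oplus> y \<notin> ?N"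
  proof (rule ccontr)
    assume "\<not> ?thesis"
    then have add: "x \<oplus> y \<in> ?N" if "x \<in> ?N" "y \<in> ?N" for x y using that by blast
    have z: "\<zero> \<in> ?N" using assms(2) by (auto simp: Units_def)
    have N: "ideal ?N R"
    proof (rule idealI[OF ring_axioms])
      show "subgroup ?N (add_monoid R)"
      proof
        show "?N \<subseteq> carrier (add_monoid R)" by auto
        show "x \<otimes>\<^bsub>add_monoid R\<^esub> y \<in> ?N" if "x \<in> ?N" "y \<in> ?N" for x y using add[OF that] by simp
        show "\<one>\<^bsub>add_monoid R\<^esub> \<in> ?N" using z by simp
        show "inv\<^bsub>add_monoid R\<^esub> x \<in> ?N" if x: "x \<in> ?N" for x
        proof -
          have "\<ominus> \<one> \<otimes> x \<in> ?N" using mulN[OF x, of "\<ominus> \<one>"] by simp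
          then have "\<ominus> x \<in> ?N" using x by (simp add: l_minus)
          then show ?thesis by (simp add: a_inv_def)
        qed
      qed
      show "x \<otimes> a \<in> ?N" "a \<otimes> x \<in> ?N" if "a \<in> ?N" "x \<in> carrier R" for a x
        using mulN[OF that] m_comm[of a x] that by auto
    qed
    have sub: "J \<subseteq> ?N" if "ideal J R" "J \<noteq> carrier R" for J
      using ideal_proper_iff[OF that(1)] that(2) ideal.Icarr[OF that(1)] by blast
    have "\<one> \<notin> ?N" by simp
    then have neq: "?N \<noteq> carrier R" using one_closed by blast
    have "maximalideal ?N R"
      using N neq sub by (intro maximalidealI) blast+
    moreover have "K = ?N" if K: "maximalideal K R" for K
    proof -
      interpret K: maximalideal K R by fact
      have "K \<subseteq> ?N" using sub[OF K.is_ideal] K.I_notcarr by blast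
      then show ?thesis using K.I_maximal[OF N] neq by blast
    qed
    ultimately have "local_ring R" unfolding local_ring_def using is_cring by blast
    then show False using assms(3) by simp
  qed
  then obtain x y where xy: "x \<in> ?N" "y \<in> ?N" "x \<oplus> y \<in> Units R" by auto
  define w where "w = inv (x \<oplus> y)"
  have w: "w \<in> carrier R" "w \<otimes> (x \<oplus> y) = \<one>" using xy(3) by (simp_all add: w_def)
  define a b where "a = w \<otimes> x" and "b = w \<otimes> y"
  have ab: "a \<in> ?N" "b \<in> ?N" "a \<oplus> b = \<one>"
    using mulN xy w by (simp_all add: a_def b_def r_distr)
  obtain n :: nat where n: "n > 0" "a [^] n \<otimes> a [^] n = a [^] n"
    using finite_pow_idempotent[OF assms(1)] ab(1) by blast
  have ac: "a \<in> carrier R" "b \<in> carrier R" using ab by auto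
  have "a [^] n \<noteq> \<one>"
  proof
    assume e: "a [^] n = \<one>"
    obtain m where "n = Suc m" using n(1) gr0_implies_Suc by blast
    then have "a [^] m \<otimes> a = \<one>" using e by simp
    then have "a [^] m \<otimes> a \<in> Units R" by simp
    then show False using mulN[OF ab(1), of "a [^] m"] ac by simp
  qed
  moreover have "a [^] n \<noteq> \<zero>"
  proof
    assume e: "a [^] n = \<zero>"
    \<comment> \<open>Every power of \<open>a\<close> is \<open>1\<close> modulo \<open>b\<close>,
      with an explicit cofactor \<open>r\<close>. At \<open>k = n\<close> this reads
      \<open>1 = r b\<close>.\<close>
    have "\<exists>r\<in>carrier R. \<one> = a [^] k \<oplus> r \<otimes> b" for k :: nat
    proof (induction k)
      case 0 show ?case using ac by (intro bexI[of _ \<zero>]) auto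
    next
      case (Suc k)
      then obtain r where r: "r \<in> carrier R" "\<one> = a [^] k \<oplus> r \<otimes> b" by blast
      have pc: "a [^] k \<in> carrier R" using ac by simp
      have "a [^] k = a [^] k \<otimes> (a \<oplus> b)" using ab(3) pc by simp
      also have "\<dots> = a [^] Suc k \<oplus> a [^] k \<otimes> b" using pc ac by (simp add: r_distr)
      finally have "\<one> = (a [^] Suc k \<oplus> a [^] k \<otimes> b) \<oplus> r \<otimes> b" using r(2) by simp
      also have "\<dots> = a [^] Suc k \<oplus> (a [^] k \<oplus> r) \<otimes> b"
        using pc ac r(1) by (simp add: l_distr a_assoc)
      finally show ?case using pc r(1) by (intro bexI[of _ "a [^] k \<oplus> r"]) auto
    qed
    then obtain r where "r \<in> carrier R" "\<one> = \<zero> \<oplus> r \<otimes> b" using e by metis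
    then have "r \<otimes> b = \<one>" "r \<in> carrier R" using ac by auto
    then have "r \<otimes> b \<in> Units R" "r \<in> carrier R" by simp_all
    then show False using mulN[OF ab(2)] by blast
  qed
  ultimately show ?thesis using that[of "a [^] n"] n ac by simp
qed

section \<open>Rings with a nontrivial idempotent\<close>

lemma (in ring) additive_subgroup_card_2:
  assumes J: "additive_subgroup J R" "card J = 2" and e: "e \<in> J" "e \<noteq> \<zero>"
  shows "J = {\<zero>, e}" "e \<oplus> e = \<zero>"
proof -
  interpret J: additive_subgroup J R by fact
  have fin: "finite J" using J(2) by (metis card.infinite zero_neq_numeral)
  show eq: "J = {\<zero>, e}"
    using card_subset_eq[OF fin, of "{\<zero>, e}"] J(2) e J.zero_closed by simp
  have "e \<oplus> e \<in> {\<zero>, e}" using J.a_closed[OF e(1) e(1)] eq by simp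
  then show "e \<oplus> e = \<zero>" using e J.a_Hcarr[OF e(1)] by simp
qed

text \<open>If \<open>e + e\<close> were zero, a third element \<open>t\<close> would bring a fourth
  one, \<open>e + t\<close>. So \<open>e + e\<close> is the third element, and the triple of
  \<open>e\<close>, being neither \<open>e\<close> nor \<open>e + e\<close>, is zero.\<close>

lemma (in ring) additive_subgroup_card_3:
  assumes J: "additive_subgroup J R" "card J = 3" and e: "e \<in> J" "e \<noteq> \<zero>"
  shows "J = {\<zero>, e, e \<oplus> e}" "e \<oplus> e \<noteq> \<zero>" "e \<oplus> e \<oplus> e = \<zero>"
proof -
  interpret J: additive_subgroup J R by fact
  have fin: "finite J" using J(2) by (metis card.infinite zero_neq_numeral)
  have ec: "e \<in> carrier R" using J.a_Hcarr e by blast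
  show ne: "e \<oplus> e \<noteq> \<zero>"
  proof
    assume ee: "e \<oplus> e = \<zero>"
    have "\<not> J \<subseteq> {\<zero>, e}"
      using card_mono[of "{\<zero>, e}" J] J(2) card_insert_le_m1[of 2 "{e}" \<zero>] by auto
    then obtain t where t: "t \<in> J" "t \<noteq> \<zero>" "t \<noteq> e" by blast
    have tc: "t \<in> carrier R" using J.a_Hcarr t by blast
    have "e \<oplus> t \<noteq> \<zero>"
    proof
      assume "e \<oplus> t = \<zero>"
      then have "e \<oplus> t = e \<oplus> e" using ee by simp
      then show False using t tc ec by simp
    qed
    then have "card {\<zero>, e, t, e \<oplus> t} = 4" using t e tc ec by auto
    moreover have "{\<zero>, e, t, e \<oplus> t} \<subseteq> J" using t e by simp
    ultimately show False using card_mono[OF fin, of "{\<zero>, e, t, e \<oplus> t}"] J(2) by simp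
  qed
  have "card {\<zero>, e, e \<oplus> e} = 3" using ne e ec by auto
  moreover have "{\<zero>, e, e \<oplus> e} \<subseteq> J" using e by simp
  ultimately show eq: "J = {\<zero>, e, e \<oplus> e}" using card_subset_eq[OF fin] J(2) by metis
  have "e \<oplus> e \<oplus> e \<in> {\<zero>, e, e \<oplus> e}" using e unfolding eq[symmetric] by simp
  moreover have "e \<oplus> e \<oplus> e = (e \<oplus> e) \<oplus> e" by simp
  ultimately show "e \<oplus> e \<oplus> e = \<zero>"
    using ne e ec add.m_assoc[of e e e] by auto
qed

text \<open>For idempotent \<open>e\<close> this is the ideal \<open>e R\<close>. Describing it by
  fixed points makes membership a single equation.\<close>

definition idempotent_block :: "('a, 'm) ring_scheme \<Rightarrow> 'a \<Rightarrow> 'a set" where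
  "idempotent_block R e = {z \<in> carrier R. e \<otimes>\<^bsub>R\<^esub> z = z}"

text \<open>Symmetric in \<open>e\<close> and \<open>f\<close>: the consequences of
  \<open>f = 1 - e\<close> are recorded for both, so that \<open>swap\<close> carries each result
  about one block over to the other.\<close>

locale split_ring = cring R for R (structure) +
  fixes e f
  assumes ef: "e \<in> carrier R" "f \<in> carrier R" "e \<oplus> f = \<one>" "e \<otimes> e = e" "e \<otimes> f = \<zero>" "f \<otimes> e = \<zero>" "f \<otimes> f = f"
    and nz: "e \<noteq> \<zero>" "f \<noteq> \<zero>"
begin

lemma swap: "split_ring R f e"
  using ef nz by unfold_locales (simp_all add: a_comm)

lemma block_subgroup: "additive_subgroup (idempotent_block R e) R"
  using ef by unfold_locales (auto simp: idempotent_block_def r_distr r_minus simp flip: a_inv_def)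

lemma block_zero_divisors: "idempotent_block R e \<subseteq> zero_divisors R"
proof
  fix z assume "z \<in> idempotent_block R e"
  then have z: "z \<in> carrier R" "e \<otimes> z = z" by (simp_all add: idempotent_block_def)
  have "z \<otimes> f = (f \<otimes> e) \<otimes> z" using z ef(1,2) m_comm[OF z(1) ef(2)] by (simp add: m_assoc)
  then show "z \<in> zero_divisors R" using z ef nz unfolding zero_divisors_def by auto
qed

lemma e_in_block: "e \<in> idempotent_block R e"
  using ef by (simp add: idempotent_block_def)

lemma block_mult: "z \<in> idempotent_block R e \<Longrightarrow> e \<otimes> z = z" "z \<in> idempotent_block R f \<Longrightarrow> e \<otimes> z = \<zero>"
proof -
  show "z \<in> idempotent_block R e \<Longrightarrow> e \<otimes> z = z" by (simp add: idempotent_block_def)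
  assume "z \<in> idempotent_block R f"
  then have z: "z \<in> carrier R" "f \<otimes> z = z" by (simp_all add: idempotent_block_def)
  then have "e \<otimes> z = (e \<otimes> f) \<otimes> z" using ef(1,2) by (simp add: m_assoc)
  then show "e \<otimes> z = \<zero>" using ef z by simp
qed

text \<open>The additive order of \<open>e\<close> limits the other block. A nonzero
  \<open>e + e\<close> lies outside that block, and K3,3 appears as soon as it has three elements;
  if \<open>e + e\<close> is zero, the prism appears from four elements on.\<close>

lemma block_card_le:
  assumes "planar_total_graph R"
  shows "card (idempotent_block R f) \<le> 3" "e \<oplus> e \<noteq> \<zero> \<Longrightarrow> card (idempotent_block R f) \<le> 2"
proof -
  interpret s: split_ring R f e by (rule swap)
  have eZ: "e \<in> zero_divisors R" using e_in_block block_zero_divisors by blast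
  have en: "e \<notin> idempotent_block R f" using block_mult(2) ef(4) nz by metis
  show two: "card (idempotent_block R f) \<le> 2" if ee: "e \<oplus> e \<noteq> \<zero>"
  proof (rule ccontr)
    assume "\<not> ?thesis"
    moreover have "e \<otimes> (e \<oplus> e) = e \<oplus> e" using ef by (simp add: r_distr)
    then have "e \<oplus> e \<notin> idempotent_block R f" using block_mult(2) ee by metis
    ultimately show False
      using nonplanar_of_three_zero_divisors[OF s.block_subgroup s.block_zero_divisors _ ef(1) _ is_cring] assms by simp
  qed
  show "card (idempotent_block R f) \<le> 3"
  proof (rule ccontr)
    assume n: "\<not> ?thesis"
    then have "e \<oplus> e = \<zero>" using two by fastforce
    then show False
      using nonplanar_of_four_zero_divisors[OF s.block_subgroup s.block_zero_divisors _ eZ en _ is_cring] assms n by simp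
  qed
qed

lemma block_card_ge:
  assumes "finite (carrier R)"
  shows "2 \<le> card (idempotent_block R e)"
proof -
  interpret J: additive_subgroup "idempotent_block R e" R by (rule block_subgroup)
  have "{\<zero>, e} \<subseteq> idempotent_block R e" using e_in_block J.zero_closed by simp
  moreover have "finite (idempotent_block R e)"
    by (rule finite_subset[OF J.a_subset assms])
  ultimately show ?thesis using card_mono[of "idempotent_block R e" "{\<zero>, e}"] nz(1) by (simp del: insert_subset)
qed

lemma carrier_eq: "carrier R = (\<lambda>(a, b). a \<oplus> b) ` (idempotent_block R e \<times> idempotent_block R f)" (is "_ = ?g ` ?B")
proof
  show "?g ` ?B \<subseteq> carrier R" by (auto simp: idempotent_block_def)
  show "carrier R \<subseteq> ?g ` ?B"
  proof
    fix z assume z: "z \<in> carrier R"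
    have "z = (e \<oplus> f) \<otimes> z" using z ef(3) by simp
    also have "\<dots> = ?g (e \<otimes> z, f \<otimes> z)" using z ef(1,2) by (simp add: l_distr)
    finally have "z = ?g (e \<otimes> z, f \<otimes> z)" .
    moreover have "(e \<otimes> z, f \<otimes> z) \<in> ?B" using z ef by (simp add: idempotent_block_def flip: m_assoc)
    ultimately show "z \<in> ?g ` ?B" by (rule image_eqI)
  qed
qed

lemma card_carrier: "card (carrier R) = card (idempotent_block R e) * card (idempotent_block R f)"
proof -
  interpret s: split_ring R f e by (rule swap)
  have "inj_on (\<lambda>(a, b). a \<oplus> b) (idempotent_block R e \<times> idempotent_block R f)"
  proof (rule inj_onI, clarify)
    fix a b c d assume abcd: "a \<in> idempotent_block R e" "b \<in> idempotent_block R f"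
      "c \<in> idempotent_block R e" "d \<in> idempotent_block R f" "a \<oplus> b = c \<oplus> d"
    then have car: "a \<in> carrier R" "b \<in> carrier R" "c \<in> carrier R" "d \<in> carrier R"
      by (simp_all add: idempotent_block_def)
    have proj: "e \<otimes> (x \<oplus> y) = x" "f \<otimes> (x \<oplus> y) = y"
      if "x \<in> idempotent_block R e" "y \<in> idempotent_block R f" "x \<in> carrier R" "y \<in> carrier R" for x y
      using that(3,4) ef(1,2) block_mult(1)[OF that(1)] block_mult(2)[OF that(2)]
        s.block_mult(1)[OF that(2)] s.block_mult(2)[OF that(1)] by (simp_all add: r_distr)
    show "a = c \<and> b = d"
      using proj[OF abcd(1,2) car(1,2)] proj[OF abcd(3,4) car(3,4)] unfolding abcd(5) by simp
  qed
  then show ?thesis by (subst carrier_eq) (simp add: card_image card_cartesian_product)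
qed

text \<open>Since \<open>e\<close> has additive order 2 and \<open>f\<close> has order 3, three
  times \<open>1\<close> is \<open>e\<close> and four times \<open>1\<close> is \<open>f\<close>; 3
  and 4 are the Chinese remainder idempotents modulo 6. So \<open>1\<close> spans both blocks
  additively.\<close>

lemma iso_Z6:
  assumes A: "card (idempotent_block R e) = 2" and B: "card (idempotent_block R f) = 3"
  shows "R \<simeq> residue_ring 6"
proof (rule residue_ring_iso[OF is_cring])
  interpret s: split_ring R f e by (rule swap)
  note A' = additive_subgroup_card_2[OF block_subgroup A e_in_block nz(1)]
  note B' = additive_subgroup_card_3[OF s.block_subgroup B s.e_in_block nz(2)]
  have two: "\<one> \<oplus> \<one> = f \<oplus> f"
  proof -
    have "(e \<oplus> f) \<oplus> (e \<oplus> f) = (e \<oplus> e) \<oplus> (f \<oplus> f)" using ef(1,2) by algebra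
    then show ?thesis using A'(2) ef by simp
  qed
  have three: "\<one> \<oplus> (\<one> \<oplus> \<one>) = e"
  proof -
    have "(e \<oplus> f) \<oplus> (f \<oplus> f) = e \<oplus> (f \<oplus> f \<oplus> f)" using ef(1,2) by algebra
    then show ?thesis using B'(3) ef two by simp
  qed
  have four: "\<one> \<oplus> (\<one> \<oplus> (\<one> \<oplus> \<one>)) = f"
  proof -
    have "(e \<oplus> f) \<oplus> e = (e \<oplus> e) \<oplus> f" using ef(1,2) by algebra
    then show ?thesis using A'(2) ef three by simp
  qed
  show "(1::int) < 6" by simp
  have "[(6::nat)] \<cdot> \<one> = (\<one> \<oplus> (\<one> \<oplus> \<one>)) \<oplus> (\<one> \<oplus> (\<one> \<oplus> \<one>))"
  proof -
    have "(6::nat) = Suc (Suc (Suc (Suc (Suc (Suc 0)))))" by simp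
    then show ?thesis by (simp only: add.nat_pow_Suc add.nat_pow_0) (simp add: a_assoc)
  qed
  then show "[nat 6] \<cdot> \<one> = \<zero>" unfolding three using A'(2) by simp
  show "card (carrier R) = nat 6" using card_carrier A B by simp
  fix D assume D: "\<zero> \<in> D" "\<one> \<in> D" "\<And>x y. x \<in> D \<Longrightarrow> y \<in> D \<Longrightarrow> x \<oplus> y \<in> D"
  have e: "e \<in> D" unfolding three[symmetric] by (intro D)
  have f: "f \<in> D" unfolding four[symmetric] by (intro D)
  show "carrier R \<subseteq> D"
  proof
    fix z assume "z \<in> carrier R"
    then obtain a b where ab: "a \<in> idempotent_block R e" "b \<in> idempotent_block R f" "z = a \<oplus> b"
      using carrier_eq by auto
    have "a \<in> D" using ab(1) D(1) e unfolding A'(1) by blast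
    moreover have "b \<in> D" using ab(2) D(1) f D(3)[OF f f] unfolding B'(1) by blast
    ultimately show "z \<in> D" unfolding ab(3) by (rule D)
  qed
qed

lemma iso_Z2_Z2:
  assumes A: "card (idempotent_block R e) = 2" and B: "card (idempotent_block R f) = 2"
  shows "R \<simeq> RDirProd (residue_ring 2) (residue_ring 2)"
proof -
  interpret s: split_ring R f e by (rule swap)
  interpret Z: residues 2 Z2 by unfold_locales simp
  note A' = additive_subgroup_card_2[OF block_subgroup A e_in_block nz(1)]
  note B' = additive_subgroup_card_2[OF s.block_subgroup B s.e_in_block nz(2)]
  let ?Q = "RDirProd Z2 Z2"
  \<comment> \<open>On pairs of residues this is \<open>i e + j f\<close>. With four elements, the
    homomorphism laws reduce to a finite table.\<close>
  define h where "h = (\<lambda>(i::int, j::int). (if i = 0 then \<zero> else e) \<oplus> (if j = 0 then \<zero> else f))"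
  have Q: "ring ?Q" using RDirProd_ring[OF Z.ring_axioms Z.ring_axioms] .
  have car: "carrier ?Q = {0, 1} \<times> {0, 1}" by (auto simp: RDirProd_carrier Z.res_carrier_eq)
  have ops: "(i, j) \<otimes>\<^bsub>?Q\<^esub> (k, l) = ((i * k) mod 2, (j * l) mod 2)" "(i, j) \<oplus>\<^bsub>?Q\<^esub> (k, l) = ((i + k) mod 2, (j + l) mod 2)"
    "\<one>\<^bsub>?Q\<^esub> = (1, 1)" for i j k l :: int
    by (simp_all add: RDirProd_def DirProd_def monoid.defs Z.res_mult_eq Z.res_add_eq Z.res_one_eq)
  have ee: "e \<oplus> e = \<zero>" and ff: "f \<oplus> f = \<zero>" using A' B' by auto
  have fe: "f \<oplus> e = \<one>" using ef by (simp add: a_comm)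
  have e1: "e \<oplus> \<one> = f" and f1: "f \<oplus> \<one> = e"
  proof -
    have "e \<oplus> (e \<oplus> f) = (e \<oplus> e) \<oplus> f" "f \<oplus> (e \<oplus> f) = (f \<oplus> f) \<oplus> e"
      using ef(1,2) by algebra+
    then show "e \<oplus> \<one> = f" "f \<oplus> \<one> = e" unfolding ee ff ef(3) using ef(1,2) by simp_all
  qed
  have 1: "\<one> \<oplus> e = f" "\<one> \<oplus> f = e" using e1 f1 a_comm[OF one_closed] ef(1,2) by metis+
  have "(e \<oplus> f) \<oplus> \<one> = e \<oplus> (f \<oplus> \<one>)" using ef(1,2) by (simp add: a_assoc)
  then have 11: "\<one> \<oplus> \<one> = \<zero>" unfolding ef(3) f1 ee .
  note efs = ee ff fe e1 f1 1 11
  have hv: "h (0, 0) = \<zero>" "h (1, 0) = e" "h (0, 1) = f" "h (1, 1) = \<one>" using ef by (simp_all add: h_def)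
  have hom: "h \<in> ring_hom ?Q R"
  proof (rule ring_hom_memI)
    show "h x \<in> carrier R" if "x \<in> carrier ?Q" for x
      using that unfolding car by (elim SigmaE insertE emptyE; simp add: hv ef)
    fix x y assume xy: "x \<in> carrier ?Q" "y \<in> carrier ?Q"
    show "h (x \<otimes>\<^bsub>?Q\<^esub> y) = h x \<otimes> h y"
      using xy unfolding car by (elim SigmaE insertE emptyE; simp add: ops hv ef)
    show "h (x \<oplus>\<^bsub>?Q\<^esub> y) = h x \<oplus> h y"
      using xy unfolding car by (elim SigmaE insertE emptyE; simp add: ops hv ef efs)
  qed (simp add: ops hv)
  show ?thesis
  proof (rule ring_iso_of_surj[OF Q ring_axioms hom])
    show "finite (carrier ?Q)" "card (carrier ?Q) \<le> card (carrier R)"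
      using card_carrier A B by (simp_all add: car card_cartesian_product)
    have "carrier ?Q = {(0, 0), (0, 1), (1, 0), (1, 1)}" unfolding car by auto
    then have "{\<zero>, e, f, e \<oplus> f} \<subseteq> h ` carrier ?Q" by (simp add: hv ef)
    moreover have "carrier R \<subseteq> {\<zero>, e, f, e \<oplus> f}"
      using ef(1,2) by (subst carrier_eq) (auto simp: A'(1) B'(1))
    ultimately show "carrier R \<subseteq> h ` carrier ?Q" by blast
  qed
qed

text \<open>The idempotent of a block of order 3 has a nonzero double, which restricts the other
  block to order 2. This excludes 3 by 3.\<close>

lemma planar_classification:
  assumes "finite (carrier R)" "planar_total_graph R"
  shows "R \<simeq> RDirProd (residue_ring 2) (residue_ring 2) \<or> R \<simeq> residue_ring 6"
proof -
  interpret s: split_ring R f e by (rule swap)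
  have ge: "2 \<le> card (idempotent_block R e)" "2 \<le> card (idempotent_block R f)"
    using block_card_ge s.block_card_ge assms(1) by auto
  have le: "card (idempotent_block R e) \<le> 3" "card (idempotent_block R f) \<le> 3"
    using block_card_le s.block_card_le assms(2) by auto
  consider "card (idempotent_block R e) = 2" "card (idempotent_block R f) = 2"
    | "card (idempotent_block R e) = 2" "card (idempotent_block R f) = 3"
    | "card (idempotent_block R e) = 3"
    using ge le by linarith
  then show ?thesis
  proof cases
    case 3
    have "e \<oplus> e \<noteq> \<zero>" using additive_subgroup_card_3(2)[OF block_subgroup 3 e_in_block nz(1)] .
    then have "card (idempotent_block R f) = 2" using block_card_le(2)[OF assms(2)] ge by simp
    then show ?thesis using s.iso_Z6 3 by simp
  qed (use iso_Z6 iso_Z2_Z2 in simp_all)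
qed

end

lemma (in cring) nonlocal_planar_classification:
  assumes "finite (carrier R)" "\<one> \<noteq> \<zero>" "\<not> local_ring R" "planar_total_graph R"
  shows "R \<simeq> RDirProd (residue_ring 2) (residue_ring 2) \<or> R \<simeq> residue_ring 6"
proof -
  obtain e where e: "e \<in> carrier R" "e \<otimes> e = e" "e \<noteq> \<zero>" "e \<noteq> \<one>"
    by (rule nonlocal_idempotent[OF assms(1-3)])
  define f where "f = \<one> \<ominus> e"
  have f: "f \<in> carrier R" using e(1) by (simp add: f_def)
  have sum: "e \<oplus> f = \<one>" unfolding f_def using e(1) by algebra
  have ef: "e \<otimes> f = \<zero>"
    unfolding f_def a_minus_def using e(1,2) by (simp add: r_distr r_minus r_neg)
  have fe: "f \<otimes> e = \<zero>" using ef e(1) f by (simp add: m_comm)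
  have "f = f \<otimes> (e \<oplus> f)" using sum f by simp
  then have ff: "f \<otimes> f = f" using fe e(1) f by (simp add: r_distr)
  have nz: "f \<noteq> \<zero>" using e(1,4) by (simp add: f_def)
  interpret split_ring R e f
    by (unfold_locales; fact e f sum ef fe ff nz)
  show ?thesis using planar_classification[OF assms(1,4)] .
qed

section \<open>Local rings\<close>

text \<open>Lagrange's theorem with representatives: \<open>K\<close> meets every coset of
  \<open>M\<close> exactly once. The residue field is handled through such representatives in
  \<open>R\<close>.\<close>

lemma (in ring) card_transversal:
  assumes M: "additive_subgroup M R" and K: "K \<subseteq> carrier R" "\<forall>k\<in>K. \<forall>l\<in>K. k \<ominus> l \<in> M \<longrightarrow> k = l"
    "\<forall>r\<in>carrier R. \<exists>k\<in>K. r \<ominus> k \<in> M"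
  shows "\<And>r. r \<in> carrier R \<Longrightarrow> \<exists>k\<in>K. \<exists>m\<in>M. r = k \<oplus> m" "card (carrier R) = card K * card M"
proof -
  interpret M: additive_subgroup M R by fact
  show rep: "\<exists>k\<in>K. \<exists>m\<in>M. r = k \<oplus> m" if r: "r \<in> carrier R" for r
  proof -
    from K(3)[rule_format, OF r] obtain k where k: "k \<in> K" "r \<ominus> k \<in> M" ..
    then have "k \<in> carrier R" using K(1) by blast
    then have "r = k \<oplus> (r \<ominus> k)" using r by algebra
    then show ?thesis using k by blast
  qed
  have eq: "carrier R = (\<lambda>(k, m). k \<oplus> m) ` (K \<times> M)" (is "_ = ?g ` _")
  proof
    show "?g ` (K \<times> M) \<subseteq> carrier R" using K(1) M.a_subset by auto
    show "carrier R \<subseteq> ?g ` (K \<times> M)"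
    proof
      fix r assume "r \<in> carrier R"
      from rep[OF this] obtain k m where "k \<in> K" "m \<in> M" "r = ?g (k, m)" by auto
      then show "r \<in> ?g ` (K \<times> M)" by blast
    qed
  qed
  have "inj_on ?g (K \<times> M)"
  proof (rule inj_onI, clarify)
    fix k m l n assume a: "k \<in> K" "m \<in> M" "l \<in> K" "n \<in> M" "k \<oplus> m = l \<oplus> n"
    have c: "k \<in> carrier R" "l \<in> carrier R" "m \<in> carrier R" "n \<in> carrier R"
      using a K(1) M.a_subset by auto
    have "k \<ominus> l = (k \<oplus> m) \<ominus> m \<ominus> l" using c by algebra
    also have "\<dots> = n \<ominus> m" unfolding a(5) using c by algebra
    finally have "k \<ominus> l \<in> M" using a(2,4) M.a_closed M.a_inv_closed by (simp add: a_minus_def)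
    then have "k = l" using K(2) a by blast
    then show "k = l \<and> m = n" using a(5) c by simp
  qed
  then show "card (carrier R) = card K * card M"
    by (subst eq) (simp add: card_image card_cartesian_product)
qed

locale finite_local = cring R for R (structure) +
  fixes M
  assumes fin: "finite (carrier R)" and maximal: "maximalideal M R" and M_eq: "M = carrier R - Units R"
begin

sublocale M: maximalideal M R by (rule maximal)

lemma finite_M: "finite M"
  using fin by (simp add: M_eq)

lemma M_zero_divisors: "M \<subseteq> zero_divisors R"
  using nonunit_zero_divisor[OF fin] by (auto simp: M_eq)

lemma one_notin: "\<one> \<notin> M"
  by (simp add: M_eq)

lemma cancel:
  assumes "x \<in> carrier R" "x \<notin> M" "z \<in> carrier R" "x \<otimes> z = \<zero>"
  shows "z = \<zero>"
proof -
  have u: "x \<in> Units R" using assms by (simp add: M_eq)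
  have "inv x \<otimes> (x \<otimes> z) = z" using u assms(1,3) by (simp flip: m_assoc)
  then show ?thesis using assms(4) u by simp
qed

lemma mult_notin: "x \<in> carrier R \<Longrightarrow> y \<in> carrier R \<Longrightarrow> x \<notin> M \<Longrightarrow> y \<notin> M \<Longrightarrow> x \<otimes> y \<notin> M"
  by (simp add: M_eq)

lemma minus_closed_M: "x \<in> M \<Longrightarrow> y \<in> M \<Longrightarrow> x \<ominus> y \<in> M"
  using M.a_closed M.a_inv_closed by (simp add: a_minus_def)

lemma minus_one_notin:
  assumes "m \<in> M"
  shows "m \<ominus> \<one> \<notin> M"
proof
  assume "m \<ominus> \<one> \<in> M"
  then have "m \<ominus> (m \<ominus> \<one>) \<in> M" by (rule minus_closed_M[OF assms])
  moreover have "m \<ominus> (m \<ominus> \<one>) = \<one>" using M.Icarr[OF assms] by algebra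
  ultimately show False using one_notin by simp
qed

text \<open>Choose \<open>s\<close> with the smallest principal ideal among the nonzero elements of
  \<open>M\<close>. If \<open>m s\<close> were nonzero, it would generate the same ideal, so
  \<open>s = r m s\<close> for some \<open>r\<close>, and the unit \<open>r m - 1\<close> would kill
  \<open>s\<close>.\<close>

lemma socle_exists:
  assumes "M \<noteq> {\<zero>}"
  obtains s where "s \<in> M" "s \<noteq> \<zero>" "\<forall>m\<in>M. m \<otimes> s = \<zero>"
proof -
  obtain x where "x \<in> M \<and> x \<noteq> \<zero>" using assms M.zero_closed by blast
  from ex_has_least_nat[of "\<lambda>x. x \<in> M \<and> x \<noteq> \<zero>", OF this, of "\<lambda>x. card (PIdl x)"]
  obtain s where s: "s \<in> M \<and> s \<noteq> \<zero>"
    and min: "\<forall>y. y \<in> M \<and> y \<noteq> \<zero> \<longrightarrow> card (PIdl s) \<le> card (PIdl y)"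
    by (elim exE conjE) blast
  have sc: "s \<in> carrier R" using s M.Icarr by blast
  have "m \<otimes> s = \<zero>" if m: "m \<in> M" for m
  proof (rule ccontr)
    assume ms: "m \<otimes> s \<noteq> \<zero>"
    have mc: "m \<in> carrier R" using m M.Icarr by blast
    have sub: "PIdl (m \<otimes> s) \<subseteq> PIdl s"
    proof
      fix x assume "x \<in> PIdl (m \<otimes> s)"
      then obtain r where r: "r \<in> carrier R" "x = r \<otimes> (m \<otimes> s)" unfolding cgenideal_def by blast
      then have "x = (r \<otimes> m) \<otimes> s" using mc sc by (simp add: m_assoc)
      then show "x \<in> PIdl s" unfolding cgenideal_def using r(1) mc by blast
    qed
    have finP: "finite (PIdl s)" using fin ideal.Icarr[OF cgenideal_ideal[OF sc]] by (meson finite_subset subsetI)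
    have "m \<otimes> s \<in> M" using M.I_l_closed s mc by simp
    then have "card (PIdl s) \<le> card (PIdl (m \<otimes> s))" using min[rule_format, of "m \<otimes> s"] ms by simp
    then have "PIdl (m \<otimes> s) = PIdl s" using card_seteq[OF finP sub] by simp
    then have "s \<in> PIdl (m \<otimes> s)" using cgenideal_self[OF sc] by simp
    then obtain r where r: "r \<in> carrier R" "s = r \<otimes> (m \<otimes> s)" unfolding cgenideal_def by blast
    have "(r \<otimes> m \<ominus> \<one>) \<otimes> s = r \<otimes> (m \<otimes> s) \<ominus> s"
      using r(1) mc sc by algebra
    also have "\<dots> = \<zero>" using r(2)[symmetric] sc by (simp add: a_minus_def r_neg)
    finally show False
      using cancel[OF _ minus_one_notin[OF M.I_l_closed[OF m r(1)]] sc] s r(1) mc by simp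
  qed
  then show ?thesis using that s by blast
qed

end

section \<open>The residue field acting on a socle element\<close>

locale finite_local_socle = finite_local +
  fixes s
  assumes s: "s \<in> M" "s \<noteq> \<zero>" "\<And>m. m \<in> M \<Longrightarrow> m \<otimes> s = \<zero>"
begin

lemma sc: "s \<in> carrier R"
  using s M.Icarr by blast

lemma mult_s_eq_zero_iff: "r \<in> carrier R \<Longrightarrow> r \<otimes> s = \<zero> \<longleftrightarrow> r \<in> M"
  using s cancel[OF _ _ sc] by blast

text \<open>Multiplication by \<open>s\<close> has kernel \<open>M\<close>, so \<open>R s\<close> is
  a copy of the residue field inside \<open>M\<close>. Residues are compared through their multiples
  of \<open>s\<close>.\<close>

lemma mult_s_eq_iff:
  assumes "r \<in> carrier R" "q \<in> carrier R"
  shows "r \<otimes> s = q \<otimes> s \<longleftrightarrow> r \<ominus> q \<in> M"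
proof -
  have "(r \<ominus> q) \<otimes> s = r \<otimes> s \<ominus> q \<otimes> s" using assms sc by algebra
  then show ?thesis using mult_s_eq_zero_iff[of "r \<ominus> q"] assms sc by simp
qed

lemma mult_s_in_M: "r \<in> carrier R \<Longrightarrow> r \<otimes> s \<in> M"
  using M.I_l_closed s by blast

lemma ss: "s \<otimes> s = \<zero>"
  using s by blast

lemma double_s: "\<one> \<oplus> \<one> \<in> M \<Longrightarrow> s \<oplus> s = \<zero>"
  using s(3)[of "\<one> \<oplus> \<one>"] sc by (simp add: l_distr)

text \<open>If \<open>M\<close> has two elements, then \<open>s + s = 0\<close>, so
  \<open>1 + 1\<close> kills \<open>s\<close> and is no unit. Otherwise \<open>M\<close> has at
  least three, and K3,3 arises from the cosets of \<open>1\<close> and \<open>-1\<close>. The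
  disjunction serves \<open>classify_2\<close>, which knows only the order of
  \<open>M\<close>.\<close>

lemma two_in_M:
  assumes "planar_total_graph R \<or> card M = 2"
  shows "\<one> \<oplus> \<one> \<in> M"
proof (rule ccontr)
  assume two: "\<one> \<oplus> \<one> \<notin> M"
  show False
  proof (cases "card M = 2")
    case True
    note J = additive_subgroup_card_2[OF M.is_additive_subgroup True s(1,2)]
    have "(\<one> \<oplus> \<one>) \<otimes> s = \<zero>" using J(2) sc by (simp add: l_distr)
    then show False using cancel[OF _ two sc] s by simp
  next
    case False
    have "card {\<zero>, s} \<le> card M" using s finite_M by (intro card_mono) auto
    then have "3 \<le> card M" using s False by simp
    then show False
      using nonplanar_of_three_zero_divisors[OF M.is_additive_subgroup M_zero_divisors _ one_closed two is_cring] assms False by simp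
  qed
qed

text \<open>If every unit fixes \<open>s\<close>, then \<open>R s\<close> is just \<open>0\<close>
  and \<open>s\<close>, so \<open>0\<close> and \<open>1\<close> represent the whole residue
  field.\<close>

lemma residue_field_2:
  assumes q: "\<forall>r\<in>carrier R - M. r \<otimes> s = s"
  shows "\<And>r. r \<in> carrier R \<Longrightarrow> \<exists>k\<in>{\<zero>, \<one>}. \<exists>m\<in>M. r = k \<oplus> m" "card (carrier R) = 2 * card M"
proof -
  have z: "\<zero> \<in> M" by (rule M.zero_closed)
  have "\<ominus> \<one> \<notin> M" using M.a_inv_closed[of "\<ominus> \<one>"] one_notin by auto
  moreover have "\<one> \<ominus> \<zero> = \<one>" "\<zero> \<ominus> \<one> = \<ominus> \<one>"
    by (simp_all add: a_minus_def)
  ultimately have n: "\<one> \<ominus> \<zero> \<notin> M" "\<zero> \<ominus> \<one> \<notin> M"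
    using one_notin by simp_all
  have K: "\<forall>k\<in>{\<zero>, \<one>}. \<forall>l\<in>{\<zero>, \<one>}. k \<ominus> l \<in> M \<longrightarrow> k = l"
    using n by blast
  have r: "\<forall>r\<in>carrier R. \<exists>k\<in>{\<zero>, \<one>}. r \<ominus> k \<in> M"
  proof
    fix r assume r: "r \<in> carrier R"
    show "\<exists>k\<in>{\<zero>, \<one>}. r \<ominus> k \<in> M"
    proof (cases "r \<in> M")
      case True
      then have "r \<ominus> \<zero> \<in> M" using r by (simp add: a_minus_def)
      then show ?thesis by blast
    next
      case False
      then have "r \<otimes> s = \<one> \<otimes> s" using q r sc by simp
      then have "r \<ominus> \<one> \<in> M" using mult_s_eq_iff[OF r one_closed] by blast
      then show ?thesis by blast
    qed
  qed
  have K2: "card {\<zero>, \<one>} = 2" using one_notin z by (metis card_2_iff)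
  note T = card_transversal[OF M.is_additive_subgroup _ K r]
  show "\<exists>k\<in>{\<zero>, \<one>}. \<exists>m\<in>M. r = k \<oplus> m" if "r \<in> carrier R" for r
    by (rule T(1)[OF _ that]) simp
  show "card (carrier R) = 2 * card M" using T(2) K2 by simp
qed

text \<open>\<open>R\<close> is additively spanned by \<open>1\<close> and \<open>s\<close> with
  \<open>s^2 = 0\<close>, so it depends only on whether \<open>1 + 1\<close> is \<open>0\<close> or
  \<open>s\<close>.\<close>

lemma classify_2:
  assumes M2: "card M = 2"
  shows "R \<simeq> residue_ring 4 \<or> R \<simeq> Z2X_X2"
proof -
  note J = additive_subgroup_card_2[OF M.is_additive_subgroup M2 s(1,2)]
  have q: "\<forall>r\<in>carrier R - M. r \<otimes> s = s"
  proof
    fix r assume r: "r \<in> carrier R - M"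
    have "r \<otimes> s \<in> {\<zero>, s}" using mult_s_in_M[of r] r J(1) by blast
    moreover have "r \<otimes> s \<noteq> \<zero>" using mult_s_eq_zero_iff[of r] r by blast
    ultimately show "r \<otimes> s = s" by blast
  qed
  note R = residue_field_2[OF q, unfolded M2]
  have spanned: "carrier R \<subseteq> D" if D: "\<zero> \<in> D" "\<one> \<in> D" "s \<in> D" "\<forall>x\<in>D. \<forall>y\<in>D. x \<oplus> y \<in> D" for D
  proof
    fix z assume "z \<in> carrier R"
    from R(1)[OF this, unfolded J(1)] obtain k m where km: "k \<in> {\<zero>, \<one>}" "m \<in> {\<zero>, s}" "z = k \<oplus> m"
      by (elim bexE)
    have "k \<in> D" "m \<in> D" using km(1,2) D(1-3) by blast+
    then show "z \<in> D" unfolding km(3) by (rule D(4)[rule_format])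
  qed
  have two: "\<one> \<oplus> \<one> \<in> {\<zero>, s}" using two_in_M M2 J(1) by blast
  show ?thesis
  proof (cases "\<one> \<oplus> \<one> = \<zero>")
    case True
    have "ring_generated R {s}"
    proof (rule ring_generatedI)
      fix S assume S: "\<zero> \<in> S" "\<one> \<in> S" "\<And>x y. x \<in> S \<Longrightarrow> y \<in> S \<Longrightarrow> x \<oplus> y \<in> S" "\<And>g x. g \<in> {s} \<Longrightarrow> x \<in> S \<Longrightarrow> g \<otimes> x \<in> S"
      have "s \<in> S" using S(4)[of s \<one>] S(2) sc by simp
      moreover have "\<forall>x\<in>S. \<forall>y\<in>S. x \<oplus> y \<in> S" by (intro ballI S(3))
      ultimately show "carrier R \<subseteq> S" by (rule spanned[OF S(1,2)])
    qed
    then show ?thesis using iso_Z2X_X2[OF is_cring _ sc _ True ss] R(2) by simp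
  next
    case False
    then have two: "\<one> \<oplus> \<one> = s" using two by blast
    have "R \<simeq> residue_ring 4"
    proof (rule residue_ring_iso[OF is_cring])
      show "[nat 4] \<cdot> \<one> = \<zero>" using add_pow_four two J(2) by simp
      show "card (carrier R) = nat 4" using R(2) by simp
      fix D assume D: "\<zero> \<in> D" "\<one> \<in> D" "\<And>x y. x \<in> D \<Longrightarrow> y \<in> D \<Longrightarrow> x \<oplus> y \<in> D"
      have "s \<in> D" unfolding two[symmetric] by (intro D)
      moreover have "\<forall>x\<in>D. \<forall>y\<in>D. x \<oplus> y \<in> D" by (intro ballI D(3))
      ultimately show "carrier R \<subseteq> D" by (rule spanned[OF D(1,2)])
    qed simp
    then show ?thesis by blast
  qed
qed

text \<open>As \<open>1 + 1\<close> kills \<open>s\<close>, the element \<open>s\<close> has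
  additive order two, which does not occur in a group of order three.\<close>

lemma card_M_not_3:
  assumes "\<one> \<oplus> \<one> \<in> M"
  shows "card M \<noteq> 3"
  using additive_subgroup_card_3(2)[OF M.is_additive_subgroup _ s(1,2)] double_s[OF assms] by blast

lemma M_eq_4:
  assumes M4: "card M = 4" and two: "\<one> \<oplus> \<one> \<in> M" and t: "t \<in> M" "t \<noteq> \<zero>" "t \<noteq> s"
  shows "M = {\<zero>, s, t, t \<oplus> s}"
proof -
  have tc: "t \<in> carrier R" using t M.Icarr by blast
  have "t \<oplus> s \<noteq> \<zero>"
  proof
    assume "t \<oplus> s = \<zero>"
    then have "t \<oplus> s = s \<oplus> s" using double_s[OF two] by simp
    then show False using t tc sc by simp
  qed
  then have "card {\<zero>, s, t, t \<oplus> s} = 4" using t s tc sc by auto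
  moreover have "{\<zero>, s, t, t \<oplus> s} \<subseteq> M" using t s M.zero_closed by (auto intro: M.a_closed)
  ultimately show ?thesis using card_subset_eq[OF finite_M] M4 by metis
qed

text \<open>\<open>R\<close> is additively spanned by \<open>1\<close>, \<open>t\<close> and
  \<open>s\<close>, so it is determined by \<open>1 + 1\<close> and \<open>t^2\<close>. When
  \<open>1 + 1\<close> is neither \<open>0\<close> nor \<open>s\<close>, it is itself taken as
  \<open>t\<close>; and \<open>t^2\<close> is always \<open>0\<close> or \<open>s\<close>. Of the
  six resulting cases two lead to \<open>Z4X_2X_X2\<close>.\<close>

lemma classify_8:
  assumes M4: "card M = 4" and two: "\<one> \<oplus> \<one> \<in> M"
    and q: "\<forall>r\<in>carrier R - M. r \<otimes> s = s"
  shows "R \<simeq> Z2X_X3 \<or> R \<simeq> Z2XY_XY2 \<or> R \<simeq> Z4X_2X_X2 \<or> R \<simeq> Z4X_2X_X2m2 \<or> R \<simeq> residue_ring 8"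
proof -
  note R = residue_field_2[OF q, unfolded M4]
  obtain t where t: "t \<in> M" "t \<noteq> \<zero>" "t \<noteq> s" and two_cases: "\<one> \<oplus> \<one> \<in> {\<zero>, s, t}"
  proof (cases "\<one> \<oplus> \<one> \<in> {\<zero>, s}")
    case True
    have "\<not> M \<subseteq> {\<zero>, s}" using card_mono[of "{\<zero>, s}" M] M4 s by auto
    then show ?thesis using that True by blast
  next
    case False
    then show ?thesis using that[of "\<one> \<oplus> \<one>"] two by blast
  qed
  note M = M_eq_4[OF M4 two t]
  have tc: "t \<in> carrier R" using t M.Icarr by blast
  have ts: "t \<otimes> s = \<zero>" using s(3) t by blast
  have ssum: "s \<oplus> s = \<zero>" using double_s[OF two] .
  have tt: "t \<otimes> t \<in> {\<zero>, s}"
  proof -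
    have u: "t \<ominus> \<one> \<in> carrier R" "t \<ominus> \<one> \<notin> M"
      using tc minus_one_notin[OF t(1)] by auto
    have "t \<otimes> t \<noteq> t"
    proof
      assume "t \<otimes> t = t"
      moreover have "(t \<ominus> \<one>) \<otimes> t = t \<otimes> t \<ominus> t" using tc by algebra
      ultimately have "(t \<ominus> \<one>) \<otimes> t = \<zero>" using tc by (simp add: a_minus_def r_neg)
      then show False using cancel[OF u tc] t by simp
    qed
    moreover have "t \<otimes> t \<noteq> t \<oplus> s"
    proof
      assume e: "t \<otimes> t = t \<oplus> s"
      \<comment> \<open>The product is chosen so that \<open>t^2 = t + s\<close> and
        \<open>t s = 0\<close> reduce it to \<open>s + s\<close>, which is zero. As
        \<open>t - 1\<close> is a unit, \<open>t = s\<close> would follow.\<close>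
      have "(t \<ominus> \<one>) \<otimes> (t \<ominus> s) = t \<otimes> t \<ominus> t \<otimes> s \<ominus> t \<oplus> s"
        using tc sc by algebra
      also have "\<dots> = s \<oplus> s" unfolding e ts using tc sc by algebra
      finally have "(t \<ominus> \<one>) \<otimes> (t \<ominus> s) = \<zero>" using ssum by simp
      then have "t \<ominus> s = \<zero>" using cancel[OF u] tc sc by simp
      then show False using t tc sc by simp
    qed
    moreover have "t \<otimes> t \<in> M" using M.I_l_closed t tc by blast
    ultimately show ?thesis using M by blast
  qed
  have spanned: "carrier R \<subseteq> D"
    if D: "\<zero> \<in> D" "\<one> \<in> D" "s \<in> D" "t \<in> D" "\<forall>x\<in>D. \<forall>y\<in>D. x \<oplus> y \<in> D" for D
  proof
    fix z assume "z \<in> carrier R"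
    from R(1)[OF this, unfolded M] obtain k m where km: "k \<in> {\<zero>, \<one>}" "m \<in> {\<zero>, s, t, t \<oplus> s}" "z = k \<oplus> m"
      by (elim bexE)
    have "k \<in> D" "m \<in> D" using km(1,2) D(1-4) D(5)[rule_format, OF D(4,3)] by blast+
    then show "z \<in> D" unfolding km(3) by (rule D(5)[rule_format])
  qed
  have gen: "ring_generated R G"
    if G: "\<And>S. \<lbrakk>\<one> \<in> S; \<forall>x\<in>S. \<forall>y\<in>S. x \<oplus> y \<in> S; \<forall>g\<in>G. \<forall>x\<in>S. g \<otimes> x \<in> S\<rbrakk> \<Longrightarrow> s \<in> S \<and> t \<in> S" for G
  proof (rule ring_generatedI)
    fix S assume S: "\<zero> \<in> S" "\<one> \<in> S" "\<And>x y. x \<in> S \<Longrightarrow> y \<in> S \<Longrightarrow> x \<oplus> y \<in> S" "\<And>g x. g \<in> G \<Longrightarrow> x \<in> S \<Longrightarrow> g \<otimes> x \<in> S"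
    have add: "\<forall>x\<in>S. \<forall>y\<in>S. x \<oplus> y \<in> S" by (intro ballI S(3))
    have "\<forall>g\<in>G. \<forall>x\<in>S. g \<otimes> x \<in> S" by (intro ballI S(4))
    from G[OF S(2) add this] show "carrier R \<subseteq> S" using spanned[OF S(1,2) _ _ add] by (elim conjE)
  qed
  have card8: "card (carrier R) = 8" using R(2) by simp
  have t2: "(\<one> \<oplus> \<one>) \<otimes> t = t \<oplus> t" using tc by (simp add: l_distr)
  consider "\<one> \<oplus> \<one> = \<zero>" "t \<otimes> t = \<zero>" | "\<one> \<oplus> \<one> = \<zero>" "t \<otimes> t = s" | "\<one> \<oplus> \<one> = s" "t \<otimes> t = \<zero>"
    | "\<one> \<oplus> \<one> = s" "t \<otimes> t = s" | "\<one> \<oplus> \<one> = t" "t \<otimes> t = \<zero>" | "\<one> \<oplus> \<one> = t" "t \<otimes> t = s"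
    using two_cases tt by blast
  then show ?thesis
  proof cases
    case 1
    have "ring_generated R {s, t}"
    proof (rule gen)
      fix S assume S: "\<one> \<in> S" and add: "\<forall>x\<in>S. \<forall>y\<in>S. x \<oplus> y \<in> S" and mul: "\<forall>g\<in>{s, t}. \<forall>x\<in>S. g \<otimes> x \<in> S"
      show "s \<in> S \<and> t \<in> S"
        using mul[rule_format, of s \<one>] mul[rule_format, of t \<one>] S sc tc by simp
    qed
    moreover have "s \<otimes> t = \<zero>" using ts sc tc by (simp add: m_comm)
    ultimately have "R \<simeq> Z2XY_XY2" using iso_Z2XY_XY2[OF is_cring card8 sc tc _ 1(1) ss _ 1(2)] by blast
    then show ?thesis by blast
  next
    case 2
    have "ring_generated R {t}"
    proof (rule gen)
      fix S assume S: "\<one> \<in> S" and add: "\<forall>x\<in>S. \<forall>y\<in>S. x \<oplus> y \<in> S" and mul: "\<forall>g\<in>{t}. \<forall>x\<in>S. g \<otimes> x \<in> S"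
      have "t \<in> S" using mul[rule_format, of t \<one>] S tc by simp
      then show "s \<in> S \<and> t \<in> S" using mul[rule_format, of t t] 2 by simp
    qed
    then have "R \<simeq> Z2X_X3" using iso_Z2X_X3[OF is_cring card8 tc _ 2(1)] 2(2) ts by simp
    then show ?thesis by blast
  next
    case 3
    have "ring_generated R {t}"
    proof (rule gen)
      fix S assume S: "\<one> \<in> S" and add: "\<forall>x\<in>S. \<forall>y\<in>S. x \<oplus> y \<in> S" and mul: "\<forall>g\<in>{t}. \<forall>x\<in>S. g \<otimes> x \<in> S"
      show "s \<in> S \<and> t \<in> S" using mul[rule_format, of t "\<one>"] S add[rule_format, OF S S] tc 3 by simp
    qed
    moreover have "s \<otimes> t = \<zero>" using ts sc tc by (simp add: m_comm)
    ultimately have "R \<simeq> Z4X_2X_X2" using iso_Z4X_2X_X2[OF is_cring card8 tc] 3 ssum by simp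
    then show ?thesis by blast
  next
    case 4
    have "ring_generated R {t}"
    proof (rule gen)
      fix S assume S: "\<one> \<in> S" and add: "\<forall>x\<in>S. \<forall>y\<in>S. x \<oplus> y \<in> S" and mul: "\<forall>g\<in>{t}. \<forall>x\<in>S. g \<otimes> x \<in> S"
      show "s \<in> S \<and> t \<in> S" using mul[rule_format, of t "\<one>"] S add[rule_format, OF S S] tc 4 by simp
    qed
    moreover have "s \<otimes> t = \<zero>" using ts sc tc by (simp add: m_comm)
    ultimately have "R \<simeq> Z4X_2X_X2m2" using iso_Z4X_2X_X2m2[OF is_cring card8 tc] 4 ssum by simp
    then show ?thesis by blast
  next
    case 5
    \<comment> \<open>Here \<open>t\<close> is \<open>2\<close> itself, and the socle element
      \<open>s\<close> plays the part of \<open>X\<close>: both \<open>2 s\<close> and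
      \<open>s^2\<close> vanish.\<close>
    have "ring_generated R {s}"
    proof (rule gen)
      fix S assume S: "\<one> \<in> S" and add: "\<forall>x\<in>S. \<forall>y\<in>S. x \<oplus> y \<in> S" and mul: "\<forall>g\<in>{s}. \<forall>x\<in>S. g \<otimes> x \<in> S"
      show "s \<in> S \<and> t \<in> S" using mul[rule_format, of s "\<one>"] S add[rule_format, OF S S] sc 5 by simp
    qed
    moreover have "t \<oplus> t = \<zero>" using t2 5 by simp
    ultimately have "R \<simeq> Z4X_2X_X2" using iso_Z4X_2X_X2[OF is_cring card8 sc] 5 ts ss by simp
    then show ?thesis by blast
  next
    case 6
    \<comment> \<open>In this case \<open>t = 2\<close>, so \<open>4 = t^2 = s\<close> and
      \<open>8 = s + s = 0\<close>.\<close>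
    have tsum: "t \<oplus> t = s" using t2 6 by simp
    have "R \<simeq> residue_ring 8"
    proof (rule residue_ring_iso[OF is_cring])
      have "[(8::nat)] \<cdot> \<one> = [(4::nat)] \<cdot> \<one> \<oplus> [(4::nat)] \<cdot> \<one>"
        by (simp add: add.nat_pow_mult)
      then show "[nat 8] \<cdot> \<one> = \<zero>" unfolding add_pow_four 6(1) tsum using ssum by simp
      show "card (carrier R) = nat 8" using card8 by simp
      fix D assume D: "\<zero> \<in> D" "\<one> \<in> D" "\<And>x y. x \<in> D \<Longrightarrow> y \<in> D \<Longrightarrow> x \<oplus> y \<in> D"
      have tD: "t \<in> D" unfolding 6(1)[symmetric] by (intro D)
      have "s \<in> D" unfolding tsum[symmetric] by (intro D tD)
      moreover have "\<forall>x\<in>D. \<forall>y\<in>D. x \<oplus> y \<in> D" by (intro ballI D(3))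
      ultimately show "carrier R \<subseteq> D" by (rule spanned[OF D(1,2) _ tD])
    qed simp
    then show ?thesis by blast
  qed
qed

text \<open>The multiple \<open>u s\<close> differs from \<open>0\<close> and \<open>s\<close>, so
  the multiples of \<open>s\<close> by \<open>0\<close>, \<open>1\<close>, \<open>u\<close> and
  \<open>u + 1\<close> exhaust the four elements of \<open>M\<close>. Hence \<open>M = R s\<close>,
  which has square zero since \<open>M\<close> kills \<open>s\<close>; and these four multipliers
  represent the residue field, where \<open>u\<close> is a root of
  \<open>X^2 + X + 1\<close>.\<close>

lemma residue_field_4:
  assumes M4: "card M = 4" and two: "\<one> \<oplus> \<one> \<in> M" and u: "u \<in> carrier R" "u \<otimes> s \<noteq> \<zero>" "u \<otimes> s \<noteq> s"
  shows "M = {\<zero>, s, u \<otimes> s, u \<otimes> s \<oplus> s}" "\<And>m n. m \<in> M \<Longrightarrow> n \<in> M \<Longrightarrow> m \<otimes> n = \<zero>"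
    "\<And>r. r \<in> carrier R \<Longrightarrow> \<exists>k\<in>{\<zero>, \<one>, u, u \<oplus> \<one>}. \<exists>m\<in>M. r = k \<oplus> m" "card (carrier R) = 16"
    "u \<otimes> u \<oplus> u \<oplus> \<one> \<in> M"
proof -
  show M: "M = {\<zero>, s, u \<otimes> s, u \<otimes> s \<oplus> s}"
    using M_eq_4[OF M4 two mult_s_in_M[OF u(1)] u(2,3)] .
  have us: "(u \<oplus> \<one>) \<otimes> s = u \<otimes> s \<oplus> s" using u(1) sc by (simp add: l_distr)
  have mult: "\<exists>r\<in>{\<zero>, \<one>, u, u \<oplus> \<one>}. m = r \<otimes> s" if "m \<in> M" for m
    using that sc u(1) us unfolding M by auto
  show "m \<otimes> n = \<zero>" if m: "m \<in> M" and n: "n \<in> M" for m n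
  proof -
    from mult[OF m] obtain r where r0: "r \<in> {\<zero>, \<one>, u, u \<oplus> \<one>}" "m = r \<otimes> s" ..
    then have r: "r \<in> carrier R" "m = r \<otimes> s" using u(1) by (blast intro: zero_closed one_closed a_closed)+
    have nc: "n \<in> carrier R" using n M.Icarr by blast
    have "m \<otimes> n = r \<otimes> (n \<otimes> s)" using r nc sc by (simp add: m_ac)
    then show ?thesis using s(3)[OF n] r by simp
  qed
  have four: "card {\<zero>, s, u \<otimes> s, u \<otimes> s \<oplus> s} = 4" using M M4 by simp
  have img: "(\<lambda>r. r \<otimes> s) ` {\<zero>, \<one>, u, u \<oplus> \<one>} = {\<zero>, s, u \<otimes> s, u \<otimes> s \<oplus> s}"
    using sc u(1) us by simp
  have cK: "card {\<zero>, \<one>, u, u \<oplus> \<one>} = 4"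
  proof (rule antisym)
    show "card {\<zero>, \<one>, u, u \<oplus> \<one>} \<le> 4"
      using card_length[of "[\<zero>, \<one>, u, u \<oplus> \<one>]"] by simp
    show "4 \<le> card {\<zero>, \<one>, u, u \<oplus> \<one>}"
      using card_image_le[of "{\<zero>, \<one>, u, u \<oplus> \<one>}" "\<lambda>r. r \<otimes> s"] four img by simp
  qed
  have inj: "inj_on (\<lambda>r. r \<otimes> s) {\<zero>, \<one>, u, u \<oplus> \<one>}"
    using eq_card_imp_inj_on[of "{\<zero>, \<one>, u, u \<oplus> \<one>}" "\<lambda>r. r \<otimes> s"] four img cK by simp
  have Kc: "{\<zero>, \<one>, u, u \<oplus> \<one>} \<subseteq> carrier R" using u(1) by simp
  have K: "\<forall>k\<in>{\<zero>, \<one>, u, u \<oplus> \<one>}. \<forall>l\<in>{\<zero>, \<one>, u, u \<oplus> \<one>}. k \<ominus> l \<in> M \<longrightarrow> k = l"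
  proof (intro ballI impI)
    fix k l assume kl: "k \<in> {\<zero>, \<one>, u, u \<oplus> \<one>}" "l \<in> {\<zero>, \<one>, u, u \<oplus> \<one>}" "k \<ominus> l \<in> M"
    have "k \<in> carrier R" "l \<in> carrier R" using kl(1,2) Kc by blast+
    then have "k \<otimes> s = l \<otimes> s" using mult_s_eq_iff kl(3) by blast
    then show "k = l" by (rule inj_onD[OF inj _ kl(1,2)])
  qed
  have r: "\<forall>r\<in>carrier R. \<exists>k\<in>{\<zero>, \<one>, u, u \<oplus> \<one>}. r \<ominus> k \<in> M"
  proof
    fix r assume r: "r \<in> carrier R"
    from mult[OF mult_s_in_M[OF r]] obtain k where k: "k \<in> {\<zero>, \<one>, u, u \<oplus> \<one>}" "r \<otimes> s = k \<otimes> s" ..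
    then have "r \<ominus> k \<in> M" using mult_s_eq_iff[OF r, of k] Kc by blast
    then show "\<exists>k\<in>{\<zero>, \<one>, u, u \<oplus> \<one>}. r \<ominus> k \<in> M" using k(1) by blast
  qed
  note T = card_transversal[OF M.is_additive_subgroup Kc K r]
  show "\<exists>k\<in>{\<zero>, \<one>, u, u \<oplus> \<one>}. \<exists>m\<in>M. r = k \<oplus> m" if "r \<in> carrier R" for r
    by (rule T(1)[OF that])
  show "card (carrier R) = 16" using T(2) cK M4 by simp
  have dbl: "s \<oplus> s = \<zero>" using double_s[OF two] .
  have uM: "u \<notin> M" using u mult_s_eq_zero_iff by blast
  have u1M: "u \<oplus> \<one> \<notin> M"
  proof -
    have "u \<otimes> s \<oplus> s \<noteq> \<zero>"
    proof
      assume "u \<otimes> s \<oplus> s = \<zero>"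
      then have "u \<otimes> s \<oplus> s = s \<oplus> s" using dbl by simp
      then show False using u sc by simp
    qed
    then show ?thesis using mult_s_eq_zero_iff[of "u \<oplus> \<one>"] u(1) us by auto
  qed
  \<comment> \<open>Three of the four values are impossible: \<open>0\<close> because
    \<open>u\<close> is a unit, \<open>s\<close> because \<open>(u + 1)^2 s\<close> would vanish
    although \<open>u + 1\<close> is a unit, and \<open>u s\<close> because
    \<open>u (u s - s)\<close> would vanish. Only \<open>u s + s\<close> is left.\<close>
  have uu: "(u \<otimes> u) \<otimes> s \<in> {\<zero>, s, u \<otimes> s, u \<otimes> s \<oplus> s}"
    using mult_s_in_M[of "u \<otimes> u"] u(1) unfolding M by simp
  have n0: "(u \<otimes> u) \<otimes> s \<noteq> \<zero>"
    using mult_s_eq_zero_iff[of "u \<otimes> u"] mult_notin[OF u(1) u(1) uM uM] u(1) by simp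
  have n1: "(u \<otimes> u) \<otimes> s \<noteq> s"
  proof
    assume e: "(u \<otimes> u) \<otimes> s = s"
    have "((u \<oplus> \<one>) \<otimes> (u \<oplus> \<one>)) \<otimes> s = (u \<otimes> u) \<otimes> s \<oplus> s \<oplus> u \<otimes> (s \<oplus> s)"
      using u(1) sc by algebra
    also have "\<dots> = \<zero>" unfolding e dbl using u(1) by simp
    finally show False
      using mult_s_eq_zero_iff[of "(u \<oplus> \<one>) \<otimes> (u \<oplus> \<one>)"] mult_notin[OF _ _ u1M u1M] u(1) by simp
  qed
  have n2: "(u \<otimes> u) \<otimes> s \<noteq> u \<otimes> s"
  proof
    assume e: "(u \<otimes> u) \<otimes> s = u \<otimes> s"
    have "u \<otimes> (u \<otimes> s \<ominus> s) = (u \<otimes> u) \<otimes> s \<ominus> u \<otimes> s"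
      using u(1) sc by algebra
    also have "\<dots> = \<zero>" unfolding e using u(1) sc by (simp add: a_minus_def r_neg)
    finally have "u \<otimes> s \<ominus> s = \<zero>" using cancel[OF u(1) uM] u(1) sc by simp
    then show False using u sc by simp
  qed
  have e: "(u \<otimes> u) \<otimes> s = u \<otimes> s \<oplus> s" using uu n0 n1 n2 by blast
  have "(u \<otimes> u \<oplus> u \<oplus> \<one>) \<otimes> s = (u \<otimes> u) \<otimes> s \<oplus> u \<otimes> s \<oplus> s"
    using u(1) sc by algebra
  also have "\<dots> = u \<otimes> (s \<oplus> s) \<oplus> (s \<oplus> s)" unfolding e using u(1) sc by algebra
  finally have "(u \<otimes> u \<oplus> u \<oplus> \<one>) \<otimes> s = \<zero>" unfolding dbl using u(1) by simp
  then show "u \<otimes> u \<oplus> u \<oplus> \<one> \<in> M"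
    using mult_s_eq_zero_iff[of "u \<otimes> u \<oplus> u \<oplus> \<one>"] u(1) by simp
qed

text \<open>Used with two socle elements: with the given \<open>s\<close>, and with
  \<open>1 + 1\<close> in its place, where the condition \<open>s \<in> D\<close> follows from
  closure under addition.\<close>

lemma residue_field_4_generated:
  assumes M4: "card M = 4" and two: "\<one> \<oplus> \<one> \<in> M" and u: "u \<in> carrier R" "u \<otimes> s \<noteq> \<zero>" "u \<otimes> s \<noteq> s"
    and D: "\<zero> \<in> D" "\<one> \<in> D" "s \<in> D" "\<forall>x\<in>D. \<forall>y\<in>D. x \<oplus> y \<in> D" "\<forall>x\<in>D. u \<otimes> x \<in> D"
  shows "carrier R \<subseteq> D"
proof
  note add = D(4)[rule_format] and mul = D(5)[rule_format]
  note Q = residue_field_4[OF M4 two u]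
  have uD: "u \<in> D" using mul[OF D(2)] u(1) by simp
  fix z assume "z \<in> carrier R"
  from Q(3)[OF this] obtain k m where km: "k \<in> {\<zero>, \<one>, u, u \<oplus> \<one>}" "m \<in> M" "z = k \<oplus> m"
    by (elim bexE)
  have "k \<in> D" using km(1) D(1,2) uD add[OF uD D(2)] by blast
  moreover have "m \<in> D" using km(2) D(1,3) mul[OF D(3)] add[OF mul[OF D(3)] D(3)] unfolding Q(1) by blast
  ultimately show "z \<in> D" unfolding km(3) by (rule add)
qed

text \<open>A Newton step makes \<open>u\<close> an exact root of \<open>X^2 + X + 1\<close>. The
  defect \<open>d\<close> lies in \<open>M\<close>, the derivative \<open>2 u + 1\<close> is
  \<open>1\<close> modulo \<open>M\<close>, and \<open>M\<close> has square zero, so one correction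
  by \<open>d\<close> suffices; its sign does not matter because \<open>2 d = 0\<close>.\<close>

lemma classify_16:
  assumes M4: "card M = 4" and two: "\<one> \<oplus> \<one> \<in> M" and u0: "u \<in> carrier R" "u \<otimes> s \<noteq> \<zero>" "u \<otimes> s \<noteq> s"
  shows "R \<simeq> F4X_X2 \<or> R \<simeq> Z4X_X2_X_1"
proof -
  note Q0 = residue_field_4[OF M4 two u0]
  define d where "d = u \<otimes> u \<oplus> u \<oplus> \<one>"
  define v where "v = u \<oplus> d"
  have d: "d \<in> M" "d \<in> carrier R" using Q0(5) u0(1) by (simp_all add: d_def)
  have v: "v \<in> carrier R" "v \<otimes> s = u \<otimes> s"
    using d u0(1) sc s(3)[OF d(1)] by (simp_all add: v_def l_distr)
  have "v \<otimes> v \<oplus> v \<oplus> \<one> = (u \<otimes> u \<oplus> u \<oplus> \<one>) \<oplus> d \<oplus> (\<one> \<oplus> \<one>) \<otimes> u \<otimes> d \<oplus> d \<otimes> d"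
    unfolding v_def using d(2) u0(1) by algebra
  also have "\<dots> = d \<oplus> d \<oplus> (\<one> \<oplus> \<one>) \<otimes> u \<otimes> d \<oplus> d \<otimes> d"
    by (simp only: d_def[symmetric])
  also have "\<dots> = (\<one> \<oplus> \<one>) \<otimes> d \<oplus> u \<otimes> ((\<one> \<oplus> \<one>) \<otimes> d) \<oplus> d \<otimes> d"
    using d(2) u0(1) by algebra
  also have "\<dots> = \<zero>" using Q0(2)[OF two d(1)] Q0(2)[OF d(1) d(1)] u0(1) by simp
  finally have vv: "v \<otimes> v \<oplus> v \<oplus> \<one> = \<zero>" .
  show ?thesis
  proof (cases "\<one> \<oplus> \<one> = \<zero>")
    case True
    have "ring_generated R {v, s}"
    proof (rule ring_generatedI)
      fix S assume S: "\<zero> \<in> S" "\<one> \<in> S" "\<And>x y. x \<in> S \<Longrightarrow> y \<in> S \<Longrightarrow> x \<oplus> y \<in> S"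
        "\<And>g x. g \<in> {v, s} \<Longrightarrow> x \<in> S \<Longrightarrow> g \<otimes> x \<in> S"
      have sS: "s \<in> S" using S(4)[of s \<one>] S(2) sc by simp
      have "\<forall>x\<in>S. \<forall>y\<in>S. x \<oplus> y \<in> S" "\<forall>x\<in>S. v \<otimes> x \<in> S"
        using S(3,4) by simp_all
      then show "carrier R \<subseteq> S"
        using residue_field_4_generated[OF M4 two v(1) _ _ S(1,2) sS] v(2) u0(2,3) by simp
    qed
    then have "R \<simeq> F4X_X2" using iso_F4X_X2[OF is_cring Q0(4) v(1) sc _ True vv ss] by blast
    then show ?thesis by blast
  next
    case False
    \<comment> \<open>\<open>M\<close> has square zero, so each of its nonzero elements can serve as
      socle element. With \<open>1 + 1\<close> in this role, \<open>v\<close> alone generates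
      \<open>R\<close>.\<close>
    let ?w = "\<one> \<oplus> \<one>"
    interpret w: finite_local_socle R M ?w
      by unfold_locales (fact two, fact False, rule Q0(2)[OF _ two])
    have vM: "v \<notin> M" using v mult_s_eq_zero_iff u0 by metis
    have v1M: "v \<ominus> \<one> \<notin> M" using mult_s_eq_iff[OF v(1) one_closed] v(2) u0 sc by simp
    have v0: "v \<otimes> ?w \<noteq> \<zero>" using w.mult_s_eq_zero_iff[OF v(1)] vM by simp
    have v1: "v \<otimes> ?w \<noteq> ?w" using w.mult_s_eq_iff[OF v(1) one_closed] v1M by simp
    have "ring_generated R {v}"
    proof (rule ring_generatedI)
      fix S assume S: "\<zero> \<in> S" "\<one> \<in> S" "\<And>x y. x \<in> S \<Longrightarrow> y \<in> S \<Longrightarrow> x \<oplus> y \<in> S"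
        "\<And>g x. g \<in> {v} \<Longrightarrow> x \<in> S \<Longrightarrow> g \<otimes> x \<in> S"
      show "carrier R \<subseteq> S"
        by (rule w.residue_field_4_generated[OF M4 two v(1) v0 v1 S(1,2) S(3)[OF S(2) S(2)]]) (use S(3,4) in \<open>simp_all\<close>)
    qed
    then have "R \<simeq> Z4X_X2_X_1"
      using iso_Z4X_X2_X_1[OF is_cring Q0(4) v(1) _ _ vv] w.double_s[OF two] by blast
    then show ?thesis by blast
  qed
qed

end

text \<open>For \<open>M\<close> of order 4, the division between rings of order 8 and 16 is whether
  every unit fixes \<open>s\<close>, that is, whether the residue field has two or four
  elements.\<close>

lemma (in cring) local_planar_classification:
  assumes fin: "finite (carrier R)" and loc: "local_ring R" and planar: "planar_total_graph R"
  shows "field R \<or> R \<simeq> residue_ring 4 \<or> R \<simeq> Z2X_X2 \<or> R \<simeq> Z2X_X3 \<or> R \<simeq> Z2XY_XY2 \<or> R \<simeq> Z4X_2X_X2 \<or>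
    R \<simeq> Z4X_2X_X2m2 \<or> R \<simeq> residue_ring 8 \<or> R \<simeq> F4X_X2 \<or> R \<simeq> Z4X_X2_X_1"
proof -
  obtain M where M: "maximalideal M R" "M = carrier R - Units R"
    by (rule local_ring_nonunits[OF fin loc])
  interpret finite_local R M
    by (intro finite_local.intro finite_local_axioms.intro is_cring fin M)
  show ?thesis
  proof (cases "M = {\<zero>}")
    case True
    then show ?thesis using zeromaximalideal_fieldI M(1) by simp
  next
    case False
    obtain s where s: "s \<in> M" "s \<noteq> \<zero>" "\<forall>m\<in>M. m \<otimes> s = \<zero>"
      by (rule socle_exists[OF False])
    interpret finite_local_socle R M s by unfold_locales (simp_all add: s)
    have two: "\<one> \<oplus> \<one> \<in> M" using two_in_M planar by blast
    have "card {\<zero>, s} \<le> card M" using s finite_M by (intro card_mono) auto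
    moreover have "card {\<zero>, s} = 2" using s by simp
    moreover have "card M < 5"
      using nonplanar_of_five_zero_divisors[OF M.is_additive_subgroup M_zero_divisors] planar by fastforce
    ultimately consider "card M = 2" | "card M = 4" using card_M_not_3[OF two] by linarith
    then show ?thesis
    proof cases
      case 1
      then show ?thesis using classify_2 by blast
    next
      case 2
      show ?thesis
      proof (cases "\<forall>r\<in>carrier R. r \<notin> M \<longrightarrow> r \<otimes> s = s")
        case True
        then show ?thesis using classify_8[OF 2 two] by blast
      next
        case False
        then obtain u where "u \<in> carrier R" "u \<notin> M" "u \<otimes> s \<noteq> s" by blast
        then show ?thesis using classify_16[OF 2 two] mult_s_eq_zero_iff by blast
      qed
    qed
  qed
qed

theorem theorem1p5:
  fixes R :: "('a, 'm) ring_scheme" (structure)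
  assumes "cring R"
    and "finite (carrier R)"
    and "\<one> \<noteq> \<zero>"
    and "planar_total_graph R"
  shows "(local_ring R \<longrightarrow>
            field R \<or>
            R \<simeq> residue_ring 4 \<or>
            R \<simeq> Z2X_X2 \<or>
            R \<simeq> Z2X_X3 \<or>
            R \<simeq> Z2XY_XY2 \<or>
            R \<simeq> Z4X_2X_X2 \<or>
            R \<simeq> Z4X_2X_X2m2 \<or>
            R \<simeq> residue_ring 8 \<or>
            R \<simeq> F4X_X2 \<or>
            R \<simeq> Z4X_X2_X_1) \<and>
         (\<not> local_ring R \<longrightarrow>
            R \<simeq> RDirProd (residue_ring 2) (residue_ring 2) \<or>
            R \<simeq> residue_ring 6)"
proof (intro conjI impI)
  interpret cring R by fact
  show "field R \<or> R \<simeq> residue_ring 4 \<or> R \<simeq> Z2X_X2 \<or> R \<simeq> Z2X_X3 \<or> R \<simeq> Z2XY_XY2 \<or> R \<simeq> Z4X_2X_X2 \<or>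
    R \<simeq> Z4X_2X_X2m2 \<or> R \<simeq> residue_ring 8 \<or> R \<simeq> F4X_X2 \<or> R \<simeq> Z4X_X2_X_1" if "local_ring R"
    using local_planar_classification[OF assms(2) that assms(4)] .
  show "R \<simeq> RDirProd (residue_ring 2) (residue_ring 2) \<or> R \<simeq> residue_ring 6" if "\<not> local_ring R"
    using nonlocal_planar_classification[OF assms(2,3) that assms(4)] .
qed

end
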